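(* Let $d\ge 1$, and let $A_{per}$, $C_{per}:\mathbb{R}^d\to\mathbb{R}^{d\times d}$ be $\mathbb{Z}^d$-periodic measurable tensor fields for which there exist $0<\alpha\le\beta$ such that for all $\xi\in\mathbb{R}^d$ and almost all $x\in\mathbb{R}^d$, $$\alpha|\xi|^2\le A_{per}(x)\xi\cdot\xi,\quad \alpha|\xi|^2\le (A_{per}+C_{per})(x)\xi\cdot\xi,\quad |A_{per}(x)\xi|\le\beta|\xi|,\quad |(A_{per}+C_{per})(x)\xi|\le\beta|\xi|.$$ For odd positive integers $N$, let $A_1^{*,N}\in\mathbb{R}^{d\times d}$ be the matrix defined by $$A_1^{*,N}e_i=\int_{I_N}A_1^0\left(\nabla w_i^{1,0,N}+e_i\right)-\int_{I_N}A_{per}\left(\nabla w_i^0+e_i\right),\qquad 1\le i\le d,$$ where $I_N$, $A_1^0$, $w_i^0$ and $w_i^{1,0,N}$ are defined in the context. Then $A_1^{*,N}$ converges to a finite limit $\bar{A_1^*}$ in $\mathbb{R}^{d\times d}$ when $N\to\infty$.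
   Context: Notation: $Q=[-\frac12,\frac12]^d$; $I_N=[-\frac N2,\frac N2]^d$ for $N$ an odd positive integer; $(e_1,\dots,e_d)$ is the canonical basis of $\mathbb{R}^d$; $\mathbf{1}_Q$ is the indicator function of $Q$ (not periodized inside $I_N$). All equations are understood in the usual weak sense. The periodic corrector $w_i^0$ is the solution (unique up to an additive constant) of $$-\mathrm{div}\left(A_{per}(\nabla w_i^0+e_i)\right)=0\ \text{ in } Q,\qquad w_i^0\ \ \mathbb{Z}^d\text{-periodic}.$$ The tensor with one defect at the origin is $A_1^0=A_{per}+\mathbf{1}_Q C_{per}$. The one-defect supercell corrector $w_i^{1,0,N}$ is the solution (unique up to an additive constant) of $$-\mathrm{div}\left(A_1^0(\nabla w_i^{1,0,N}+e_i)\right)=0\ \text{ in } I_N,\qquad w_i^{1,0,N}\ \ (N\mathbb{Z})^d\text{-periodic}$$ (weak formulation with $(N\mathbb{Z})^d$-periodic $H^1$ test functions on $I_N$). *)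

theory Defs
  imports "HOL-Analysis.Analysis"
begin

subsection \<open>Weak gradients on \<open>\<real>\<^sup>d\<close>\<close>

definition partial_deriv :: "'n::finite \<Rightarrow> (real^'n \<Rightarrow> real) \<Rightarrow> real^'n \<Rightarrow> real" where
  "partial_deriv i f x = frechet_derivative f (at x) (axis i 1)"

primrec C_k :: "nat \<Rightarrow> (real^'n::finite \<Rightarrow> real) \<Rightarrow> bool" where
  "C_k 0 f \<longleftrightarrow> continuous_on UNIV f"
| "C_k (Suc k) f \<longleftrightarrow> (\<forall>x. f differentiable (at x)) \<and> (\<forall>i. C_k k (partial_deriv i f))"

definition test_function :: "(real^'n::finite \<Rightarrow> real) \<Rightarrow> bool" where
  "test_function \<phi> \<longleftrightarrow> (\<forall>k. C_k k \<phi>) \<and> compact (closure {x. \<phi> x \<noteq> 0})"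

definition locally_integrable :: "(real^'n::finite \<Rightarrow> 'b::euclidean_space) \<Rightarrow> bool" where
  "locally_integrable f \<longleftrightarrow> (\<forall>K. compact K \<longrightarrow> set_integrable lebesgue K f)"

definition has_weak_gradient ::
    "(real^'n::finite \<Rightarrow> real) \<Rightarrow> (real^'n \<Rightarrow> real^'n) \<Rightarrow> bool" where
  "has_weak_gradient u g \<longleftrightarrow> locally_integrable u \<and> locally_integrable g \<and>
     (\<forall>\<phi> i. test_function \<phi> \<longrightarrow>
        (LINT x|lebesgue. u x * partial_deriv i \<phi> x) = - (LINT x|lebesgue. g x $ i * \<phi> x))"

(* The weak gradient is unique only up to null sets; weak_gradient u is a representative
   of it, and is unspecified if u has none. *)
definition weak_gradient :: "(real^'n::finite \<Rightarrow> real) \<Rightarrow> real^'n \<Rightarrow> real^'n" where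
  "weak_gradient u = (SOME g. has_weak_gradient u g)"


subsection \<open>Periodic \<open>H\<^sup>1\<close> functions and correctors\<close>

definition cube :: "nat \<Rightarrow> (real^'n::finite) set" where
  "cube N = cbox (\<chi> i. - real N / 2) (\<chi> i. real N / 2)"

(* Fields are identified when they agree almost everywhere, so periodicity is an almost
   everywhere statement as well. *)
definition periodic :: "nat \<Rightarrow> (real^'n::finite \<Rightarrow> 'b) \<Rightarrow> bool" where
  "periodic N f \<longleftrightarrow>
     (\<forall>k :: 'n \<Rightarrow> int. AE x in lebesgue. f (x + (\<chi> i. real N * of_int (k i))) = f x)"

definition square_integrable_on ::
    "(real^'n::finite \<Rightarrow> 'b::euclidean_space) \<Rightarrow> (real^'n) set \<Rightarrow> bool"
    (infixr "square'_integrable'_on" 46) where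
  "f square_integrable_on S \<longleftrightarrow>
     set_borel_measurable lebesgue S f \<and> set_integrable lebesgue S (\<lambda>x. (norm (f x))\<^sup>2)"

(* Periodic functions on the whole space that are locally H^1: the weak gradient is taken on
   the whole space, so that the traces on opposite faces of the cube match. *)
definition H1_per :: "nat \<Rightarrow> (real^'n::finite \<Rightarrow> real) set" where
  "H1_per N = {u. periodic N u \<and> u square_integrable_on cube N \<and>
     (\<exists>g. has_weak_gradient u g) \<and> weak_gradient u square_integrable_on cube N}"

(* Weak form of  - div (A (grad w + e_i)) = 0  in cube N,  w  (N Z)^d-periodic.
   Only the values of A on cube N matter; A itself need not be periodic. *)
definition is_corrector ::
    "nat \<Rightarrow> (real^'n::finite \<Rightarrow> real^'n^'n) \<Rightarrow> 'n \<Rightarrow> (real^'n \<Rightarrow> real) \<Rightarrow> bool" where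
  "is_corrector N A i w \<longleftrightarrow> w \<in> H1_per N \<and>
     (\<forall>v \<in> H1_per N.
        (LINT x:cube N|lebesgue. (A x *v (weak_gradient w x + axis i 1)) \<bullet> weak_gradient v x) = 0)"

definition one_defect ::
    "(real^'n::finite \<Rightarrow> real^'n^'n) \<Rightarrow> (real^'n \<Rightarrow> real^'n^'n) \<Rightarrow> real^'n \<Rightarrow> real^'n^'n" where
  "one_defect A C x = A x + indicator (cube 1) x *\<^sub>R C x"

end

theory Submission
  imports Defs
begin

text \<open>
  Let \<open>u\<close> be the difference of the one-defect correctors for two supercells \<open>I\<^sub>N \<subseteq> I\<^sub>M\<close>. It solves the
  homogeneous equation in \<open>I\<^sub>N\<close>, and comparison with the periodic corrector bounds its energy there
  independently of \<open>N\<close> and \<open>M\<close>. Testing the equation with a cutoff of \<open>u - c\<close> and using the Poincare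
  inequality, the energies \<open>E(R)\<close> of \<open>u\<close> on the cubes of side \<open>R\<close> satisfy
  \<open>E(R)\<^sup>2 \<le> K (E(3R) - E(R)) E(9R)\<close>. Summing over \<open>R = 1, 3, 9, \<dots>\<close> telescopes and shows that \<open>E(1)\<close>
  tends to \<open>0\<close>, so the gradients of the one-defect correctors form a Cauchy sequence in \<open>L\<^sup>2(Q)\<close>.

  The entries of the matrix also contain an integral of \<open>A\<^sub>p\<^sub>e\<^sub>r\<close> over the whole supercell. Summing the
  integrand over the unit cells turns it into an integral over \<open>Q\<close> of a \<open>1\<close>-periodic gradient, which
  solves an equation whose right-hand side only involves the gradient of the one-defect corrector
  on \<open>Q\<close>. Hence it is Cauchy as well; no adjoint corrector, compactness or existence theorem is needed.
\<close>

subsection \<open>Smooth functions\<close>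

text \<open>The uniform energy bound comes from the source: subtracting the periodic problem leaves
  C(grad w0 + e_i), carried by Q only. This bound is too weak twice over. It does not make
  \<open>E(1)\<close> small, and by Cauchy-Schwarz it only bounds the integral of A times the
  gradient difference over I_N by a multiple of N^(d/2). The first gap is closed by hole filling:
  the gradient of the cutoff lives on the shell between the cubes of sides R and 3R, so only the
  energy of that shell enters, and about log N disjoint shells share a bounded total. The resulting
  rate for \<open>E(1)^2\<close> is 1/log N, slow but enough for a Cauchy sequence. The factor 9 is
  the price of an elementary Poincare inequality: differences are integrated along segments that
  leave the cube, which costs a factor 3 in the side. The second gap is closed on the unit torus,
  where folding the gradient difference produces a field whose energy is controlled by an equation
  of its own, irrespective of the size of I_N.\<close>

lemma frechet_derivative_eqI: "(f has_derivative f') (at x) \<Longrightarrow> frechet_derivative f (at x) = f'"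
  by (metis frechet_derivative_at)

lemma partial_derivI: "(f has_derivative f') (at x) \<Longrightarrow> partial_deriv i f x = f' (axis i 1)"
  unfolding partial_deriv_def by (simp add: frechet_derivative_eqI)

lemma partial_deriv_const: "partial_deriv i (\<lambda>x. c) = (\<lambda>x. 0)"
  by (rule ext, rule partial_derivI[OF has_derivative_const])

lemma C_k_SucD: "C_k (Suc k) f \<Longrightarrow> C_k k f"
proof (induction k arbitrary: f)
  case 0
  then have "\<And>x. isCont f x" by (auto intro: differentiable_imp_continuous_within)
  then show ?case by (simp add: continuous_at_imp_continuous_on)
qed auto

lemma C_k_const: "C_k k (\<lambda>x. c)"
proof (induction k arbitrary: c)
  case (Suc k)
  show ?case using Suc[of 0] by (simp add: partial_deriv_const)
qed simp

lemma C_k_add: "C_k k f \<Longrightarrow> C_k k g \<Longrightarrow> C_k k (\<lambda>x. f x + g x)"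
proof (induction k arbitrary: f g)
  case 0 then show ?case by (auto intro!: continuous_intros)
next
  case (Suc k)
  have "partial_deriv i (\<lambda>x. f x + g x) = (\<lambda>x. partial_deriv i f x + partial_deriv i g x)" for i
  proof
    fix x
    have "(f has_derivative frechet_derivative f (at x)) (at x)"
      and "(g has_derivative frechet_derivative g (at x)) (at x)"
      using Suc.prems by (auto simp: frechet_derivative_works)
    from partial_derivI[OF has_derivative_add[OF this]]
    show "partial_deriv i (\<lambda>x. f x + g x) x = partial_deriv i f x + partial_deriv i g x"
      by (simp add: partial_deriv_def)
  qed
  with Suc show ?case by simp
qed

lemma C_k_mult: "C_k k f \<Longrightarrow> C_k k g \<Longrightarrow> C_k k (\<lambda>x. f x * g x)"
proof (induction k arbitrary: f g)
  case 0 then show ?case by (auto intro!: continuous_intros)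
next
  case (Suc k)
  have "partial_deriv i (\<lambda>x. f x * g x) = (\<lambda>x. f x * partial_deriv i g x + partial_deriv i f x * g x)" for i
  proof
    fix x
    have "(f has_derivative frechet_derivative f (at x)) (at x)"
      and "(g has_derivative frechet_derivative g (at x)) (at x)"
      using Suc.prems by (auto simp: frechet_derivative_works)
    from partial_derivI[OF has_derivative_mult[OF this]]
    show "partial_deriv i (\<lambda>x. f x * g x) x = f x * partial_deriv i g x + partial_deriv i f x * g x"
      by (simp add: partial_deriv_def)
  qed
  moreover have "C_k k f" "C_k k g" using Suc.prems C_k_SucD by blast+
  ultimately show ?case using Suc by (auto intro!: C_k_add)
qed

lemma C_k_cmult: "C_k k f \<Longrightarrow> C_k k (\<lambda>x. c * f x)"
  by (rule C_k_mult[OF C_k_const])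

lemma C_k_prod:
  assumes "\<And>j. j \<in> J \<Longrightarrow> C_k k (f j)"
  shows "C_k k (\<lambda>x. \<Prod>j\<in>J. f j x)"
  using assms by (induction J rule: infinite_finite_induct) (auto intro: C_k_const C_k_mult)

text \<open>The derivative of 1/f is -f'/f^2, in which 1/f is needed to order k only; this is the
  induction hypothesis, available through \<open>C_k_SucD\<close>.\<close>

lemma C_k_inverse:
  assumes "\<And>x. f x \<noteq> 0"
  shows "C_k k f \<Longrightarrow> C_k k (\<lambda>x. inverse (f x))"
proof (induction k)
  case 0 then show ?case using assms by (auto intro!: continuous_intros)
next
  case (Suc k)
  have D: "((\<lambda>x. inverse (f x)) has_derivative
      (\<lambda>h. - (inverse (f x) * frechet_derivative f (at x) h * inverse (f x)))) (at x)" for x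
    using Suc.prems assms frechet_derivative_works[of f "at x"]
    by (intro Deriv.has_derivative_inverse) auto
  have "partial_deriv i (\<lambda>x. inverse (f x)) =
      (\<lambda>x. (- 1) * (inverse (f x) * partial_deriv i f x * inverse (f x)))" for i
    by (rule ext, subst partial_derivI[OF D]) (simp add: partial_deriv_def)
  moreover have "C_k k (\<lambda>x. inverse (f x))" using Suc C_k_SucD by blast
  moreover have "C_k k (partial_deriv i f)" for i using Suc.prems by simp
  ultimately have "C_k k (partial_deriv i (\<lambda>x. inverse (f x)))" for i
    by (simp only:) (intro C_k_cmult C_k_mult)
  moreover have "(\<lambda>x. inverse (f x)) differentiable at x" for x
    using D unfolding differentiable_def by blast
  ultimately show ?case by simp
qed

lemma has_derivative_affine_arg:
  assumes "f differentiable (at (c *\<^sub>R x + a))"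
  shows "((\<lambda>x. f (c *\<^sub>R x + a)) has_derivative
    (\<lambda>h. frechet_derivative f (at (c *\<^sub>R x + a)) (c *\<^sub>R h))) (at x)"
proof -
  have "((\<lambda>x. c *\<^sub>R x + a) has_derivative (\<lambda>h. c *\<^sub>R h)) (at x)"
    by (auto intro!: derivative_eq_intros)
  from diff_chain_at[OF this, of f] assms show ?thesis
    by (auto simp: o_def frechet_derivative_works)
qed

lemma partial_deriv_affine_arg:
  assumes "f differentiable (at (c *\<^sub>R x + a))"
  shows "partial_deriv i (\<lambda>x. f (c *\<^sub>R x + a)) x = c * partial_deriv i f (c *\<^sub>R x + a)"
proof -
  have "frechet_derivative f (at (c *\<^sub>R x + a)) (c *\<^sub>R axis i 1)
      = c * frechet_derivative f (at (c *\<^sub>R x + a)) (axis i 1)"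
    using linear_frechet_derivative[OF assms] by (simp add: linear_scale)
  then show ?thesis
    by (subst partial_derivI[OF has_derivative_affine_arg[OF assms]]) (simp add: partial_deriv_def)
qed

lemma C_k_affine_arg: "C_k k f \<Longrightarrow> C_k k (\<lambda>x. f (c *\<^sub>R x + a))"
proof (induction k arbitrary: f)
  case 0
  then have "continuous_on UNIV f" by simp
  then have "continuous_on UNIV (\<lambda>x. f (c *\<^sub>R x + a))"
    by (rule continuous_on_compose2) (auto intro!: continuous_on_add continuous_on_scaleR continuous_on_const continuous_on_id)
  then show ?case by simp
next
  case (Suc k)
  have "partial_deriv i (\<lambda>x. f (c *\<^sub>R x + a)) = (\<lambda>x. c * partial_deriv i f (c *\<^sub>R x + a))" for i
    using Suc.prems by (auto simp: partial_deriv_affine_arg)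
  moreover have "(\<lambda>x. f (c *\<^sub>R x + a)) differentiable (at x)" for x
    using has_derivative_affine_arg Suc.prems unfolding differentiable_def C_k.simps by metis
  ultimately show ?case using Suc by (auto intro!: C_k_cmult)
qed

section \<open>A smooth step function\<close>

definition flat_exp :: "nat \<Rightarrow> real \<Rightarrow> real" where
  "flat_exp m t = (if t \<le> 0 then 0 else exp (- 1 / t) / t ^ m)"

text \<open>The functions exp(-1/t)/t^m, extended by 0, are closed under differentiation up to
  linear combinations with larger m. Carrying all m along is what makes the induction on the order
  of smoothness work.\<close>

lemma flat_exp_DERIV:
  "(flat_exp m has_real_derivative flat_exp (m + 2) t - real m * flat_exp (m + 1) t) (at t)"
proof -
  consider "t < 0" | "t > 0" | "t = 0" by linarith
  then show ?thesis
  proof cases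
    case 1
    have "((\<lambda>t. 0) has_real_derivative 0) (at t)" by simp
    then have "(flat_exp m has_real_derivative 0) (at t)"
      by (rule has_field_derivative_transform_within_open[where S="{..<0}"])
         (use 1 in \<open>auto simp: flat_exp_def\<close>)
    then show ?thesis using 1 by (simp add: flat_exp_def)
  next
    case 2
    have "((\<lambda>t. exp (- 1 / t) / t ^ m) has_real_derivative
       flat_exp (m + 2) t - real m * flat_exp (m + 1) t) (at t)"
    proof (cases m)
      case 0 then show ?thesis using 2
        by (auto intro!: derivative_eq_intros simp: flat_exp_def divide_simps power2_eq_square)
    next
      case (Suc n)
      have "((\<lambda>t. exp (- 1 / t) / t ^ m) has_real_derivative
        (exp (- 1 / t) * (1 / t\<^sup>2) * t ^ m - exp (- 1 / t) * (real m * t ^ (m - 1))) / (t ^ m)\<^sup>2) (at t)"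
        using 2 by (auto intro!: derivative_eq_intros simp: power2_eq_square divide_simps)
      also have "(exp (- 1 / t) * (1 / t\<^sup>2) * t ^ m - exp (- 1 / t) * (real m * t ^ (m - 1))) / (t ^ m)\<^sup>2
         = flat_exp (m + 2) t - real m * flat_exp (m + 1) t"
        using 2 by (simp add: flat_exp_def Suc divide_simps power2_eq_square) (simp add: algebra_simps)
      finally show ?thesis .
    qed
    then show ?thesis
      by (rule has_field_derivative_transform_within_open[where S="{0<..}"])
         (use 2 in \<open>auto simp: flat_exp_def\<close>)
  next
    case 3
    \<comment> \<open>The delicate point is 0: from the right the difference quotient is
      s^(m+1)/exp(s) with s = 1/h, and the exponential wins.\<close>
    have "((\<lambda>h. flat_exp m h / h) \<longlongrightarrow> 0) (at 0)"
    proof (rule filterlim_split_at)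
      have "((\<lambda>h::real. 0::real) \<longlongrightarrow> 0) (at_left 0)" by simp
      then show "((\<lambda>h. flat_exp m h / h) \<longlongrightarrow> 0) (at_left 0)"
        by (rule Lim_transform_eventually)
           (auto simp: eventually_at_filter flat_exp_def)
      have "((\<lambda>h::real. exp (- 1 / h) / h ^ m / h) \<longlongrightarrow> 0) (at_right 0)"
      proof (rule Lim_transform_eventually)
        have "filterlim (\<lambda>h::real. inverse h) at_top (at_right 0)"
          by (rule filterlim_inverse_at_top_right)
        then show "((\<lambda>h::real. inverse h ^ Suc m / exp (inverse h)) \<longlongrightarrow> 0) (at_right 0)"
          by (rule filterlim_compose[OF tendsto_power_div_exp_0])
      qed (auto simp: eventually_at_filter exp_minus field_simps)
      then show "((\<lambda>h. flat_exp m h / h) \<longlongrightarrow> 0) (at_right 0)"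
        by (rule Lim_transform_eventually)
           (auto simp: eventually_at_filter flat_exp_def)
    qed
    then show ?thesis using 3 by (simp add: DERIV_def flat_exp_def)
  qed
qed

lemma has_derivative_coord:
  assumes "(f has_real_derivative d) (at (a * x $ j + b))"
  shows "((\<lambda>x::real^'n::finite. f (a * x $ j + b)) has_derivative (\<lambda>h. d * (a * h $ j))) (at x)"
proof -
  have "((\<lambda>x::real^'n. a * x $ j + b) has_derivative (\<lambda>h. a * h $ j)) (at x)"
    by (auto intro!: derivative_eq_intros bounded_linear.has_derivative[OF bounded_linear_vec_nth])
  from diff_chain_at[OF this, of f] assms show ?thesis
    by (auto simp: o_def has_field_derivative_def)
qed

lemma C_k_flat_exp: "C_k k (\<lambda>x::real^'n::finite. flat_exp m (a * x $ j + b))"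
proof (induction k arbitrary: m)
  case 0
  have "continuous_on UNIV (flat_exp m)"
    using DERIV_isCont[OF flat_exp_DERIV] by (intro continuous_at_imp_continuous_on ballI)
  then have "continuous_on UNIV (\<lambda>x::real^'n. flat_exp m (a * x $ j + b))"
    by (rule continuous_on_compose2) (auto intro!: continuous_intros)
  then show ?case by simp
next
  case (Suc k)
  note D = has_derivative_coord[OF flat_exp_DERIV[of m], where a=a and j=j and b=b]
  have "partial_deriv i (\<lambda>x::real^'n. flat_exp m (a * x $ j + b)) x =
     (a * axis i 1 $ j) * (flat_exp (m + 2) (a * x $ j + b) + (- real m) * flat_exp (m + 1) (a * x $ j + b))"
    for i x
    by (rule trans[OF partial_derivI[OF D]]) (simp only: mult_ac diff_conv_add_uminus mult_minus_left)
  then have "partial_deriv i (\<lambda>x::real^'n. flat_exp m (a * x $ j + b)) = (\<lambda>x.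
     (a * axis i 1 $ j) * (flat_exp (m + 2) (a * x $ j + b) + (- real m) * flat_exp (m + 1) (a * x $ j + b)))" for i
    by (rule ext)
  moreover have "C_k k (\<lambda>x::real^'n. (a * axis i 1 $ j) *
     (flat_exp (m + 2) (a * x $ j + b) + (- real m) * flat_exp (m + 1) (a * x $ j + b)))" for i
    by (rule C_k_cmult, rule C_k_add[OF Suc C_k_cmult[OF Suc]])
  ultimately have "C_k k (partial_deriv i (\<lambda>x::real^'n. flat_exp m (a * x $ j + b)))" for i
    by metis
  moreover have "(\<lambda>x::real^'n. flat_exp m (a * x $ j + b)) differentiable at x" for x
    using D unfolding differentiable_def by blast
  ultimately show ?case by simp
qed

definition smooth_step :: "real \<Rightarrow> real" where
  "smooth_step t = flat_exp 0 t * inverse (flat_exp 0 t + flat_exp 0 (1 - t))"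

lemma flat_exp_nonneg: "0 \<le> flat_exp m t"
  by (simp add: flat_exp_def)

text \<open>Of t and 1 - t at least one is positive.\<close>

lemma smooth_step_denom_pos: "0 < flat_exp 0 t + flat_exp 0 (1 - t)"
  by (auto simp: flat_exp_def add_pos_pos)

lemma smooth_step_bounds: "0 \<le> smooth_step t" "smooth_step t \<le> 1"
  and smooth_step_0: "t \<le> 0 \<Longrightarrow> smooth_step t = 0"
  and smooth_step_1: "1 \<le> t \<Longrightarrow> smooth_step t = 1"
  using smooth_step_denom_pos[of t] flat_exp_nonneg[of 0 t] flat_exp_nonneg[of 0 "1-t"]
  by (auto simp: smooth_step_def flat_exp_def divide_simps)

lemma C_k_smooth_step: "C_k k (\<lambda>x::real^'n::finite. smooth_step (a * x $ j + b))"
proof -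
  have eq: "1 - (a * x $ j + b) = (- a) * x $ j + (1 - b)" for x :: "real^'n" by simp
  have "C_k k (\<lambda>x::real^'n. flat_exp 0 (a * x $ j + b) + flat_exp 0 (1 - (a * x $ j + b)))"
    unfolding eq by (rule C_k_add[OF C_k_flat_exp C_k_flat_exp])
  moreover have "flat_exp 0 (a * x $ j + b) + flat_exp 0 (1 - (a * x $ j + b)) \<noteq> 0" for x :: "real^'n"
    using smooth_step_denom_pos less_irrefl by metis
  ultimately have "C_k k (\<lambda>x::real^'n. inverse (flat_exp 0 (a * x $ j + b) + flat_exp 0 (1 - (a * x $ j + b))))"
    by (intro C_k_inverse)
  then show ?thesis unfolding smooth_step_def
    by (intro C_k_mult C_k_flat_exp)
qed

section \<open>Cubes, gradients and test functions\<close>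

lemma mem_cube: "x \<in> cube N \<longleftrightarrow> (\<forall>i. \<bar>x $ i\<bar> \<le> real N / 2)"
proof -
  have "\<bar>x $ i\<bar> \<le> real N / 2 \<longleftrightarrow> - real N / 2 \<le> x $ i \<and> x $ i \<le> real N / 2" for i
    by linarith
  then show ?thesis by (simp add: cube_def mem_box_cart)
qed

lemma compact_cube: "compact (cube N)" and closed_cube: "closed (cube N)"
  by (simp_all add: cube_def compact_cbox closed_cbox)

lemma cube_mono: "M \<le> N \<Longrightarrow> cube M \<subseteq> (cube N :: (real^'n::finite) set)"
proof
  fix x :: "real^'n" assume "M \<le> N" "x \<in> cube M"
  have "\<bar>x $ i\<bar> \<le> real N / 2" for i
    using \<open>x \<in> cube M\<close>[unfolded mem_cube, rule_format, of i] \<open>M \<le> N\<close> by linarith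
  then show "x \<in> cube N" by (simp add: mem_cube)
qed

lemma compact_subset_cube:
  assumes "compact K" shows "\<exists>N. K \<subseteq> cube N"
proof -
  obtain B where B: "\<And>x. x \<in> K \<Longrightarrow> norm x \<le> B"
    using compact_imp_bounded[OF assms] unfolding bounded_iff by blast
  obtain N :: nat where N: "2 * B \<le> real N" using real_arch_simple by blast
  have "K \<subseteq> cube N"
  proof
    fix x assume "x \<in> K"
    have "\<bar>x $ i\<bar> \<le> real N / 2" for i
      using B[OF \<open>x \<in> K\<close>] N component_le_norm_cart[of x i] by linarith
    then show "x \<in> cube N" by (simp add: mem_cube)
  qed
  then show ?thesis ..
qed

definition grad :: "(real^'n::finite \<Rightarrow> real) \<Rightarrow> real^'n \<Rightarrow> real^'n" where
  "grad f x = (\<chi> i. partial_deriv i f x)"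

lemma grad_nth [simp]: "grad f x $ i = partial_deriv i f x"
  by (simp add: grad_def)

lemma has_derivative_grad:
  assumes "f differentiable (at x)"
  shows "(f has_derivative (\<lambda>h. h \<bullet> grad f x)) (at x)"
proof -
  let ?D = "frechet_derivative f (at x)"
  have L: "linear ?D" using linear_frechet_derivative[OF assms] .
  have "?D h = h \<bullet> grad f x" for h
  proof -
    have "?D h = ?D (\<Sum>i\<in>UNIV. (h $ i) *s axis i 1)" by (simp add: basis_expansion)
    also have "\<dots> = (\<Sum>i\<in>UNIV. h $ i * ?D (axis i 1))"
      by (simp add: linear_sum[OF L] linear_scale[OF L] scalar_mult_eq_scaleR)
    finally show ?thesis by (simp add: inner_vec_def partial_deriv_def)
  qed
  then have "?D = (\<lambda>h. h \<bullet> grad f x)" by auto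
  with assms show ?thesis by (simp add: frechet_derivative_works)
qed

lemma test_functionI:
  assumes "\<And>k. C_k k f" "\<And>x. x \<notin> cube N \<Longrightarrow> f x = 0"
  shows "test_function f"
proof -
  have "closure {x. f x \<noteq> 0} \<subseteq> cube N"
    by (rule closure_minimal[OF _ closed_cube]) (use assms(2) in blast)
  then have "compact (closure {x. f x \<noteq> 0})"
    using compact_Int_closed[OF compact_cube[of N] closed_closure[of "{x. f x \<noteq> 0}"]]
    by (simp add: Int_absorb1)
  with assms(1) show ?thesis by (simp add: test_function_def)
qed

lemma test_function_C_k: "test_function f \<Longrightarrow> C_k k f"
  by (simp add: test_function_def)

lemma test_function_differentiable: "test_function f \<Longrightarrow> f differentiable (at x)"
  using test_function_C_k[of f "Suc 0"] by simp

lemma test_function_support: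
  assumes "test_function f" obtains N where "\<And>x. x \<notin> cube N \<Longrightarrow> f x = 0"
proof -
  have "compact (closure {x. f x \<noteq> 0})" using assms by (simp add: test_function_def)
  then obtain N where "closure {x. f x \<noteq> 0} \<subseteq> cube N" using compact_subset_cube by blast
  then have "{x. f x \<noteq> 0} \<subseteq> cube N" using closure_subset by (rule subset_trans[rotated])
  then show ?thesis by (intro that[of N]) blast
qed

lemma partial_deriv_zero_outside:
  fixes S :: "(real^'n::finite) set"
  assumes "closed S" "\<And>x. x \<notin> S \<Longrightarrow> f x = 0" "x \<notin> S"
  shows "partial_deriv i f x = 0"
proof -
  have "((\<lambda>x. 0) has_derivative (\<lambda>h. 0)) (at x)" by simp
  then have "(f has_derivative (\<lambda>h. 0)) (at x)"
    by (rule has_derivative_transform_within_open[of _ _ _ _ "- S"]) (use assms in auto)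
  from partial_derivI[OF this] show ?thesis by simp
qed

lemma test_function_partial_deriv:
  assumes "test_function f" shows "test_function (partial_deriv i f)"
proof -
  obtain N where N: "\<And>x. x \<notin> cube N \<Longrightarrow> f x = 0" using test_function_support[OF assms] by blast
  have "C_k k (partial_deriv i f)" for k using test_function_C_k[OF assms, of "Suc k"] by simp
  then show ?thesis
    by (rule test_functionI) (rule partial_deriv_zero_outside[OF closed_cube N])
qed

lemma test_function_mult:
  assumes "test_function f" "\<And>k. C_k k g" shows "test_function (\<lambda>x. g x * f x)"
proof -
  obtain N where N: "\<And>x. x \<notin> cube N \<Longrightarrow> f x = 0" using test_function_support[OF assms(1)] by blast
  show ?thesis
  proof (rule test_functionI[where N=N])
    show "C_k k (\<lambda>x. g x * f x)" for k
      by (intro C_k_mult assms(2) test_function_C_k assms(1))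
  qed (simp add: N)
qed

lemma test_function_affine_arg:
  fixes a :: "real^'n::finite" and f :: "real^'n::finite \<Rightarrow> real"
  assumes "test_function f" "c \<noteq> 0" shows "test_function (\<lambda>x. f (c *\<^sub>R x + a))"
proof -
  have "compact ((\<lambda>x::real^'n. (1 / c) *\<^sub>R (x - a)) ` closure {x. f x \<noteq> 0})"
    using assms by (intro compact_continuous_image continuous_intros) (simp add: test_function_def)
  then obtain N where N: "(\<lambda>x::real^'n. (1 / c) *\<^sub>R (x - a)) ` closure {x. f x \<noteq> 0} \<subseteq> cube N"
    using compact_subset_cube by blast
  show ?thesis
  proof (rule test_functionI[where N=N])
    show "C_k k (\<lambda>x::real^'n. f (c *\<^sub>R x + a))" for k
      using assms by (intro C_k_affine_arg test_function_C_k)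
    fix x :: "real^'n" assume x: "x \<notin> cube N"
    show "f (c *\<^sub>R x + a) = 0"
    proof (rule ccontr)
      assume "f (c *\<^sub>R x + a) \<noteq> 0"
      then have "c *\<^sub>R x + a \<in> closure {x. f x \<noteq> 0}"
        by (intro subsetD[OF closure_subset]) simp
      then have "(1 / c) *\<^sub>R (c *\<^sub>R x + a - a) \<in> cube N" using N by blast
      then show False using x \<open>c \<noteq> 0\<close> by simp
    qed
  qed
qed

lemma test_function_continuous: "test_function f \<Longrightarrow> continuous_on UNIV f"
  using test_function_C_k[of f 0] by simp

lemma test_function_borel [measurable_dest]: "test_function f \<Longrightarrow> f \<in> borel_measurable borel"
  by (intro borel_measurable_continuous_onI test_function_continuous)

lemma test_function_bounded:
  assumes "test_function f" obtains B where "0 \<le> B" "\<And>x. \<bar>f x\<bar> \<le> B"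
proof -
  obtain N where N: "\<And>x. x \<notin> cube N \<Longrightarrow> f x = 0" using test_function_support[OF assms] by blast
  have "compact (f ` cube N)"
    by (intro compact_continuous_image compact_cube)
       (use test_function_continuous[OF assms] continuous_on_subset in blast)
  then have "bounded (f ` cube N)" by (rule compact_imp_bounded)
  then obtain B where B: "\<And>x. x \<in> cube N \<Longrightarrow> \<bar>f x\<bar> \<le> B"
    by (auto simp: bounded_iff)
  show ?thesis
    by (rule that[of "max 0 B"]) (use B N in \<open>force simp: le_max_iff_disj\<close>)+
qed

lemma test_function_grad_bounded:
  assumes "test_function f" obtains B where "0 \<le> B" "\<And>x. norm (grad f x) \<le> B"
proof -
  have "\<forall>i. \<exists>B. 0 \<le> B \<and> (\<forall>x. \<bar>partial_deriv i f x\<bar> \<le> B)"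
    using test_function_bounded[OF test_function_partial_deriv[OF assms]] by metis
  then obtain B where B: "\<And>i. 0 \<le> B i" "\<And>i x. \<bar>partial_deriv i f x\<bar> \<le> B i" by metis
  show ?thesis
  proof (rule that[of "\<Sum>i\<in>UNIV. B i"])
    show "0 \<le> (\<Sum>i\<in>UNIV. B i)" using B by (simp add: sum_nonneg)
    show "norm (grad f x) \<le> (\<Sum>i\<in>UNIV. B i)" for x
    proof -
      have "(\<Sum>i\<in>UNIV. \<bar>grad f x $ i\<bar>) \<le> (\<Sum>i\<in>UNIV. B i)" using B by (intro sum_mono) simp
      then show ?thesis using norm_le_l1_cart[of "grad f x"] by linarith
    qed
  qed
qed

lemma test_function_grad_borel [measurable_dest]:
  fixes f :: "real^'n::finite \<Rightarrow> real"
  assumes "test_function f" shows "grad f \<in> borel_measurable borel"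
proof (subst borel_measurable_euclidean_space, rule ballI)
  fix b :: "real^'n" assume "b \<in> Basis"
  then obtain i where b: "b = axis i 1" by (auto simp: Basis_vec_def)
  show "(\<lambda>x. grad f x \<bullet> b) \<in> borel_measurable borel"
    using test_function_borel[OF test_function_partial_deriv[OF assms]] by (simp add: b inner_axis)
qed

text \<open>Products over the coordinates of steps of width 1/n placed just inside the two faces: at
  an interior point every factor is 1 for large n, outside the open box one factor is 0. Integrals
  over boxes are thereby reached from integrals against test functions.\<close>

lemma box_indicator_test_functions:
  fixes a b :: "real^'n::finite"
  obtains \<phi> where "\<And>n::nat. test_function (\<phi> n)"
    "\<And>n x. 0 \<le> \<phi> n x \<and> \<phi> n x \<le> 1" "\<And>n x. x \<notin> box a b \<Longrightarrow> \<phi> n x = 0"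
    "\<And>x. (\<lambda>n. \<phi> n x) \<longlonglongrightarrow> indicator (box a b) x"
proof -
  define \<phi> where "\<phi> n x = (\<Prod>j\<in>UNIV. smooth_step (real n * x $ j + - real n * a $ j) *
     smooth_step (- real n * x $ j + real n * b $ j))" for n :: nat and x :: "real^'n"
  have lim1: "(\<lambda>n. smooth_step (real n * s)) \<longlonglongrightarrow> (if s > 0 then 1 else 0)" for s
  proof (cases "s > 0")
    case True
    then obtain N :: nat where N: "1 < real N * s" using reals_Archimedean3 by blast
    have "\<forall>\<^sub>F n in sequentially. smooth_step (real n * s) = 1"
    proof (rule eventually_sequentiallyI[of N])
      fix n assume "N \<le> n"
      then have "real N * s \<le> real n * s" using True by (simp add: mult_right_mono)
      then show "smooth_step (real n * s) = 1" using N by (intro smooth_step_1) simp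
    qed
    then show ?thesis using True by (simp add: tendsto_eventually)
  next
    case False
    then have "smooth_step (real n * s) = 0" for n
      by (intro smooth_step_0) (simp add: mult_nonneg_nonpos)
    then show ?thesis using False by simp
  qed
  have zero: "\<phi> n x = 0" if out: "x \<notin> box a b" for n x
  proof -
    obtain j where "x $ j \<le> a $ j \<or> b $ j \<le> x $ j"
      using out unfolding mem_box_cart by (metis not_less)
    then have "real n * x $ j + - real n * a $ j \<le> 0 \<or> - real n * x $ j + real n * b $ j \<le> 0"
      using mult_left_mono[of _ _ "real n"] by auto
    then have "smooth_step (real n * x $ j + - real n * a $ j) *
      smooth_step (- real n * x $ j + real n * b $ j) = 0"
      using smooth_step_0 by auto
    then show ?thesis unfolding \<phi>_def by (intro prod_zero bexI[of _ j]) auto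
  qed
  show ?thesis
  proof (rule that)
    fix n
    have "bounded (box a b)" by (rule bounded_box)
    then obtain N where N: "closure (box a b) \<subseteq> cube N"
      using compact_subset_cube compact_closure by blast
    show "test_function (\<phi> n)"
    proof (rule test_functionI)
      show "C_k k (\<phi> n)" for k unfolding \<phi>_def by (intro C_k_prod C_k_mult C_k_smooth_step)
      show "\<phi> n x = 0" if "x \<notin> cube N" for x
        using zero N that closure_subset by blast
    qed
  next
    fix n x show "0 \<le> \<phi> n x \<and> \<phi> n x \<le> 1" unfolding \<phi>_def
      by (intro conjI prod_nonneg prod_le_1 mult_nonneg_nonneg mult_le_one smooth_step_bounds)
  next
    fix x
    have "(\<lambda>n. \<phi> n x) \<longlonglongrightarrow> (\<Prod>j\<in>UNIV. (if x $ j - a $ j > 0 then 1 else 0) *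
       (if b $ j - x $ j > 0 then 1 else 0))"
    proof -
      have "\<phi> n x = (\<Prod>j\<in>UNIV. smooth_step (real n * (x $ j - a $ j)) *
         smooth_step (real n * (b $ j - x $ j)))" for n
        unfolding \<phi>_def by (simp add: algebra_simps)
      then show ?thesis by (simp only:) (intro tendsto_prod tendsto_mult lim1)
    qed
    also have "(\<Prod>j\<in>UNIV. (if x $ j - a $ j > 0 then 1 else 0) *
       (if b $ j - x $ j > 0 then 1 else (0::real))) = indicator (box a b) x"
    proof (cases "x \<in> box a b")
      case True
      then show ?thesis by (auto simp: mem_box_cart)
    next
      case False
      then obtain j where "\<not> (a $ j < x $ j \<and> x $ j < b $ j)" unfolding mem_box_cart by blast
      then have "(if x $ j - a $ j > 0 then 1 else 0) * (if b $ j - x $ j > 0 then 1 else (0::real)) = 0"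
        by auto
      then have "(\<Prod>j\<in>UNIV. (if x $ j - a $ j > 0 then 1 else 0) *
        (if b $ j - x $ j > 0 then 1 else (0::real))) = 0"
        by (intro prod_zero bexI[of _ j]) auto
      then show ?thesis using False by simp
    qed
    finally show "(\<lambda>n. \<phi> n x) \<longlonglongrightarrow> indicator (box a b) x" .
  qed (rule zero)
qed

lemma cutoff_unit:
  obtains \<eta> :: "real^'n::finite \<Rightarrow> real" where "test_function \<eta>" "\<And>x. 0 \<le> \<eta> x" "\<And>x. \<eta> x \<le> 1"
    "\<And>x. x \<in> cube 1 \<Longrightarrow> \<eta> x = 1" "\<And>x. \<exists>i. 3 / 2 \<le> \<bar>x $ i\<bar> \<Longrightarrow> \<eta> x = 0"
proof -
  \<comment> \<open>The offset 3/2 lets each factor change from 0 to 1 between the faces of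
    \<open>cube 3\<close>, at distance 3/2, and those of \<open>cube 1\<close>, at distance
    1/2.\<close>
  define \<eta> :: "real^'n \<Rightarrow> real"
    where "\<eta> x = (\<Prod>j\<in>UNIV. smooth_step (1 * x $ j + 3 / 2) * smooth_step ((-1) * x $ j + 3 / 2))" for x
  have zero: "\<eta> x = 0" if out: "\<exists>i. 3 / 2 \<le> \<bar>x $ i\<bar>" for x
  proof -
    obtain j where "3 / 2 \<le> \<bar>x $ j\<bar>" using out ..
    then have "1 * x $ j + 3 / 2 \<le> 0 \<or> (-1) * x $ j + 3 / 2 \<le> 0" by auto
    then have "smooth_step (1 * x $ j + 3 / 2) * smooth_step ((-1) * x $ j + 3 / 2) = 0"
      using smooth_step_0 by auto
    then show ?thesis unfolding \<eta>_def by (intro prod_zero bexI[of _ j]) auto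
  qed
  show ?thesis
  proof (rule that)
    show "test_function \<eta>"
    proof (rule test_functionI[where N=3])
      show "C_k k \<eta>" for k unfolding \<eta>_def by (intro C_k_prod C_k_mult C_k_smooth_step)
      fix x :: "real^'n" assume "x \<notin> cube 3"
      then obtain i where "\<not> \<bar>x $ i\<bar> \<le> 3 / 2" unfolding mem_cube by auto
      then show "\<eta> x = 0" by (intro zero exI[of _ i]) linarith
    qed
    fix x
    show "0 \<le> \<eta> x" "\<eta> x \<le> 1" unfolding \<eta>_def
      by (intro conjI prod_nonneg prod_le_1 mult_nonneg_nonneg mult_le_one smooth_step_bounds)+
    show "\<eta> x = 1" if "x \<in> cube 1"
    proof -
      have "1 \<le> 1 * x $ j + 3 / 2" "1 \<le> (-1) * x $ j + 3 / 2" for j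
        using that[unfolded mem_cube, rule_format, of j] by auto
      then show ?thesis unfolding \<eta>_def by (simp add: smooth_step_1 del: mult_1 mult_minus1)
    qed
  qed (rule zero)
qed

text \<open>A cutoff with values in [0,1] has an extremum wherever it equals 0 or 1, so its gradient
  vanishes on the closed plateaus, faces included.\<close>

lemma grad_zero_at_extremum:
  assumes "f differentiable (at x)" "(\<forall>y. f y \<le> f x) \<or> (\<forall>y. f x \<le> f y)"
  shows "grad f x = 0"
proof -
  have "(\<lambda>h. h \<bullet> grad f x) = (\<lambda>h. 0)"
    by (rule differential_zero_maxmin[OF UNIV_I open_UNIV has_derivative_grad[OF assms(1)]])
       (use assms(2) in simp)
  then show ?thesis by (metis inner_eq_zero_iff)
qed

text \<open>Rescaling of the unit cutoff. As \<open>D\<close> does not depend on \<open>R\<close>,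
  the gradient costs 1/R, which later cancels against the factor R of the Poincare
  inequality.\<close>

lemma cutoff:
  obtains D :: real where "0 \<le> D" "\<And>R. 0 < R \<Longrightarrow> \<exists>\<eta>::real^'n::finite \<Rightarrow> real.
    test_function \<eta> \<and> (\<forall>x. 0 \<le> \<eta> x \<and> \<eta> x \<le> 1) \<and> (\<forall>x\<in>cube R. \<eta> x = 1 \<and> grad \<eta> x = 0) \<and>
    (\<forall>x. (\<exists>i. 3 * real R / 2 \<le> \<bar>x $ i\<bar>) \<longrightarrow> \<eta> x = 0 \<and> grad \<eta> x = 0) \<and> (\<forall>x. norm (grad \<eta> x) \<le> D / R)"
proof -
  obtain \<eta> :: "real^'n \<Rightarrow> real" where \<eta>: "test_function \<eta>" "\<And>x. 0 \<le> \<eta> x" "\<And>x. \<eta> x \<le> 1"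
    "\<And>x. x \<in> cube 1 \<Longrightarrow> \<eta> x = 1" "\<And>x. \<exists>i. 3 / 2 \<le> \<bar>x $ i\<bar> \<Longrightarrow> \<eta> x = 0"
    by (rule cutoff_unit) (rule that; assumption)
  obtain D where D: "0 \<le> D" "\<And>x. norm (grad \<eta> x) \<le> D" using test_function_grad_bounded[OF \<eta>(1)] by blast
  show ?thesis
  proof (rule that[OF D(1)])
    fix R :: nat assume R: "0 < R"
    let ?\<eta> = "\<lambda>x. \<eta> ((1 / real R) *\<^sub>R x + 0)"
    have t: "test_function ?\<eta>" using \<eta>(1) R by (intro test_function_affine_arg) auto
    have b: "0 \<le> ?\<eta> x" "?\<eta> x \<le> 1" for x using \<eta> by auto
    have 1: "?\<eta> x = 1" if "x \<in> cube R" for x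
      using that R by (intro \<eta>(4)) (simp add: mem_cube abs_mult field_simps)
    have 0: "?\<eta> x = 0" if "\<exists>i. 3 * real R / 2 \<le> \<bar>x $ i\<bar>" for x
      using that R by (intro \<eta>(5)) (auto simp: abs_mult field_simps)
    have g: "grad ?\<eta> x = (1 / real R) *\<^sub>R grad \<eta> ((1 / real R) *\<^sub>R x + 0)" for x
      unfolding vec_eq_iff
      by (simp only: grad_nth vector_scaleR_component real_scaleR_def
        partial_deriv_affine_arg[OF test_function_differentiable[OF \<eta>(1)]]) simp
    have "norm (grad ?\<eta> x) \<le> D / R" for x
      unfolding g using D(2) R by (simp add: divide_right_mono)
    moreover have "grad ?\<eta> x = 0" if "?\<eta> x = 1 \<or> ?\<eta> x = 0" for x
      by (rule grad_zero_at_extremum) (use that b test_function_differentiable[OF t] in auto)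
    ultimately show "\<exists>\<eta>::real^'n \<Rightarrow> real.
      test_function \<eta> \<and> (\<forall>x. 0 \<le> \<eta> x \<and> \<eta> x \<le> 1) \<and> (\<forall>x\<in>cube R. \<eta> x = 1 \<and> grad \<eta> x = 0) \<and>
      (\<forall>x. (\<exists>i. 3 * real R / 2 \<le> \<bar>x $ i\<bar>) \<longrightarrow> \<eta> x = 0 \<and> grad \<eta> x = 0) \<and> (\<forall>x. norm (grad \<eta> x) \<le> D / R)"
      using t b 0 1 by (intro exI[of _ ?\<eta>] conjI ballI allI impI) simp_all
  qed
qed

subsection \<open>Weak gradients\<close>

lemma distr_lebesgue_translation: "distr lebesgue lebesgue (\<lambda>x::'a::euclidean_space. x + a) = lebesgue"
  and measurable_lebesgue_translation: "(\<lambda>x::'a. x + a) \<in> lebesgue \<rightarrow>\<^sub>M lebesgue"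
proof -
  have T: "(\<lambda>x::'a. a + (\<Sum>j\<in>Basis. (1 * (x \<bullet> j)) *\<^sub>R j)) = (\<lambda>x. x + a)"
    by (simp add: euclidean_representation add.commute)
  show "distr lebesgue lebesgue (\<lambda>x::'a. x + a) = lebesgue"
    using lebesgue_affine_euclidean[of "\<lambda>_. 1" a] unfolding T by (simp add: density_1)
  show "(\<lambda>x::'a. x + a) \<in> lebesgue \<rightarrow>\<^sub>M lebesgue"
    using lebesgue_affine_measurable[of "\<lambda>_. 1" a] unfolding T by simp
qed

lemma measurable_translation:
  assumes "f \<in> borel_measurable lebesgue"
  shows "(\<lambda>x::'a::euclidean_space. f (x + a)) \<in> borel_measurable lebesgue"
  using measurable_compose[OF measurable_lebesgue_translation assms] .

lemma integral_translation:
  fixes f :: "'a::euclidean_space \<Rightarrow> 'b::{banach, second_countable_topology}"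
  assumes "f \<in> borel_measurable lebesgue"
  shows "(LINT x|lebesgue. f (x + a)) = (LINT x|lebesgue. f x)"
  using integral_distr[OF measurable_lebesgue_translation assms, of a]
  by (simp add: distr_lebesgue_translation)

lemma integrable_translation:
  fixes f :: "'a::euclidean_space \<Rightarrow> 'b::{banach, second_countable_topology}"
  assumes "integrable lebesgue f" shows "integrable lebesgue (\<lambda>x. f (x + a))"
  using integrable_distr_eq[OF measurable_lebesgue_translation borel_measurable_integrable[OF assms], of a] assms
  by (simp add: distr_lebesgue_translation)

lemma AE_translation:
  assumes "AE x in lebesgue. P (x::'a::euclidean_space)" shows "AE x in lebesgue. P (x + a)"
proof -
  have "AE x in distr lebesgue lebesgue (\<lambda>x. x + a). P x"
    unfolding distr_lebesgue_translation by (rule assms)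
  then show ?thesis by (rule AE_distrD[OF measurable_lebesgue_translation])
qed

lemma cube_sets [measurable]: "cube N \<in> sets borel"
  using closed_cube by (rule borel_closed)

lemma cube_lebesgue [measurable]: "cube N \<in> sets lebesgue"
  using cube_sets by simp

lemma emeasure_cube_finite: "emeasure lebesgue (cube N) < \<infinity>"
  using emeasure_compact_finite[OF compact_cube] cube_sets by simp

lemma UN_cube: "(\<Union>N. cube N) = (UNIV :: (real^'n::finite) set)"
proof -
  have "\<exists>N. x \<in> cube N" for x :: "real^'n"
    using compact_subset_cube[of "{x}"] by auto
  then show ?thesis by blast
qed

lemma locally_integrable_iff_cube:
  "locally_integrable f \<longleftrightarrow> (\<forall>N. set_integrable lebesgue (cube N) f)"
proof
  assume "locally_integrable f" then show "\<forall>N. set_integrable lebesgue (cube N) f"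
    by (simp add: locally_integrable_def compact_cube)
next
  assume *: "\<forall>N. set_integrable lebesgue (cube N) f"
  show "locally_integrable f" unfolding locally_integrable_def
  proof (intro allI impI)
    fix K :: "(real^'a) set" assume "compact K"
    moreover obtain N where "K \<subseteq> cube N" using compact_subset_cube[OF \<open>compact K\<close>] ..
    ultimately show "set_integrable lebesgue K f"
      using * by (intro set_integrable_subset[of lebesgue "cube N" f K]) (auto simp: borel_compact)
  qed
qed

lemma indicator_cube_tendsto:
  fixes x :: "real^'n::finite" and y :: "'b::real_normed_vector"
  shows "(\<lambda>N. indicator (cube N) x *\<^sub>R y) \<longlonglongrightarrow> y"
proof -
  obtain M where M: "x \<in> cube M" using UN_cube by blast
  have "\<forall>\<^sub>F N in sequentially. indicator (cube N) x *\<^sub>R y = y"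
    by (rule eventually_sequentiallyI[of M]) (use M cube_mono in \<open>auto simp: indicator_def\<close>)
  then show ?thesis by (rule tendsto_eventually)
qed

text \<open>\<open>locally_integrable\<close> speaks of compact sets only; measurability on the
  whole space is recovered from the pointwise limit of the restrictions to exhausting cubes.\<close>

lemma locally_integrable_measurable:
  assumes "locally_integrable f" shows "f \<in> borel_measurable lebesgue"
proof (rule borel_measurable_LIMSEQ_metric)
  show "(\<lambda>x. indicator (cube N) x *\<^sub>R f x) \<in> borel_measurable lebesgue" for N
    using assms unfolding locally_integrable_iff_cube set_integrable_def by (meson borel_measurable_integrable)
  show "(\<lambda>N. indicator (cube N) x *\<^sub>R f x) \<longlonglongrightarrow> f x" for x by (rule indicator_cube_tendsto)
qed

lemma integrable_mult_compact_support:
  fixes u \<psi> :: "real^'n::finite \<Rightarrow> real"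
  assumes u: "locally_integrable u" and \<psi>: "\<psi> \<in> borel_measurable lebesgue" "\<And>x. \<bar>\<psi> x\<bar> \<le> B"
    "\<And>x. x \<notin> cube N \<Longrightarrow> \<psi> x = 0"
  shows "integrable lebesgue (\<lambda>x. u x * \<psi> x)"
proof (rule Bochner_Integration.integrable_bound)
  show "integrable lebesgue (\<lambda>x. B * (indicator (cube N) x *\<^sub>R u x))"
    using u unfolding locally_integrable_iff_cube set_integrable_def by (intro integrable_mult_right) blast
  show "(\<lambda>x. u x * \<psi> x) \<in> borel_measurable lebesgue"
    using locally_integrable_measurable[OF u] \<psi>(1) by measurable
  have "\<bar>u x\<bar> * \<bar>\<psi> x\<bar> \<le> \<bar>B\<bar> * \<bar>u x\<bar>" for x
    using mult_right_mono[of "\<bar>\<psi> x\<bar>" "\<bar>B\<bar>" "\<bar>u x\<bar>"] \<psi>(2)[of x] by (simp add: mult.commute)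
  then show "AE x in lebesgue. norm (u x * \<psi> x) \<le> norm (B * (indicator (cube N) x *\<^sub>R u x))"
    using \<psi>(3) by (auto simp: abs_mult indicator_def)
qed

lemma borel_lebesgue: "f \<in> borel_measurable borel \<Longrightarrow> f \<in> borel_measurable lebesgue"
  by (rule measurable_completion) simp

lemma integrable_mult_test_function:
  assumes "locally_integrable u" "test_function \<phi>"
  shows "integrable lebesgue (\<lambda>x. u x * \<phi> x)"
proof -
  obtain N where N: "\<And>x. x \<notin> cube N \<Longrightarrow> \<phi> x = 0" using test_function_support[OF assms(2)] by blast
  obtain B where B: "\<And>x. \<bar>\<phi> x\<bar> \<le> B" using test_function_bounded[OF assms(2)] by blast
  show ?thesis
    by (rule integrable_mult_compact_support[OF assms(1) _ B N])
       (use borel_lebesgue test_function_borel[OF assms(2)] in blast)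
qed

lemma integrable_mult_partial_deriv:
  "locally_integrable u \<Longrightarrow> test_function \<phi> \<Longrightarrow> integrable lebesgue (\<lambda>x. u x * partial_deriv i \<phi> x)"
  by (intro integrable_mult_test_function test_function_partial_deriv)

lemma locally_integrable_nth: "locally_integrable g \<Longrightarrow> locally_integrable (\<lambda>x. g x $ i :: real)"
  unfolding locally_integrable_iff_cube set_integrable_def
  using integrable_bounded_linear[OF bounded_linear_vec_nth, of lebesgue _ i] by force

lemma measurable_nth:
  fixes g :: "'a \<Rightarrow> real^'n::finite"
  shows "g \<in> borel_measurable M \<Longrightarrow> (\<lambda>x. g x $ i) \<in> borel_measurable M"
  using borel_measurable_inner[of g M "\<lambda>_. axis i 1"] by (simp add: inner_axis)

lemma measurable_vecI:
  fixes g :: "'a \<Rightarrow> real^'n::finite"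
  assumes "\<And>i. (\<lambda>x. g x $ i) \<in> borel_measurable M" shows "g \<in> borel_measurable M"
  by (subst borel_measurable_euclidean_space) (use assms in \<open>auto simp: Basis_vec_def inner_axis\<close>)

lemma locally_integrable_bound:
  assumes "locally_integrable f" "g \<in> borel_measurable lebesgue" "AE x in lebesgue. norm (g x) \<le> norm (f x)"
  shows "locally_integrable g"
  unfolding locally_integrable_iff_cube
proof
  fix N
  show "set_integrable lebesgue (cube N) g"
    by (rule set_integrable_bound[where f=f])
       (use assms in \<open>auto simp: locally_integrable_iff_cube set_borel_measurable_def\<close>)
qed

lemma locally_integrable_add:
  "locally_integrable f \<Longrightarrow> locally_integrable g \<Longrightarrow> locally_integrable (\<lambda>x. f x + g x)"
  by (simp add: locally_integrable_iff_cube)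

lemma locally_integrable_scaleR:
  "locally_integrable f \<Longrightarrow> locally_integrable (\<lambda>x. c *\<^sub>R f x)"
  by (simp add: locally_integrable_iff_cube)

section \<open>The fundamental lemma of the calculus of variations\<close>

text \<open>Boxes are an intersection-stable generator of the Borel sets.\<close>

lemma AE_zero_if_box_integrals_zero:
  fixes F :: "real^'n::finite \<Rightarrow> real"
  assumes F: "integrable lborel F" "integral\<^sup>L lborel F = 0"
    and box: "\<And>a b. (LINT x:box a b|lborel. F x) = 0"
  shows "AE x in lborel. F x = 0"
proof (rule sigma_finite_measure.density_zero[OF sigma_finite_lborel F(1)])
  fix A :: "(real^'n) set" assume "A \<in> sets lborel"
  let ?G = "range (\<lambda>(a, b). box a b :: (real^'n) set)"
  have si: "set_integrable lborel A F" if "A \<in> sets borel" for A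
    unfolding set_integrable_def using that F(1) by (intro integrable_mult_indicator) auto
  have sets: "sigma_sets UNIV ?G = sets borel"
    by (subst borel_eq_box) (simp add: sets_measure_of)
  have "Int_stable ?G"
    unfolding Int_stable_def by (auto simp: Int_interval_cart box_Int_box)
  moreover have "?G \<subseteq> Pow UNIV" by simp
  moreover have "A \<in> sigma_sets UNIV ?G" using \<open>A \<in> sets lborel\<close> sets by simp
  ultimately show "(LINT x:A|lborel. F x) = 0"
  proof (induction rule: sigma_sets_induct_disjoint)
    case (basic A) then show ?case using box by auto
  next
    \<comment> \<open>Complements are the case that uses the vanishing of the integral over the
      whole space.\<close>
    case (compl A)
    then have "A \<in> sets borel" using sets by simp
    then have "(LINT x:A|lborel. F x) + (LINT x:UNIV - A|lborel. F x) = (LINT x:A \<union> (UNIV - A)|lborel. F x)"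
      by (intro set_integral_Un[symmetric] si) auto
    moreover have "(LINT x:A \<union> (UNIV - A)|lborel. F x) = 0" using F(2) by (simp add: set_lebesgue_integral_def)
    ultimately show ?case using compl by simp
  next
    case (union A)
    then have A: "A i \<in> sets borel" for i using sets by blast
    have "(LINT x:(\<Union>i. A i)|lborel. F x) = (\<Sum>i. (LINT x:(A i)|lborel. F x))"
      by (rule lebesgue_integral_countable_add)
         (use A union(1) in \<open>auto intro: si simp: disjoint_family_on_def\<close>)
    then show ?case using union by simp
  qed (auto simp: set_lebesgue_integral_def)
qed

text \<open>Dominated convergence turns vanishing against test functions into vanishing over every
  box, and boxes determine a density. The generator argument runs over \<open>lborel\<close>, whence
  the passage to a Borel representative of \<open>f\<close>.\<close>

lemma fundamental_lemma:
  fixes f :: "real^'n::finite \<Rightarrow> real"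
  assumes f: "locally_integrable f" and 0: "\<And>\<phi>. test_function \<phi> \<Longrightarrow> (LINT x|lebesgue. f x * \<phi> x) = 0"
  shows "AE x in lebesgue. f x = 0"
proof -
  have box: "integrable lebesgue (\<lambda>x. indicator (box a b) x * f x)"
    "(LINT x|lebesgue. indicator (box a b) x * f x) = 0" for a b
  proof -
    obtain \<phi> where \<phi>: "\<And>n::nat. test_function (\<phi> n)" "\<And>n x. 0 \<le> \<phi> n x \<and> \<phi> n x \<le> 1"
      "\<And>n x. x \<notin> box a b \<Longrightarrow> \<phi> n x = 0" "\<And>x. (\<lambda>n. \<phi> n x) \<longlonglongrightarrow> indicator (box a b) x"
      by (rule box_indicator_test_functions[of a b]) (rule that; assumption)
    have m: "f \<in> borel_measurable lebesgue" by (rule locally_integrable_measurable[OF f])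
    have "set_integrable lebesgue (cbox a b) f" using f by (auto simp: locally_integrable_def)
    then have "set_integrable lebesgue (box a b) f"
      by (rule set_integrable_subset) (auto simp: box_subset_cbox)
    then show i: "integrable lebesgue (\<lambda>x. indicator (box a b) x * f x)"
      by (simp add: set_integrable_def)
    have "(\<lambda>n. LINT x|lebesgue. f x * \<phi> n x) \<longlonglongrightarrow> (LINT x|lebesgue. indicator (box a b) x * f x)"
    proof (rule integral_dominated_convergence[where w="\<lambda>x. norm (indicator (box a b) x * f x)"])
      show "integrable lebesgue (\<lambda>x. norm (indicator (box a b) x * f x))" using i by (rule integrable_norm)
      show "(\<lambda>x. f x * \<phi> n x) \<in> borel_measurable lebesgue" for n
        using integrable_mult_test_function[OF f \<phi>(1)] by (rule borel_measurable_integrable)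
      show "AE x in lebesgue. (\<lambda>n. f x * \<phi> n x) \<longlonglongrightarrow> indicator (box a b) x * f x"
        using tendsto_mult[OF tendsto_const \<phi>(4)] by (auto simp: mult.commute)
      have "\<bar>f x\<bar> * \<bar>\<phi> n x\<bar> \<le> \<bar>indicator (box a b) x * f x\<bar>" for n x
        using \<phi>(2)[of n x] \<phi>(3)[of x n] by (cases "x \<in> box a b") (auto simp: mult_left_le)
      then show "AE x in lebesgue. norm (f x * \<phi> n x) \<le> norm (indicator (box a b) x * f x)" for n
        by (simp add: abs_mult)
    qed (use i in \<open>rule borel_measurable_integrable\<close>)
    then show "(LINT x|lebesgue. indicator (box a b) x * f x) = 0"
      using 0[OF \<phi>(1)] by (simp add: LIMSEQ_const_iff)
  qed
  obtain f' where f': "f' \<in> borel_measurable lborel" "AE x in lborel. f x = f' x"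
    using completion_ex_borel_measurable_real[OF locally_integrable_measurable[OF f]] by blast
  have eq: "AE x in lebesgue. f x = f' x" using f'(2) by (rule AE_completion)
  have m: "f \<in> borel_measurable lebesgue" by (rule locally_integrable_measurable[OF f])
  have m': "f' \<in> borel_measurable lebesgue" using f'(1) by (rule measurable_completion)
  have AEbox: "AE x in lebesgue. indicator (box a b) x * f x = (indicator (box a b) x * f' x :: real)" for a b
    using eq by eventually_elim simp
  have mb: "(\<lambda>x. indicator (box a b) x * f x) \<in> borel_measurable lebesgue"
     "(\<lambda>x. indicator (box a b) x * f' x) \<in> borel_measurable lebesgue" for a b
    by (intro borel_measurable_times borel_measurable_indicator m m'; simp)+
  have mb': "(\<lambda>x. indicator (box a b) x * f' x) \<in> borel_measurable lborel" for a b
    using f' by measurable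
  have box': "integrable lborel (\<lambda>x. indicator (box a b) x * f' x)"
    "(LINT x|lborel. indicator (box a b) x * f' x) = 0" for a b
  proof -
    show "integrable lborel (\<lambda>x. indicator (box a b) x * f' x)"
      using box(1) integrable_cong_AE[OF mb AEbox] integrable_completion[OF mb'] by blast
    show "(LINT x|lborel. indicator (box a b) x * f' x) = 0"
      using box(2) integral_cong_AE[OF mb AEbox] integral_completion[OF mb'] by metis
  qed
  \<comment> \<open>\<open>f\<close> is only locally integrable, so the density argument is applied
    to its restrictions to boxes exhausting the space; intersecting these with a further box gives a
    box again.\<close>
  define c :: "nat \<Rightarrow> real^'n" where "c n = (\<chi> i. real n)" for n
  have "AE x in lborel. indicator (box (- c n) (c n)) x * f' x = 0" for n
  proof (rule AE_zero_if_box_integrals_zero[OF box'])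
    fix a b
    obtain a' b' where "box a b \<inter> box (- c n) (c n) = box a' b'" using box_Int_box by blast
    then have "(\<lambda>x. indicator (box a b) x *\<^sub>R (indicator (box (- c n) (c n)) x * f' x)) =
       (\<lambda>x. indicator (box a' b') x * f' x)"
      by (auto simp: fun_eq_iff indicator_inter_arith[symmetric] mult.assoc[symmetric])
    then show "(LINT x:box a b|lborel. indicator (box (- c n) (c n)) x * f' x) = 0"
      unfolding set_lebesgue_integral_def using box'(2) by simp
  qed
  then have "AE x in lborel. \<forall>n. indicator (box (- c n) (c n)) x * f' x = 0"
    by (subst AE_all_countable) blast
  then have "AE x in lborel. f' x = 0"
  proof eventually_elim
    fix x assume *: "\<forall>n. indicator (box (- c n) (c n)) x * f' x = 0"
    obtain n :: nat where n: "norm x < real n" using reals_Archimedean2 by blast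
    have "\<bar>x $ i\<bar> < real n" for i using component_le_norm_cart[of x i] n by linarith
    then have "x \<in> box (- c n) (c n)" by (auto simp: mem_box_cart c_def abs_less_iff minus_less_iff)
    with *[rule_format, of n] show "f' x = 0" by simp
  qed
  then have "AE x in lebesgue. f' x = 0" by (rule AE_completion)
  with eq show ?thesis by eventually_elim simp
qed

text \<open>\<open>weak_gradient\<close> is an arbitrary choice; this is what makes it agree almost
  everywhere with every gradient computed by hand.\<close>

lemma weak_gradient_AE_unique:
  assumes "has_weak_gradient u g" "has_weak_gradient u h"
  shows "AE x in lebesgue. g x = h x"
proof -
  have "AE x in lebesgue. g x $ i - h x $ i = 0" for i
  proof (rule fundamental_lemma)
    have li: "locally_integrable (\<lambda>x. g x $ i)" "locally_integrable (\<lambda>x. h x $ i)"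
      using assms by (auto simp: has_weak_gradient_def intro: locally_integrable_nth)
    show "locally_integrable (\<lambda>x. g x $ i - h x $ i)"
      using locally_integrable_add[OF li(1) locally_integrable_scaleR[OF li(2), of "-1"]] by simp
    show "(LINT x|lebesgue. (g x $ i - h x $ i) * \<phi> x) = 0" if "test_function \<phi>" for \<phi>
      using integrable_mult_test_function[OF li(1) that] integrable_mult_test_function[OF li(2) that] assms that
      by (simp add: has_weak_gradient_def left_diff_distrib)
  qed
  then have "AE x in lebesgue. \<forall>i\<in>UNIV. g x $ i - h x $ i = 0"
    by (intro AE_finite_allI) auto
  then show ?thesis by eventually_elim (simp add: vec_eq_iff)
qed

lemma has_weak_gradient_weak_gradient:
  "has_weak_gradient u g \<Longrightarrow> has_weak_gradient u (weak_gradient u)"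
  unfolding weak_gradient_def by (rule someI[where P="has_weak_gradient u"])

lemma weak_gradient_AE_eq:
  "has_weak_gradient u g \<Longrightarrow> AE x in lebesgue. weak_gradient u x = g x"
  using weak_gradient_AE_unique has_weak_gradient_weak_gradient by blast

text \<open>Square integrability on all cubes at once rather than on one period cell: correctors of
  different periods, their translates and their cutoffs then belong to one space.\<close>

definition loc_L2 :: "(real^'n::finite \<Rightarrow> 'b::euclidean_space) \<Rightarrow> bool" where
  "loc_L2 f \<longleftrightarrow> f \<in> borel_measurable lebesgue \<and> (\<forall>N. set_integrable lebesgue (cube N) (\<lambda>x. (norm (f x))\<^sup>2))"

lemma loc_L2_measurable: "loc_L2 f \<Longrightarrow> f \<in> borel_measurable lebesgue"
  by (simp add: loc_L2_def)

lemma loc_L2_square_integrable: "loc_L2 f \<Longrightarrow> set_integrable lebesgue (cube N) (\<lambda>x. (norm (f x))\<^sup>2)"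
  by (simp add: loc_L2_def)

lemma loc_L2_bound:
  assumes "loc_L2 f" "g \<in> borel_measurable lebesgue" "AE x in lebesgue. norm (g x) \<le> c * norm (f x)"
  shows "loc_L2 g"
  unfolding loc_L2_def
proof (intro conjI allI)
  fix N
  show "set_integrable lebesgue (cube N) (\<lambda>x. (norm (g x))\<^sup>2)"
  proof (rule set_integrable_bound[where f="\<lambda>x. c\<^sup>2 * (norm (f x))\<^sup>2"])
    show "set_integrable lebesgue (cube N) (\<lambda>x. c\<^sup>2 * (norm (f x))\<^sup>2)"
      using loc_L2_square_integrable[OF assms(1)] by simp
    show "set_borel_measurable lebesgue (cube N) (\<lambda>x. (norm (g x))\<^sup>2)"
      unfolding set_borel_measurable_def using assms(2) by measurable
    have "AE x in lebesgue. (norm (g x))\<^sup>2 \<le> c\<^sup>2 * (norm (f x))\<^sup>2"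
      using assms(3) by eventually_elim (metis norm_ge_zero power_mono power_mult_distrib)
    then show "AE x in lebesgue. x \<in> cube N \<longrightarrow> norm ((norm (g x))\<^sup>2) \<le> norm (c\<^sup>2 * (norm (f x))\<^sup>2)"
      by eventually_elim simp
  qed
qed fact

lemma loc_L2_add:
  assumes "loc_L2 f" "loc_L2 g" shows "loc_L2 (\<lambda>x. f x + g x)"
  unfolding loc_L2_def
proof (intro conjI allI)
  show m: "(\<lambda>x. f x + g x) \<in> borel_measurable lebesgue"
    using assms by (intro borel_measurable_add loc_L2_measurable)
  fix N
  show "set_integrable lebesgue (cube N) (\<lambda>x. (norm (f x + g x))\<^sup>2)"
  proof (rule set_integrable_bound[where f="\<lambda>x. 2 * (norm (f x))\<^sup>2 + 2 * (norm (g x))\<^sup>2"])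
    show "set_integrable lebesgue (cube N) (\<lambda>x. 2 * (norm (f x))\<^sup>2 + 2 * (norm (g x))\<^sup>2)"
      using loc_L2_square_integrable assms by (intro set_integral_add) auto
    show "set_borel_measurable lebesgue (cube N) (\<lambda>x. (norm (f x + g x))\<^sup>2)"
      unfolding set_borel_measurable_def using m by measurable
    have "(norm (f x + g x))\<^sup>2 \<le> 2 * (norm (f x))\<^sup>2 + 2 * (norm (g x))\<^sup>2" for x
    proof -
      have "(norm (f x + g x))\<^sup>2 \<le> (norm (f x) + norm (g x))\<^sup>2"
        by (intro power_mono norm_triangle_ineq) simp
      also have "\<dots> \<le> 2 * (norm (f x))\<^sup>2 + 2 * (norm (g x))\<^sup>2"
        using sum_squares_bound[of "norm (f x)" "norm (g x)"] by (simp add: power2_sum)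
      finally show ?thesis .
    qed
    then show "AE x in lebesgue. x \<in> cube N \<longrightarrow>
        norm ((norm (f x + g x))\<^sup>2) \<le> norm (2 * (norm (f x))\<^sup>2 + 2 * (norm (g x))\<^sup>2)"
      by simp
  qed
qed

lemma loc_L2_scaleR: "loc_L2 f \<Longrightarrow> loc_L2 (\<lambda>x. c *\<^sub>R f x)"
  by (rule loc_L2_bound[where f=f and c="\<bar>c\<bar>"])
     (auto intro!: borel_measurable_scaleR dest: loc_L2_measurable)

lemma loc_L2_const: "loc_L2 (\<lambda>x::real^'n::finite. c)"
proof -
  have "integrable lebesgue (indicat_real (cube N :: (real^'n) set))" for N
    by (rule integrable_real_indicator[OF cube_lebesgue emeasure_cube_finite])
  then show ?thesis by (auto simp: loc_L2_def set_integrable_def)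
qed

lemma loc_L2_diff:
  assumes "loc_L2 f" "loc_L2 g" shows "loc_L2 (\<lambda>x. f x - g x)"
  using loc_L2_add[OF assms(1) loc_L2_scaleR[OF assms(2), of "-1"]] by simp

lemma loc_L2_sum: "(\<And>i. i \<in> I \<Longrightarrow> loc_L2 (f i)) \<Longrightarrow> loc_L2 (\<lambda>x. \<Sum>i\<in>I. f i x)"
  by (induction I rule: infinite_finite_induct) (auto intro: loc_L2_add loc_L2_const)

lemma loc_L2_translation:
  fixes f :: "real^'n::finite \<Rightarrow> 'b::euclidean_space"
  assumes "loc_L2 f" shows "loc_L2 (\<lambda>x. f (x + a))"
  unfolding loc_L2_def
proof (intro conjI allI)
  show m: "(\<lambda>x. f (x + a)) \<in> borel_measurable lebesgue"
    by (rule measurable_translation[OF loc_L2_measurable[OF assms]])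
  fix N
  have "compact ((\<lambda>x. x + a) ` cube N)"
    by (intro compact_continuous_image compact_cube continuous_intros)
  then obtain M where M: "(\<lambda>x. x + a) ` cube N \<subseteq> cube M" using compact_subset_cube by blast
  have "set_integrable lebesgue UNIV (\<lambda>x. indicator (cube M) (x + a) *\<^sub>R (norm (f (x + a)))\<^sup>2)"
    using integrable_translation[OF loc_L2_square_integrable[OF assms, unfolded set_integrable_def, of M]]
    by (simp add: set_integrable_def)
  then have "set_integrable lebesgue (cube N) (\<lambda>x. indicator (cube M) (x + a) *\<^sub>R (norm (f (x + a)))\<^sup>2)"
    by (rule set_integrable_subset) auto
  then show "set_integrable lebesgue (cube N) (\<lambda>x. (norm (f (x + a)))\<^sup>2)"
    by (rule set_integrable_cong[THEN iffD1, rotated -1]) (use M in \<open>auto simp: indicator_def\<close>)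
qed

lemma loc_L2_prod_bound:
  fixes f :: "real^'n::finite \<Rightarrow> 'a::euclidean_space" and g :: "real^'n \<Rightarrow> 'b::euclidean_space"
    and h :: "real^'n \<Rightarrow> 'c::euclidean_space"
  assumes "loc_L2 f" "loc_L2 g" "h \<in> borel_measurable lebesgue"
    "AE x in lebesgue. norm (h x) \<le> c * (norm (f x) * norm (g x))"
  shows "set_integrable lebesgue (cube N) h"
proof (rule set_integrable_bound[where f="\<lambda>x. \<bar>c\<bar> * ((norm (f x))\<^sup>2 + (norm (g x))\<^sup>2)"])
  show "set_integrable lebesgue (cube N) (\<lambda>x. \<bar>c\<bar> * ((norm (f x))\<^sup>2 + (norm (g x))\<^sup>2))"
    using assms(1,2)[THEN loc_L2_square_integrable] by (intro set_integrable_mult_right set_integral_add)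
  show "set_borel_measurable lebesgue (cube N) h"
    unfolding set_borel_measurable_def using assms(3) by measurable
  have *: "c * (norm (f x) * norm (g x)) \<le> \<bar>c\<bar> * ((norm (f x))\<^sup>2 + (norm (g x))\<^sup>2)" for x
  proof -
    have "norm (f x) * norm (g x) \<le> (norm (f x))\<^sup>2 + (norm (g x))\<^sup>2"
    proof -
      have "0 \<le> norm (f x) * norm (g x)" by simp
      then show ?thesis using sum_squares_bound[of "norm (f x)" "norm (g x)"] unfolding mult.assoc by linarith
    qed
    then show ?thesis by (intro mult_mono) auto
  qed
  then show "AE x in lebesgue. x \<in> cube N \<longrightarrow> norm (h x) \<le> norm (\<bar>c\<bar> * ((norm (f x))\<^sup>2 + (norm (g x))\<^sup>2))"
    using assms(4)
  proof eventually_elim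
    case (elim x)
    have "norm (h x) \<le> \<bar>c\<bar> * ((norm (f x))\<^sup>2 + (norm (g x))\<^sup>2)" using elim(1) *[of x] by linarith
    then show ?case by simp
  qed
qed

lemma loc_L2_locally_integrable:
  assumes "loc_L2 f" shows "locally_integrable f"
  unfolding locally_integrable_iff_cube
  using loc_L2_prod_bound[OF assms loc_L2_const[of "1::real"] loc_L2_measurable[OF assms], of 1] by simp

lemma loc_L2_cong_AE:
  assumes "loc_L2 f" "g \<in> borel_measurable lebesgue" "AE x in lebesgue. f x = g x"
  shows "loc_L2 g"
  by (rule loc_L2_bound[OF assms(1,2), of 1]) (use assms(3) in \<open>eventually_elim, simp\<close>)

section \<open>Calculus of weak gradients\<close>

lemma has_weak_gradientD:
  "has_weak_gradient u g \<Longrightarrow> locally_integrable u"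
  "has_weak_gradient u g \<Longrightarrow> locally_integrable g"
  "has_weak_gradient u g \<Longrightarrow> test_function \<phi> \<Longrightarrow>
    (LINT x|lebesgue. u x * partial_deriv i \<phi> x) = - (LINT x|lebesgue. g x $ i * \<phi> x)"
  by (auto simp: has_weak_gradient_def)

lemma has_weak_gradient_add:
  assumes "has_weak_gradient u g" "has_weak_gradient v h"
  shows "has_weak_gradient (\<lambda>x. u x + v x) (\<lambda>x. g x + h x)"
  unfolding has_weak_gradient_def
proof (intro conjI allI impI)
  note li = assms[THEN has_weak_gradientD(1)] assms[THEN has_weak_gradientD(2)]
  show "locally_integrable (\<lambda>x. u x + v x)" "locally_integrable (\<lambda>x. g x + h x)"
    using li by (auto intro: locally_integrable_add)
  fix \<phi> :: "real^'a \<Rightarrow> real" and i assume \<phi>: "test_function \<phi>"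
  have "(LINT x|lebesgue. (u x + v x) * partial_deriv i \<phi> x) =
    (LINT x|lebesgue. u x * partial_deriv i \<phi> x) + (LINT x|lebesgue. v x * partial_deriv i \<phi> x)"
    unfolding distrib_right
    by (intro Bochner_Integration.integral_add integrable_mult_partial_deriv li \<phi>)
  moreover have "(LINT x|lebesgue. (g x + h x) $ i * \<phi> x) =
    (LINT x|lebesgue. g x $ i * \<phi> x) + (LINT x|lebesgue. h x $ i * \<phi> x)"
    unfolding distrib_right vector_add_component
    by (intro Bochner_Integration.integral_add integrable_mult_test_function locally_integrable_nth li \<phi>)
  ultimately show "(LINT x|lebesgue. (u x + v x) * partial_deriv i \<phi> x) = - (LINT x|lebesgue. (g x + h x) $ i * \<phi> x)"
    using assms[THEN has_weak_gradientD(3), OF \<phi>] by simp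
qed

lemma has_weak_gradient_scaleR:
  assumes "has_weak_gradient u g"
  shows "has_weak_gradient (\<lambda>x. c * u x) (\<lambda>x. c *\<^sub>R g x)"
  unfolding has_weak_gradient_def
  using has_weak_gradientD[OF assms] locally_integrable_scaleR[of u c] locally_integrable_scaleR[of g c]
  by (simp add: mult.assoc)

lemma has_weak_gradient_diff:
  assumes "has_weak_gradient u g" "has_weak_gradient v h"
  shows "has_weak_gradient (\<lambda>x. u x - v x) (\<lambda>x. g x - h x)"
  using has_weak_gradient_add[OF assms(1) has_weak_gradient_scaleR[OF assms(2), of "-1"]] by simp

lemma has_weak_gradient_zero: "has_weak_gradient (\<lambda>x. 0) (\<lambda>x. 0)"
  by (simp add: has_weak_gradient_def locally_integrable_def set_integrable_def)

lemma has_weak_gradient_sum: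
  "finite I \<Longrightarrow> (\<And>i. i \<in> I \<Longrightarrow> has_weak_gradient (u i) (g i)) \<Longrightarrow>
   has_weak_gradient (\<lambda>x. \<Sum>i\<in>I. u i x) (\<lambda>x. \<Sum>i\<in>I. g i x)"
  by (induction I rule: finite_induct) (auto intro: has_weak_gradient_zero has_weak_gradient_add)

lemma locally_integrable_translation:
  fixes f :: "real^'n::finite \<Rightarrow> 'b::euclidean_space"
  assumes "locally_integrable f" shows "locally_integrable (\<lambda>x. f (x + a))"
  unfolding locally_integrable_iff_cube
proof
  fix N
  have "compact ((\<lambda>x. x + a) ` cube N)"
    by (intro compact_continuous_image compact_cube continuous_intros)
  then obtain M where M: "(\<lambda>x. x + a) ` cube N \<subseteq> cube M" using compact_subset_cube by blast
  have "integrable lebesgue (\<lambda>x. indicator (cube M) x *\<^sub>R f x)"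
    using assms by (simp add: locally_integrable_iff_cube set_integrable_def)
  from integrable_translation[OF this, of a]
  have "set_integrable lebesgue UNIV (\<lambda>x. indicator (cube M) (x + a) *\<^sub>R f (x + a))"
    by (simp add: set_integrable_def)
  then have "set_integrable lebesgue (cube N) (\<lambda>x. indicator (cube M) (x + a) *\<^sub>R f (x + a))"
    by (rule set_integrable_subset) auto
  then show "set_integrable lebesgue (cube N) (\<lambda>x. f (x + a))"
    by (rule set_integrable_cong[THEN iffD1, rotated -1]) (use M in \<open>auto simp: indicator_def\<close>)
qed

lemma has_weak_gradient_translation:
  fixes a :: "real^'n::finite"
  assumes "has_weak_gradient u g"
  shows "has_weak_gradient (\<lambda>x. u (x + a)) (\<lambda>x. g (x + a))"
  unfolding has_weak_gradient_def
proof (intro conjI allI impI)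
  note li = has_weak_gradientD(1,2)[OF assms]
  show "locally_integrable (\<lambda>x. u (x + a))" "locally_integrable (\<lambda>x. g (x + a))"
    using li by (auto intro: locally_integrable_translation)
  fix \<phi> :: "real^'n \<Rightarrow> real" and i assume \<phi>: "test_function \<phi>"
  let ?\<psi> = "\<lambda>x. \<phi> (1 *\<^sub>R x + (- a))"
  have \<psi>: "test_function ?\<psi>" using \<phi> by (rule test_function_affine_arg) simp
  have p: "partial_deriv i ?\<psi> x = partial_deriv i \<phi> (x - a)" for x
    using partial_deriv_affine_arg[OF test_function_differentiable[OF \<phi>], where c=1 and a="- a"] by simp
  have "(LINT x|lebesgue. u (x + a) * partial_deriv i \<phi> x) =
     (LINT x|lebesgue. (\<lambda>y. u y * partial_deriv i ?\<psi> y) (x + a))"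
    by (simp only: p add_diff_cancel_right')
  also have "\<dots> = (LINT y|lebesgue. u y * partial_deriv i ?\<psi> y)"
    by (rule integral_translation)
       (rule borel_measurable_integrable[OF integrable_mult_partial_deriv[OF li(1) \<psi>]])
  also have "\<dots> = - (LINT y|lebesgue. g y $ i * ?\<psi> y)"
    by (rule has_weak_gradientD(3)[OF assms \<psi>])
  also have "(LINT y|lebesgue. g y $ i * ?\<psi> y) = (LINT x|lebesgue. (\<lambda>y. g y $ i * ?\<psi> y) (x + a))"
    by (rule integral_translation[symmetric])
       (rule borel_measurable_integrable[OF integrable_mult_test_function[OF locally_integrable_nth[OF li(2)] \<psi>]])
  finally show "(LINT x|lebesgue. u (x + a) * partial_deriv i \<phi> x) = - (LINT x|lebesgue. g (x + a) $ i * \<phi> x)"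
    by simp
qed

lemma locally_integrable_mult_bounded:
  fixes f :: "real^'n::finite \<Rightarrow> 'b::euclidean_space"
  assumes "locally_integrable f" "\<eta> \<in> borel_measurable lebesgue" "\<And>x. \<bar>\<eta> x\<bar> \<le> B"
  shows "locally_integrable (\<lambda>x. \<eta> x *\<^sub>R f x)"
proof (rule locally_integrable_bound[OF locally_integrable_scaleR[OF assms(1), of B]])
  show "(\<lambda>x. \<eta> x *\<^sub>R f x) \<in> borel_measurable lebesgue"
    by (intro borel_measurable_scaleR assms(2) locally_integrable_measurable[OF assms(1)])
  have "\<bar>\<eta> x\<bar> * norm (f x) \<le> \<bar>B\<bar> * norm (f x)" for x
    using assms(3)[of x] by (intro mult_right_mono) auto
  then show "AE x in lebesgue. norm (\<eta> x *\<^sub>R f x) \<le> norm (B *\<^sub>R f x)" by simp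
qed

text \<open>Leibniz rule by duality: \<open>\<eta> x * \<phi> x\<close> is itself a test function,
  and the smooth product rule for it isolates
  \<open>\<eta> x * partial_deriv i \<phi> x\<close>.\<close>

lemma has_weak_gradient_mult_test_function:
  fixes \<eta> :: "real^'n::finite \<Rightarrow> real"
  assumes w: "has_weak_gradient u g" and \<eta>: "test_function \<eta>"
  shows "has_weak_gradient (\<lambda>x. \<eta> x * u x) (\<lambda>x. \<eta> x *\<^sub>R g x + u x *\<^sub>R grad \<eta> x)"
  unfolding has_weak_gradient_def
proof (intro conjI allI impI)
  note li = has_weak_gradientD(1,2)[OF w]
  have m\<eta>: "\<eta> \<in> borel_measurable lebesgue" using test_function_borel[OF \<eta>] by (rule borel_lebesgue)
  obtain B where B: "\<And>x. \<bar>\<eta> x\<bar> \<le> B" using test_function_bounded[OF \<eta>] by blast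
  show l1: "locally_integrable (\<lambda>x. \<eta> x * u x)"
    using locally_integrable_mult_bounded[OF li(1) m\<eta> B] by simp
  have l2: "locally_integrable (\<lambda>x. u x *\<^sub>R grad \<eta> x)"
  proof -
    obtain D where D: "\<And>x. norm (grad \<eta> x) \<le> D" using test_function_grad_bounded[OF \<eta>] by blast
    have "\<bar>u x\<bar> * norm (grad \<eta> x) \<le> \<bar>u x\<bar> * \<bar>D\<bar>" for x
      using D[of x] by (intro mult_left_mono) auto
    then show ?thesis
      using locally_integrable_measurable[OF li(1)] borel_lebesgue[OF test_function_grad_borel[OF \<eta>]]
      by (intro locally_integrable_bound[OF locally_integrable_scaleR[OF li(1), of D]] borel_measurable_scaleR)
         (auto simp: mult.commute abs_mult)
  qed
  show "locally_integrable (\<lambda>x. \<eta> x *\<^sub>R g x + u x *\<^sub>R grad \<eta> x)"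
    by (intro locally_integrable_add l2 locally_integrable_mult_bounded[OF li(2) m\<eta> B])
  fix \<phi> :: "real^'n \<Rightarrow> real" and i assume \<phi>: "test_function \<phi>"
  have t: "test_function (\<lambda>x. \<eta> x * \<phi> x)" by (rule test_function_mult[OF \<phi> test_function_C_k[OF \<eta>]])
  have t2: "test_function (\<lambda>x. partial_deriv i \<eta> x * \<phi> x)"
    by (rule test_function_mult[OF \<phi> test_function_C_k[OF test_function_partial_deriv[OF \<eta>]]])
  have p: "partial_deriv i (\<lambda>x. \<eta> x * \<phi> x) x = \<eta> x * partial_deriv i \<phi> x + partial_deriv i \<eta> x * \<phi> x" for x
    using partial_derivI[OF has_derivative_mult[OF
      test_function_differentiable[OF \<eta>, unfolded frechet_derivative_works]
      test_function_differentiable[OF \<phi>, unfolded frechet_derivative_works], of x], of i]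
    by (simp add: partial_deriv_def)
  have i1: "integrable lebesgue (\<lambda>x. u x * partial_deriv i (\<lambda>x. \<eta> x * \<phi> x) x)"
    by (rule integrable_mult_partial_deriv[OF li(1) t])
  have i2: "integrable lebesgue (\<lambda>x. u x * (partial_deriv i \<eta> x * \<phi> x))"
    by (rule integrable_mult_test_function[OF li(1) t2])
  have i3: "integrable lebesgue (\<lambda>x. g x $ i * (\<eta> x * \<phi> x))"
    by (rule integrable_mult_test_function[OF locally_integrable_nth[OF li(2)] t])
  have "(LINT x|lebesgue. \<eta> x * u x * partial_deriv i \<phi> x) =
    (LINT x|lebesgue. u x * partial_deriv i (\<lambda>x. \<eta> x * \<phi> x) x - u x * (partial_deriv i \<eta> x * \<phi> x))"
    unfolding p by (simp add: algebra_simps)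
  also have "\<dots> = - (LINT x|lebesgue. g x $ i * (\<eta> x * \<phi> x)) - (LINT x|lebesgue. u x * (partial_deriv i \<eta> x * \<phi> x))"
    using Bochner_Integration.integral_diff[OF i1 i2] has_weak_gradientD(3)[OF w t] by simp
  also have "\<dots> = - (LINT x|lebesgue. g x $ i * (\<eta> x * \<phi> x) + u x * (partial_deriv i \<eta> x * \<phi> x))"
    using Bochner_Integration.integral_add[OF i3 i2] by simp
  also have "(\<lambda>x. g x $ i * (\<eta> x * \<phi> x) + u x * (partial_deriv i \<eta> x * \<phi> x)) =
     (\<lambda>x. (\<eta> x *\<^sub>R g x + u x *\<^sub>R grad \<eta> x) $ i * \<phi> x)"
    by (simp add: fun_eq_iff algebra_simps)
  finally show "(LINT x|lebesgue. \<eta> x * u x * partial_deriv i \<phi> x) =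
      - (LINT x|lebesgue. (\<eta> x *\<^sub>R g x + u x *\<^sub>R grad \<eta> x) $ i * \<phi> x)" .
qed

text \<open>A test function sees u and g only on a cube containing its support. This lets a locally
  finite sum of infinitely many translates be differentiated.\<close>

lemma has_weak_gradient_local:
  fixes u :: "real^'n::finite \<Rightarrow> real"
  assumes loc: "\<And>N. \<exists>v h. has_weak_gradient v h \<and> (\<forall>x\<in>cube N. u x = v x \<and> g x = h x)"
  shows "has_weak_gradient u g"
  unfolding has_weak_gradient_def
proof (intro conjI allI impI)
  have "set_integrable lebesgue (cube N) u \<and> set_integrable lebesgue (cube N) g" for N
  proof -
    obtain v h where vh: "has_weak_gradient v h" "\<forall>x\<in>cube N. u x = v x \<and> g x = h x" using loc by blast
    have "set_integrable lebesgue (cube N) v" "set_integrable lebesgue (cube N) h"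
      using has_weak_gradientD(1,2)[OF vh(1)] by (auto simp: locally_integrable_iff_cube)
    then show ?thesis
      using vh(2) set_integrable_cong[of lebesgue lebesgue "cube N" "cube N" u v]
        set_integrable_cong[of lebesgue lebesgue "cube N" "cube N" g h] by auto
  qed
  then show "locally_integrable u" "locally_integrable g" by (auto simp: locally_integrable_iff_cube)
  fix \<phi> :: "real^'n \<Rightarrow> real" and i assume \<phi>: "test_function \<phi>"
  obtain N where N: "\<And>x. x \<notin> cube N \<Longrightarrow> \<phi> x = 0" using test_function_support[OF \<phi>] by blast
  have N': "partial_deriv i \<phi> x = 0" if "x \<notin> cube N" for x
    using partial_deriv_zero_outside[OF closed_cube N that] .
  obtain v h where vh: "has_weak_gradient v h" "\<forall>x\<in>cube N. u x = v x \<and> g x = h x" using loc by blast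
  have "u x * partial_deriv i \<phi> x = v x * partial_deriv i \<phi> x" "g x $ i * \<phi> x = h x $ i * \<phi> x" for x
    using vh(2) N[of x] N'[of x] by (cases "x \<in> cube N"; simp)+
  then show "(LINT x|lebesgue. u x * partial_deriv i \<phi> x) = - (LINT x|lebesgue. g x $ i * \<phi> x)"
    using has_weak_gradientD(3)[OF vh(1) \<phi>, of i] by presburger
qed

subsection \<open>Weak gradients along segments and the Poincare inequality\<close>

text \<open>Weak gradients are defined with the completed measure, whereas Fubini is applied to
  products of \<open>lborel\<close>; Borel functions pass freely between the two.\<close>

lemma integral_lborel_eq:
  fixes f :: "'a::euclidean_space \<Rightarrow> 'b::{banach, second_countable_topology}"
  shows "f \<in> borel_measurable borel \<Longrightarrow> integral\<^sup>L lebesgue f = integral\<^sup>L lborel f"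
  by (rule integral_completion) simp

lemma integrable_lborel_eq:
  fixes f :: "'a::euclidean_space \<Rightarrow> 'b::{banach, second_countable_topology}"
  shows "f \<in> borel_measurable borel \<Longrightarrow> integrable lebesgue f \<longleftrightarrow> integrable lborel f"
  by (rule integrable_completion) simp

lemma integrable_lborel_translation:
  fixes f :: "'a::euclidean_space \<Rightarrow> 'b::{banach, second_countable_topology}"
  assumes f: "integrable lborel f"
  shows "integrable lborel (\<lambda>x. f (x + a))" "(LINT x|lborel. f (x + a)) = (LINT x|lborel. f x)"
proof -
  have [measurable]: "f \<in> borel_measurable borel" using borel_measurable_integrable[OF f] by simp
  have m: "(\<lambda>x. f (x + a)) \<in> borel_measurable borel" by measurable
  show "integrable lborel (\<lambda>x. f (x + a))"
    using integrable_translation[of f a] f by (simp add: integrable_lborel_eq m)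
  show "(LINT x|lborel. f (x + a)) = (LINT x|lborel. f x)"
    using integral_translation[of f a] by (simp add: integral_lborel_eq m borel_lebesgue)
qed

text \<open>Joint integrability for the later uses of Fubini. The common shift by ta is removed by
  translation invariance, and the remaining relative shift keeps the support of \<psi> inside one
  cube for all t in [0,1].\<close>

lemma integrable_sheared:
  fixes u \<psi> :: "real^'n::finite \<Rightarrow> real"
  assumes u[measurable]: "u \<in> borel_measurable borel" and li: "locally_integrable u"
    and \<psi>[measurable]: "\<psi> \<in> borel_measurable borel" and B: "\<And>x. \<bar>\<psi> x\<bar> \<le> B"
    and N: "\<And>x. x \<notin> cube N \<Longrightarrow> \<psi> x = 0"
  shows "integrable (lborel \<Otimes>\<^sub>M lborel)
    (\<lambda>(t, x). indicator {0..1::real} t * (u (x + t *\<^sub>R a) * \<psi> (x + t *\<^sub>R b)))"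
proof (rule lborel_pair.Fubini_integrable)
  have "compact ((\<lambda>(t, x). x - t *\<^sub>R (b - a)) ` ({0..1::real} \<times> cube N))"
    by (intro compact_continuous_image compact_Times compact_cube) (auto intro!: continuous_intros simp: case_prod_beta)
  then obtain M where M: "(\<lambda>(t, x). x - t *\<^sub>R (b - a)) ` ({0..1::real} \<times> cube N) \<subseteq> cube M"
    using compact_subset_cube by blast
  have iu: "integrable lborel (\<lambda>x. B * \<bar>indicator (cube M) x * u x\<bar>)"
  proof -
    have "integrable lebesgue (\<lambda>x. indicator (cube M) x * u x)"
      using li by (simp add: locally_integrable_iff_cube set_integrable_def)
    then have "integrable lborel (\<lambda>x. indicator (cube M) x * u x)" by (subst (asm) integrable_lborel_eq) auto
    then show ?thesis by (intro integrable_mult_right integrable_abs)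
  qed
  have bd: "\<bar>u x * \<psi> (x + t *\<^sub>R (b - a))\<bar> \<le> B * \<bar>indicator (cube M) x * u x\<bar>" if "t \<in> {0..1}" for t x
  proof (cases "\<psi> (x + t *\<^sub>R (b - a)) = 0")
    case True
    have "0 \<le> B" using B[of x] by linarith
    then show ?thesis using True by simp
  next
    case False
    then have "x + t *\<^sub>R (b - a) \<in> cube N" using N by blast
    then have "x + t *\<^sub>R (b - a) - t *\<^sub>R (b - a) \<in> cube M" using M that by (force simp: image_subset_iff)
    then show ?thesis using mult_left_mono[OF B[of "x + t *\<^sub>R (b - a)"], of "\<bar>u x\<bar>"]
      by (simp add: abs_mult mult.commute[of B])
  qed
  have i: "integrable lborel (\<lambda>x. u x * \<psi> (x + t *\<^sub>R (b - a)))"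
    and n: "(LINT x|lborel. \<bar>u x * \<psi> (x + t *\<^sub>R (b - a))\<bar>) \<le> (LINT x|lborel. B * \<bar>indicator (cube M) x * u x\<bar>)"
    if t: "t \<in> {0..1}" for t
  proof -
    show i: "integrable lborel (\<lambda>x. u x * \<psi> (x + t *\<^sub>R (b - a)))"
      by (rule Bochner_Integration.integrable_bound[OF iu]) (use bd[OF t] in \<open>auto intro: order_trans[OF _ abs_ge_self]\<close>)
    show "(LINT x|lborel. \<bar>u x * \<psi> (x + t *\<^sub>R (b - a))\<bar>) \<le> (LINT x|lborel. B * \<bar>indicator (cube M) x * u x\<bar>)"
      by (rule integral_mono[OF integrable_abs[OF i] iu bd[OF t]])
  qed
  have eq: "x + t *\<^sub>R a + t *\<^sub>R (b - a) = x + t *\<^sub>R b" for x :: "real^'n" and t by (simp add: algebra_simps)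
  have i': "integrable lborel (\<lambda>x. u (x + t *\<^sub>R a) * \<psi> (x + t *\<^sub>R b))"
    and n': "(LINT x|lborel. \<bar>u (x + t *\<^sub>R a) * \<psi> (x + t *\<^sub>R b)\<bar>) \<le> (LINT x|lborel. B * \<bar>indicator (cube M) x * u x\<bar>)"
    if t: "t \<in> {0..1}" for t
    using integrable_lborel_translation(1)[OF i[OF t], of "t *\<^sub>R a"] n[OF t]
      integrable_lborel_translation(2)[OF integrable_abs[OF i[OF t]], of "t *\<^sub>R a"] by (simp_all add: eq)
  show m: "(\<lambda>(t, x). indicator {0..1::real} t * (u (x + t *\<^sub>R a) * \<psi> (x + t *\<^sub>R b))) \<in> borel_measurable (lborel \<Otimes>\<^sub>M lborel)"
    by measurable
  show "AE t in lborel. integrable lborel (\<lambda>x. case (t, x) of (t, x) \<Rightarrow>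
      indicator {0..1::real} t * (u (x + t *\<^sub>R a) * \<psi> (x + t *\<^sub>R b)))"
    using i' by (auto simp: indicator_def)
  let ?C = "LINT x|lborel. B * \<bar>indicator (cube M) x * u x\<bar>"
  show "integrable lborel (\<lambda>t. LINT x|lborel. norm (case (t, x) of (t, x) \<Rightarrow>
      indicator {0..1::real} t * (u (x + t *\<^sub>R a) * \<psi> (x + t *\<^sub>R b))))"
  proof (rule Bochner_Integration.integrable_bound)
    show "integrable lborel (\<lambda>t. indicator {0..1::real} t *\<^sub>R ?C)"
      by (rule integrable_scaleR_left) (auto intro!: integrable_real_indicator)
    show "(\<lambda>t. LINT x|lborel. norm (case (t, x) of (t, x) \<Rightarrow>
      indicator {0..1::real} t * (u (x + t *\<^sub>R a) * \<psi> (x + t *\<^sub>R b)))) \<in> borel_measurable lborel"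
      by measurable
    have "0 \<le> (LINT x|lborel. \<bar>u (x + t *\<^sub>R a) * \<psi> (x + t *\<^sub>R b)\<bar>)" for t by simp
    then show "AE t in lborel. norm (LINT x|lborel. norm (case (t, x) of (t, x) \<Rightarrow>
      indicator {0..1::real} t * (u (x + t *\<^sub>R a) * \<psi> (x + t *\<^sub>R b)))) \<le> norm (indicator {0..1::real} t *\<^sub>R ?C)"
      using n' by (auto simp: indicator_def intro: order_trans[OF _ abs_ge_self])
  qed
qed

lemma has_weak_gradient_directional:
  assumes w: "has_weak_gradient u g" and \<phi>: "test_function \<phi>"
  shows "(LINT x|lebesgue. u x * (h \<bullet> grad \<phi> x)) = - (LINT x|lebesgue. (g x \<bullet> h) * \<phi> x)"
proof -
  note li = has_weak_gradientD(1,2)[OF w]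
  have "(LINT x|lebesgue. u x * (h \<bullet> grad \<phi> x)) = (LINT x|lebesgue. (\<Sum>i\<in>UNIV. h $ i * (u x * partial_deriv i \<phi> x)))"
    by (simp add: inner_vec_def sum_distrib_left mult_ac)
  also have "\<dots> = (\<Sum>i\<in>UNIV. h $ i * (LINT x|lebesgue. u x * partial_deriv i \<phi> x))"
    by (subst Bochner_Integration.integral_sum)
       (auto intro!: integrable_mult_right integrable_mult_partial_deriv li \<phi>)
  also have "\<dots> = - (\<Sum>i\<in>UNIV. h $ i * (LINT x|lebesgue. g x $ i * \<phi> x))"
    by (simp add: has_weak_gradientD(3)[OF w \<phi>] sum_negf)
  also have "(\<Sum>i\<in>UNIV. h $ i * (LINT x|lebesgue. g x $ i * \<phi> x)) = (LINT x|lebesgue. (\<Sum>i\<in>UNIV. h $ i * (g x $ i * \<phi> x)))"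
    by (subst Bochner_Integration.integral_sum)
       (auto intro!: integrable_mult_right integrable_mult_test_function locally_integrable_nth li \<phi>)
  also have "\<dots> = (LINT x|lebesgue. (g x \<bullet> h) * \<phi> x)"
    by (simp add: inner_vec_def sum_distrib_right) (simp add: mult_ac)
  finally show ?thesis .
qed

lemma segment_integral:
  fixes \<phi> :: "real^'n::finite \<Rightarrow> real"
  assumes \<phi>: "test_function \<phi>"
  shows "(LINT t|lborel. indicator {0..1} t * (h \<bullet> grad \<phi> (x + t *\<^sub>R h))) = \<phi> (x + h) - \<phi> x"
proof -
  have "(LINT t|lborel. indicator {0..1} t *\<^sub>R (h \<bullet> grad \<phi> (x + t *\<^sub>R h))) =
      (\<lambda>t. \<phi> (x + t *\<^sub>R h)) 1 - (\<lambda>t. \<phi> (x + t *\<^sub>R h)) 0"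
  proof (rule integral_FTC_Icc)
    fix t :: real
    have "((\<lambda>t. x + t *\<^sub>R h) has_derivative (\<lambda>s. s *\<^sub>R h)) (at t within {0..1})"
      by (auto intro!: derivative_eq_intros)
    from has_derivative_compose[OF this has_derivative_grad[OF test_function_differentiable[OF \<phi>]]]
    show "((\<lambda>t. \<phi> (x + t *\<^sub>R h)) has_vector_derivative h \<bullet> grad \<phi> (x + t *\<^sub>R h)) (at t within {0..1})"
      by (simp add: has_vector_derivative_def)
  next
    have "continuous_on {0..1::real} (\<lambda>t. \<Sum>i\<in>UNIV. h $ i * partial_deriv i \<phi> (x + t *\<^sub>R h))"
      by (intro continuous_on_sum continuous_on_mult continuous_on_const
          continuous_on_compose2[OF test_function_continuous[OF test_function_partial_deriv[OF \<phi>]]])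
         (auto intro!: continuous_intros)
    then show "continuous_on {0..1::real} (\<lambda>t. h \<bullet> grad \<phi> (x + t *\<^sub>R h))"
      by (simp add: inner_vec_def)
  qed simp
  then show ?thesis by simp
qed

text \<open>The fundamental theorem of calculus is applied to the smooth factor, so that u may be
  merely locally integrable; Fubini then exchanges t and x.\<close>

lemma difference_against_test_function:
  fixes u :: "real^'n::finite \<Rightarrow> real"
  assumes u[measurable]: "u \<in> borel_measurable borel" and li: "locally_integrable u" and \<phi>: "test_function \<phi>"
  shows "(LINT x|lborel. u x * (\<phi> (x + h) - \<phi> x)) =
    (LINT t|lborel. indicator {0..1} t * (LINT x|lborel. u x * (h \<bullet> grad \<phi> (x + t *\<^sub>R h))))"
proof -
  obtain N where N: "\<And>x. x \<notin> cube N \<Longrightarrow> \<phi> x = 0" using test_function_support[OF \<phi>] by blast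
  obtain D where D: "\<And>x. norm (grad \<phi> x) \<le> D" using test_function_grad_bounded[OF \<phi>] by blast
  have "integrable (lborel \<Otimes>\<^sub>M lborel)
    (\<lambda>(t, x). indicator {0..1::real} t * (u (x + t *\<^sub>R 0) * (\<lambda>y. h \<bullet> grad \<phi> y) (x + t *\<^sub>R h)))"
  proof (rule integrable_sheared[OF u li])
    show "(\<lambda>y. h \<bullet> grad \<phi> y) \<in> borel_measurable borel" using test_function_grad_borel[OF \<phi>] by measurable
    show "\<bar>h \<bullet> grad \<phi> x\<bar> \<le> norm h * D" for x
      using Cauchy_Schwarz_ineq2[of h "grad \<phi> x"] D[of x] by (meson mult_left_mono norm_ge_zero order_trans)
    show "h \<bullet> grad \<phi> x = 0" if "x \<notin> cube N" for x
      using partial_deriv_zero_outside[OF closed_cube N that] by (simp add: inner_vec_def)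
  qed
  then have I: "integrable (lborel \<Otimes>\<^sub>M lborel)
    (\<lambda>(t, x). indicator {0..1::real} t * (u x * (h \<bullet> grad \<phi> (x + t *\<^sub>R h))))" by simp
  have "(LINT x|lborel. u x * (\<phi> (x + h) - \<phi> x)) =
    (LINT x|lborel. LINT t|lborel. indicator {0..1} t * (u x * (h \<bullet> grad \<phi> (x + t *\<^sub>R h))))"
  proof (rule Bochner_Integration.integral_cong)
    fix x
    have "(LINT t|lborel. indicator {0..1} t * (u x * (h \<bullet> grad \<phi> (x + t *\<^sub>R h)))) =
      (LINT t|lborel. u x * (indicator {0..1} t * (h \<bullet> grad \<phi> (x + t *\<^sub>R h))))"
      by (simp add: mult_ac)
    also have "\<dots> = u x * (\<phi> (x + h) - \<phi> x)"
      by (simp only: integral_mult_right_zero segment_integral[OF \<phi>])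
    finally show "u x * (\<phi> (x + h) - \<phi> x) =
       (LINT t|lborel. indicator {0..1} t * (u x * (h \<bullet> grad \<phi> (x + t *\<^sub>R h))))" by simp
  qed simp
  also have "\<dots> = (LINT t|lborel. LINT x|lborel. indicator {0..1} t * (u x * (h \<bullet> grad \<phi> (x + t *\<^sub>R h))))"
    by (rule lborel_pair.Fubini_integral[OF I])
  finally show ?thesis by simp
qed

text \<open>Translation invariance makes the integral of \<phi>(x + e_i) - \<phi>(x) vanish, and
  Fubini identifies it with the integral of the i-th partial derivative of \<phi>.\<close>

lemma has_weak_gradient_const: "has_weak_gradient (\<lambda>x. c) (\<lambda>x. 0)"
  unfolding has_weak_gradient_def
proof (intro conjI allI impI)
  show l: "locally_integrable (\<lambda>x::real^'a. c)" by (rule loc_L2_locally_integrable[OF loc_L2_const])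
  show "locally_integrable (\<lambda>x::real^'a. 0 :: real^'a)" by (rule loc_L2_locally_integrable[OF loc_L2_const])
  fix \<phi> :: "real^'a \<Rightarrow> real" and i assume \<phi>: "test_function \<phi>"
  note p = test_function_partial_deriv[OF \<phi>, of i]
  have li: "locally_integrable (\<lambda>x::real^'a. 1::real)" by (rule loc_L2_locally_integrable[OF loc_L2_const])
  have i: "integrable lborel \<phi>" "integrable lborel (partial_deriv i \<phi>)"
    using integrable_mult_test_function[OF li \<phi>] integrable_mult_test_function[OF li p]
    by (simp_all add: integrable_lborel_eq test_function_borel \<phi> p)
  have e: "axis i 1 \<bullet> grad \<phi> x = partial_deriv i \<phi> x" for x by (simp add: inner_axis')
  have "0 = (LINT x|lborel. \<phi> (x + axis i 1) - \<phi> x)"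
    using integrable_lborel_translation[OF i(1), of "axis i 1"] i(1) by simp
  also have "\<dots> = (LINT t|lborel. indicator {0..1} t * (LINT x|lborel. partial_deriv i \<phi> (x + t *\<^sub>R axis i 1)))"
    using difference_against_test_function[OF _ li \<phi>, of "axis i 1"] by (simp add: e)
  also have "\<dots> = (LINT t|lborel. indicator {0..1::real} t * (LINT x|lborel. partial_deriv i \<phi> x))"
    by (simp add: integrable_lborel_translation(2)[OF i(2)])
  also have "\<dots> = (LINT x|lborel. partial_deriv i \<phi> x)"
    by simp
  finally show "(LINT x|lebesgue. c * partial_deriv i \<phi> x) = - (LINT x|lebesgue. 0 $ i * \<phi> x)"
    by (simp add: integral_lborel_eq test_function_borel p)
qed

text \<open>By duality: the difference is shifted onto the test function, written there as a segment
  integral, and the weak gradient is used at each t. The Borel representatives \<open>u\<close> and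
  \<open>G\<close> serve the use of Fubini.\<close>

lemma weak_gradient_segment_integral:
  fixes u G :: "real^'n::finite \<Rightarrow> real"
  assumes w: "has_weak_gradient u0 g"
    and u[measurable]: "u \<in> borel_measurable borel" and u0: "AE x in lebesgue. u0 x = u x"
    and G[measurable]: "G \<in> borel_measurable borel" and G0: "AE x in lebesgue. g x \<bullet> h = G x"
  shows "AE x in lebesgue. u (x + h) - u x = (LINT t|lborel. indicator {0..1} t * G (x + t *\<^sub>R h))"
proof -
  note li0 = has_weak_gradientD(1,2)[OF w]
  have mu: "u \<in> borel_measurable lebesgue" and mG: "G \<in> borel_measurable lebesgue"
    by (rule borel_lebesgue, simp)+
  have li: "locally_integrable u"
    by (rule locally_integrable_bound[OF li0(1) mu]) (use u0 in \<open>eventually_elim, simp\<close>)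
  have liG: "locally_integrable G"
  proof (rule locally_integrable_bound[OF locally_integrable_scaleR[OF li0(2), of "norm h"] mG])
    show "AE x in lebesgue. norm (G x) \<le> norm (norm h *\<^sub>R g x)"
      using G0
    proof eventually_elim
      case (elim x)
      then show ?case using Cauchy_Schwarz_ineq2[of "g x" h] by (simp add: mult.commute)
    qed
  qed
  define P where "P x = (LINT t|lborel. indicator {0..1::real} t * G (x + t *\<^sub>R h))" for x
  have [measurable]: "P \<in> borel_measurable borel" unfolding P_def by measurable
  have shear: "integrable (lborel \<Otimes>\<^sub>M lborel)
      (\<lambda>(t, x). indicator {0..1::real} t * (G (x + t *\<^sub>R h) * \<psi> x))"
    if "\<psi> \<in> borel_measurable borel" "\<And>x. \<bar>\<psi> x\<bar> \<le> B" "\<And>x. x \<notin> cube N \<Longrightarrow> \<psi> x = 0" for \<psi> B N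
    using integrable_sheared[OF G liG that, where a=h and b=0] by simp
  have inner: "(LINT t|lborel. indicator {0..1::real} t * (G (x + t *\<^sub>R h) * \<psi> x)) = P x * \<psi> x"
    for \<psi> :: "real^'n \<Rightarrow> real" and x
    unfolding P_def by (simp add: mult.assoc[symmetric])
  have liP: "locally_integrable P" unfolding locally_integrable_iff_cube set_integrable_def
  proof
    fix N
    have "integrable lborel (\<lambda>x. P x * indicator (cube N) x)"
      using lborel_pair.integrable_snd[OF shear[of "indicator (cube N)" 1 N]]
      unfolding inner by (simp add: indicator_def)
    then show "integrable lebesgue (\<lambda>x. indicator (cube N) x *\<^sub>R P x)"
      by (subst integrable_lborel_eq) (auto simp: mult.commute)
  qed
  have "AE x in lebesgue. u (x + h) - u x - P x = 0"
  proof (rule fundamental_lemma)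
    note liu = locally_integrable_translation[OF li, of h]
    show "locally_integrable (\<lambda>x. u (x + h) - u x - P x)"
      using locally_integrable_add[OF locally_integrable_add[OF liu locally_integrable_scaleR[OF li, of "-1"]]
        locally_integrable_scaleR[OF liP, of "-1"]] by simp
    fix \<phi> :: "real^'n \<Rightarrow> real" assume \<phi>: "test_function \<phi>"
    note [measurable] = test_function_borel[OF \<phi>] test_function_grad_borel[OF \<phi>]
    obtain N where N: "\<And>x. x \<notin> cube N \<Longrightarrow> \<phi> x = 0" using test_function_support[OF \<phi>] by blast
    obtain B where B: "\<And>x. \<bar>\<phi> x\<bar> \<le> B" using test_function_bounded[OF \<phi>] by blast
    have i1: "integrable lborel (\<lambda>x. u (x + h) * \<phi> x)" and i2: "integrable lborel (\<lambda>x. u x * \<phi> x)"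
      and i3: "integrable lborel (\<lambda>x. P x * \<phi> x)"
      using integrable_mult_test_function[OF liu \<phi>] integrable_mult_test_function[OF li \<phi>]
        integrable_mult_test_function[OF liP \<phi>] by (simp_all add: integrable_lborel_eq)
    have t: "test_function (\<lambda>x. \<phi> (x - a))" for a
      using test_function_affine_arg[OF \<phi>, of 1 "- a"] by simp
    have gt: "grad (\<lambda>x. \<phi> (x - a)) x = grad \<phi> (x - a)" for a x
      using partial_deriv_affine_arg[OF test_function_differentiable[OF \<phi>], where c=1 and a="- a"]
      by (simp add: vec_eq_iff)
    have i1': "integrable lborel (\<lambda>x. u x * \<phi> (x - h))"
      using integrable_mult_test_function[OF li t] by (simp add: integrable_lborel_eq)
    have "(LINT x|lborel. u (x + h) * \<phi> x) - (LINT x|lborel. u x * \<phi> x)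
       = (LINT x|lborel. u x * \<phi> (x - h)) - (LINT x|lborel. u x * \<phi> x)"
      using integrable_lborel_translation(2)[OF i1', of h] by simp
    also have "\<dots> = (LINT x|lborel. u x * (\<phi> (x + - h) - \<phi> x))"
      using Bochner_Integration.integral_diff[OF i1' i2] by (simp add: right_diff_distrib)
    also have "\<dots> = (LINT t|lborel. indicator {0..1} t * (LINT x|lborel. u x * (- h \<bullet> grad \<phi> (x + t *\<^sub>R (- h)))))"
      by (rule difference_against_test_function[OF u li \<phi>])
    \<comment> \<open>For fixed t the shifted test function is admissible in the definition of the
      weak gradient. That definition concerns \<open>u0\<close> and \<open>g\<close>, so the Borel
      representatives are exchanged for them and back.\<close>
    also have "\<dots> = (LINT t|lborel. indicator {0..1} t * (LINT x|lborel. G (x + t *\<^sub>R h) * \<phi> x))"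
    proof -
      have "(LINT x|lborel. u x * (- h \<bullet> grad \<phi> (x + t *\<^sub>R (- h)))) = (LINT x|lborel. G (x + t *\<^sub>R h) * \<phi> x)" for t
      proof -
        let ?\<psi> = "\<lambda>x. \<phi> (x - t *\<^sub>R h)"
        have iG: "integrable lborel (\<lambda>x. G x * ?\<psi> x)"
          using integrable_mult_test_function[OF liG t] by (simp add: integrable_lborel_eq)
        have "(LINT x|lborel. u x * (- h \<bullet> grad \<phi> (x + t *\<^sub>R (- h)))) = - (LINT x|lborel. u x * (h \<bullet> grad ?\<psi> x))"
          by (simp add: gt)
        also have "(LINT x|lborel. u x * (h \<bullet> grad ?\<psi> x)) = (LINT x|lebesgue. u x * (h \<bullet> grad ?\<psi> x))"
          by (subst integral_lborel_eq) (simp_all add: gt)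
        also have "\<dots> = (LINT x|lebesgue. u0 x * (h \<bullet> grad ?\<psi> x))"
        proof (rule integral_cong_AE)
          have m: "(\<lambda>x. h \<bullet> grad ?\<psi> x) \<in> borel_measurable lebesgue"
            by (rule borel_lebesgue) (simp add: gt)
          show "(\<lambda>x. u x * (h \<bullet> grad ?\<psi> x)) \<in> borel_measurable lebesgue"
            by (rule borel_measurable_times[OF mu m])
          show "(\<lambda>x. u0 x * (h \<bullet> grad ?\<psi> x)) \<in> borel_measurable lebesgue"
            by (rule borel_measurable_times[OF locally_integrable_measurable[OF li0(1)] m])
          show "AE x in lebesgue. u x * (h \<bullet> grad ?\<psi> x) = u0 x * (h \<bullet> grad ?\<psi> x)"
            using u0 by eventually_elim simp
        qed
        also have "\<dots> = - (LINT x|lebesgue. (g x \<bullet> h) * ?\<psi> x)"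
          by (rule has_weak_gradient_directional[OF w t])
        also have "(LINT x|lebesgue. (g x \<bullet> h) * ?\<psi> x) = (LINT x|lebesgue. G x * ?\<psi> x)"
        proof (rule integral_cong_AE)
          have m: "?\<psi> \<in> borel_measurable lebesgue" by (rule borel_lebesgue) simp
          show "(\<lambda>x. (g x \<bullet> h) * ?\<psi> x) \<in> borel_measurable lebesgue"
            by (intro borel_measurable_times borel_measurable_inner m locally_integrable_measurable[OF li0(2)]) simp
          show "(\<lambda>x. G x * ?\<psi> x) \<in> borel_measurable lebesgue"
            by (rule borel_measurable_times[OF mG m])
          show "AE x in lebesgue. (g x \<bullet> h) * ?\<psi> x = G x * ?\<psi> x"
            using G0 by eventually_elim simp
        qed
        also have "\<dots> = (LINT x|lborel. G x * ?\<psi> x)"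
          by (rule integral_lborel_eq) simp
        also have "\<dots> = (LINT x|lborel. G (x + t *\<^sub>R h) * \<phi> x)"
          using integrable_lborel_translation(2)[OF iG, of "t *\<^sub>R h"] by simp
        finally show ?thesis by simp
      qed
      then show ?thesis by simp
    qed
    also have "\<dots> = (LINT t|lborel. LINT x|lborel. indicator {0..1} t * (G (x + t *\<^sub>R h) * \<phi> x))" by simp
    also have "\<dots> = (LINT x|lborel. P x * \<phi> x)"
      using lborel_pair.Fubini_integral[OF shear[OF test_function_borel[OF \<phi>] B N]] unfolding inner
      by (rule sym)
    finally have "(LINT x|lborel. u (x + h) * \<phi> x - u x * \<phi> x - P x * \<phi> x) = 0"
      using i1 i2 i3 by simp
    then have "(LINT x|lborel. (u (x + h) - u x - P x) * \<phi> x) = 0" by (simp add: left_diff_distrib)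
    then show "(LINT x|lebesgue. (u (x + h) - u x - P x) * \<phi> x) = 0"
      by (subst integral_lborel_eq) auto
  qed
  then show ?thesis unfolding P_def by eventually_elim simp
qed

section \<open>A Poincare inequality with the energy on a larger cube\<close>

lemma measure_cube: "measure lebesgue (cube N :: (real^'n::finite) set) = real N ^ CARD('n)"
proof -
  have "cube N \<noteq> ({} :: (real^'n) set)" using mem_cube[of "0 :: real^'n" N] by auto
  then have "measure lborel (cube N :: (real^'n) set) = (\<Prod>i\<in>(UNIV :: 'n set). real N)"
    unfolding cube_def by (subst content_cbox_cart) auto
  then show ?thesis by (simp add: measure_completion)
qed

lemma emeasure_cube: "emeasure lborel (cube N :: (real^'n::finite) set) = ennreal (real N ^ CARD('n))"
proof -
  have "emeasure lborel (cube N :: (real^'n) set) = ennreal (measure lborel (cube N :: (real^'n) set))"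
    using emeasure_cube_finite[where 'a='n, of N] by (intro emeasure_eq_ennreal_measure) auto
  then show ?thesis using measure_cube[where 'n='n, of N] by (simp add: measure_completion)
qed

lemma nn_integral_lborel_translation:
  fixes f :: "'a::euclidean_space \<Rightarrow> ennreal"
  assumes [measurable]: "f \<in> borel_measurable borel"
  shows "(\<integral>\<^sup>+x. f (x + a) \<partial>lborel) = (\<integral>\<^sup>+x. f x \<partial>lborel)"
proof -
  have "(\<integral>\<^sup>+x. f x \<partial>lborel) = (\<integral>\<^sup>+x. f x \<partial>distr lborel borel ((+) a))"
    by (simp add: lborel_distr_plus)
  also have "\<dots> = (\<integral>\<^sup>+x. f (a + x) \<partial>lborel)"
    by (rule nn_integral_distr) auto
  finally show ?thesis by (simp add: add.commute)
qed

text \<open>Cauchy-Schwarz on an interval of length 1. If the integrand is not integrable, the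
  integral on the left has the default value 0.\<close>

lemma power2_integral_le_nn_integral:
  fixes G :: "real \<Rightarrow> real"
  assumes [measurable]: "G \<in> borel_measurable borel"
  shows "ennreal ((LINT t|lborel. indicator {0..1} t * G t)\<^sup>2) \<le> (\<integral>\<^sup>+t\<in>{0..1}. ennreal ((G t)\<^sup>2) \<partial>lborel)"
proof (cases "integrable lborel (\<lambda>t. indicator {0..1} t * G t)")
  case True
  let ?f = "\<lambda>t. ennreal (\<bar>G t\<bar>) * indicator {0..1} t"
  have "ennreal \<bar>LINT t|lborel. indicator {0..1} t * G t\<bar> \<le> (\<integral>\<^sup>+t. ennreal (norm (indicator {0..1} t * G t)) \<partial>lborel)"
    using integral_norm_bound_ennreal[OF True] by simp
  also have "\<dots> = (\<integral>\<^sup>+t. ?f t * indicator {0..1} t \<partial>lborel)"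
    by (intro nn_integral_cong) (auto simp: indicator_def)
  finally have "(ennreal \<bar>LINT t|lborel. indicator {0..1} t * G t\<bar>)\<^sup>2 \<le> (\<integral>\<^sup>+t. ?f t * indicator {0..1} t \<partial>lborel)\<^sup>2"
    by (rule power_mono) simp
  also have "\<dots> \<le> (\<integral>\<^sup>+t. (?f t)\<^sup>2 \<partial>lborel) * (\<integral>\<^sup>+t. (indicator {0..1::real} t)\<^sup>2 \<partial>lborel)"
    using Cauchy_Schwarz_nn_integral[of ?f lborel "indicator {0..1}"] by simp
  also have "(\<integral>\<^sup>+t. (indicator {0..1::real} t)\<^sup>2 \<partial>lborel) = (\<integral>\<^sup>+t. indicator {0..1::real} t \<partial>lborel)"
    by (intro nn_integral_cong) (auto simp: indicator_def)
  also have "(\<integral>\<^sup>+t. indicator {0..1::real} t \<partial>lborel) = 1"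
    by simp
  also have "(\<integral>\<^sup>+t. (?f t)\<^sup>2 \<partial>lborel) = (\<integral>\<^sup>+t\<in>{0..1}. ennreal ((G t)\<^sup>2) \<partial>lborel)"
    by (intro nn_integral_cong) (auto simp: indicator_def ennreal_power)
  finally show ?thesis by (simp add: ennreal_power)
qed (simp add: not_integrable_integral_eq)

lemma borel_version_real:
  fixes f :: "real^'n::finite \<Rightarrow> real"
  assumes "f \<in> borel_measurable lebesgue"
  obtains f' where "f' \<in> borel_measurable borel" "AE x in lebesgue. f x = f' x"
proof -
  obtain f' where "f' \<in> borel_measurable lborel" "AE x in lborel. f x = f' x"
    using completion_ex_borel_measurable_real[OF assms] by blast
  then show ?thesis using that[of f'] AE_completion by auto
qed

lemma borel_version_vec:
  fixes g :: "real^'n::finite \<Rightarrow> real^'n"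
  assumes "g \<in> borel_measurable lebesgue"
  obtains g' where "g' \<in> borel_measurable borel" "AE x in lebesgue. g x = g' x"
proof -
  have "\<exists>f'. f' \<in> borel_measurable borel \<and> (AE x in lebesgue. g x $ i = f' x)" for i
    by (rule borel_version_real[OF measurable_nth[OF assms, of i]]) blast
  then obtain f' where f': "\<And>i. f' i \<in> borel_measurable borel" "\<And>i. AE x in lebesgue. g x $ i = f' i x"
    by metis
  have "AE x in lebesgue. \<forall>i\<in>UNIV. g x $ i = f' i x" using f'(2) by (intro AE_finite_allI) auto
  then have "AE x in lebesgue. g x = (\<chi> i. f' i x)" by eventually_elim (simp add: vec_eq_iff)
  moreover have "(\<lambda>x. \<chi> i. f' i x) \<in> borel_measurable borel" using f'(1) by (intro measurable_vecI) simp
  ultimately show ?thesis using that by blast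
qed

lemma norm_le_cube:
  fixes h :: "real^'n::finite"
  assumes "h \<in> cube (2 * R)" shows "(norm h)\<^sup>2 \<le> real CARD('n) * (real R)\<^sup>2"
proof -
  have "(norm h)\<^sup>2 = (\<Sum>i\<in>UNIV. (h $ i)\<^sup>2)"
    unfolding power2_norm_eq_inner inner_vec_def by (simp add: power2_eq_square)
  also have "\<dots> \<le> (\<Sum>i\<in>(UNIV :: 'n set). (real R)\<^sup>2)"
  proof (rule sum_mono)
    fix i have "\<bar>h $ i\<bar> \<le> real R" using assms[unfolded mem_cube, rule_format, of i] by simp
    then show "(h $ i)\<^sup>2 \<le> (real R)\<^sup>2" by (metis abs_ge_zero power2_abs power_mono)
  qed
  finally show ?thesis by simp
qed

text \<open>A segment from x in \<open>cube R\<close> along h in \<open>cube (2 * R)\<close> stays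
  in \<open>cube (3 * R)\<close>, as R/2 + R = 3R/2. Cauchy-Schwarz along the segment contributes
  |h|^2 \<le> d R^2, and translation invariance removes the shift by th.\<close>

lemma translation_estimate:
  fixes u :: "real^'n::finite \<Rightarrow> real" and \<gamma> :: "real^'n \<Rightarrow> real^'n"
  assumes w: "has_weak_gradient u0 g"
    and u[measurable]: "u \<in> borel_measurable borel" and u0: "AE x in lebesgue. u0 x = u x"
    and \<gamma>[measurable]: "\<gamma> \<in> borel_measurable borel" and g: "AE x in lebesgue. g x = \<gamma> x"
    and h: "h \<in> cube (2 * R)"
  shows "(\<integral>\<^sup>+x\<in>cube R. ennreal ((u x - u (x + h))\<^sup>2) \<partial>lborel)
    \<le> ennreal (real CARD('n) * (real R)\<^sup>2) * (\<integral>\<^sup>+x\<in>cube (3 * R). ennreal ((norm (\<gamma> x))\<^sup>2) \<partial>lborel)"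
proof -
  let ?c = "ennreal (real CARD('n) * (real R)\<^sup>2)"
  let ?E = "\<lambda>x. ennreal ((norm (\<gamma> x))\<^sup>2)"
  have "AE x in lebesgue. u (x + h) - u x = (LINT t|lborel. indicator {0..1} t * (\<gamma> (x + t *\<^sub>R h) \<bullet> h))"
    by (rule weak_gradient_segment_integral[OF w u u0]) (use g in \<open>measurable, eventually_elim, simp\<close>)
  then have AE: "AE x in lborel. u (x + h) - u x = (LINT t|lborel. indicator {0..1} t * (\<gamma> (x + t *\<^sub>R h) \<bullet> h))"
    by (simp add: AE_completion_iff)
  have "(\<integral>\<^sup>+x\<in>cube R. ennreal ((u x - u (x + h))\<^sup>2) \<partial>lborel)
     \<le> (\<integral>\<^sup>+x. (\<integral>\<^sup>+t. ?c * (indicator {0..1} t * (?E (x + t *\<^sub>R h) * indicator (cube R) x)) \<partial>lborel) \<partial>lborel)"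
  proof (rule nn_integral_mono_AE, use AE in eventually_elim)
    case (elim x)
    have "ennreal ((u x - u (x + h))\<^sup>2) = ennreal ((u (x + h) - u x)\<^sup>2)" by (simp add: power2_commute)
    also have "\<dots> \<le> (\<integral>\<^sup>+t\<in>{0..1}. ennreal ((\<gamma> (x + t *\<^sub>R h) \<bullet> h)\<^sup>2) \<partial>lborel)"
      unfolding elim by (rule power2_integral_le_nn_integral) measurable
    also have "\<dots> \<le> (\<integral>\<^sup>+t. ?c * (indicator {0..1} t * ?E (x + t *\<^sub>R h)) \<partial>lborel)"
    proof (rule nn_integral_mono)
      fix t :: real
      have "(\<gamma> (x + t *\<^sub>R h) \<bullet> h)\<^sup>2 \<le> (norm (\<gamma> (x + t *\<^sub>R h)) * norm h)\<^sup>2"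
        using Cauchy_Schwarz_ineq2[of "\<gamma> (x + t *\<^sub>R h)" h]
        by (metis abs_ge_zero power2_abs power_mono)
      also have "\<dots> \<le> (norm (\<gamma> (x + t *\<^sub>R h)))\<^sup>2 * (real CARD('n) * (real R)\<^sup>2)"
        unfolding power_mult_distrib using norm_le_cube[OF h] by (rule mult_left_mono) simp
      finally have "ennreal ((\<gamma> (x + t *\<^sub>R h) \<bullet> h)\<^sup>2) \<le> ?c * ?E (x + t *\<^sub>R h)"
        by (subst ennreal_mult[symmetric]) (auto simp: mult.commute)
      then show "ennreal ((\<gamma> (x + t *\<^sub>R h) \<bullet> h)\<^sup>2) * indicator {0..1} t \<le> ?c * (indicator {0..1} t * ?E (x + t *\<^sub>R h))"
        by (auto simp: indicator_def)
    qed
    finally show ?case by (cases "x \<in> cube R") auto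
  qed
  also have "\<dots> = (\<integral>\<^sup>+t. (\<integral>\<^sup>+x. ?c * (indicator {0..1} t * (?E (x + t *\<^sub>R h) * indicator (cube R) x)) \<partial>lborel) \<partial>lborel)"
    by (rule lborel_pair.Fubini') measurable
  also have "\<dots> \<le> (\<integral>\<^sup>+t. ?c * (\<integral>\<^sup>+x\<in>cube (3 * R). ?E x \<partial>lborel) * indicator {0..1::real} t \<partial>lborel)"
  proof (rule nn_integral_mono)
    fix t :: real
    have "(\<integral>\<^sup>+x. ?E (x + t *\<^sub>R h) * indicator (cube R) x \<partial>lborel) \<le> (\<integral>\<^sup>+x\<in>cube (3 * R). ?E x \<partial>lborel)"
      if t: "t \<in> {0..1}"
    proof -
      have "(\<integral>\<^sup>+x. ?E (x + t *\<^sub>R h) * indicator (cube R) x \<partial>lborel) \<le>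
        (\<integral>\<^sup>+x. (\<lambda>y. ?E y * indicator (cube (3 * R)) y) (x + t *\<^sub>R h) \<partial>lborel)"
      proof (rule nn_integral_mono)
        fix x
        have "x + t *\<^sub>R h \<in> cube (3 * R)" if x: "x \<in> cube R"
          unfolding mem_cube
        proof
          fix i
          have "\<bar>x $ i\<bar> \<le> real R / 2" using x by (simp add: mem_cube)
          moreover have "\<bar>t * h $ i\<bar> \<le> 1 * real R"
            unfolding abs_mult using t h[unfolded mem_cube, rule_format, of i] by (intro mult_mono) auto
          ultimately show "\<bar>(x + t *\<^sub>R h) $ i\<bar> \<le> real (3 * R) / 2"
            using abs_triangle_ineq[of "x $ i" "t * h $ i"] by simp
        qed
        then show "?E (x + t *\<^sub>R h) * indicator (cube R) x \<le> (\<lambda>y. ?E y * indicator (cube (3 * R)) y) (x + t *\<^sub>R h)"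
          by (auto simp: indicator_def)
      qed
      also have "\<dots> = (\<integral>\<^sup>+x. ?E x * indicator (cube (3 * R)) x \<partial>lborel)"
        by (rule nn_integral_lborel_translation) measurable
      finally show ?thesis .
    qed
    then show "(\<integral>\<^sup>+x. ?c * (indicator {0..1} t * (?E (x + t *\<^sub>R h) * indicator (cube R) x)) \<partial>lborel)
       \<le> ?c * (\<integral>\<^sup>+x\<in>cube (3 * R). ?E x \<partial>lborel) * indicator {0..1::real} t"
      by (subst nn_integral_cmult, measurable) (auto simp: indicator_def intro: mult_left_mono)
  qed
  also have "\<dots> = ?c * (\<integral>\<^sup>+x\<in>cube (3 * R). ?E x \<partial>lborel)"
    by (subst nn_integral_cmult_indicator) auto
  finally show ?thesis .
qed

lemma nn_integral_cube_eq:
  fixes f :: "real^'n::finite \<Rightarrow> real"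
  assumes "set_integrable lebesgue (cube N) f" "\<And>x. 0 \<le> f x"
  shows "(\<integral>\<^sup>+x\<in>cube N. ennreal (f x) \<partial>lebesgue) = ennreal (LINT x:cube N|lebesgue. f x)"
proof -
  have "(\<integral>\<^sup>+x. ennreal (indicator (cube N) x *\<^sub>R f x) \<partial>lebesgue) = ennreal (LINT x:cube N|lebesgue. f x)"
    unfolding set_lebesgue_integral_def
    by (rule nn_integral_eq_integral) (use assms in \<open>auto simp: set_integrable_def\<close>)
  moreover have "(\<integral>\<^sup>+x. ennreal (indicator (cube N) x *\<^sub>R f x) \<partial>lebesgue) = (\<integral>\<^sup>+x\<in>cube N. ennreal (f x) \<partial>lebesgue)"
    by (rule nn_integral_cong) (auto simp: indicator_def)
  ultimately show ?thesis by simp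
qed

text \<open>The mean of \<open>\<integral>|u(x) - u(y)|\<^sup>2 dx\<close> over \<open>y\<close> is controlled by the translation estimate, so some
  value \<open>c = u(y)\<close> does the job.\<close>

lemma poincare:
  fixes u0 :: "real^'n::finite \<Rightarrow> real"
  assumes w: "has_weak_gradient u0 g" and L2: "loc_L2 u0" "loc_L2 g" and R: "0 < R"
  shows "\<exists>c. (LINT x:cube R|lebesgue. (u0 x - c)\<^sup>2) \<le>
    2 ^ CARD('n) * real CARD('n) * (real R)\<^sup>2 * (LINT x:cube (3 * R)|lebesgue. (norm (g x))\<^sup>2)"
proof -
  obtain u where u[measurable]: "u \<in> borel_measurable borel" and u0: "AE x in lebesgue. u0 x = u x"
    using borel_version_real[OF loc_L2_measurable[OF L2(1)]] by blast
  obtain \<gamma> where \<gamma>[measurable]: "\<gamma> \<in> borel_measurable borel" and g: "AE x in lebesgue. g x = \<gamma> x"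
    using borel_version_vec[OF loc_L2_measurable[OF L2(2)]] by blast
  define m where "m = (LINT x:cube (3 * R)|lebesgue. (norm (g x))\<^sup>2)"
  have m0: "0 \<le> m" unfolding m_def set_lebesgue_integral_def by (intro integral_nonneg_AE) auto
  have mE: "(\<integral>\<^sup>+x\<in>cube (3 * R). ennreal ((norm (\<gamma> x))\<^sup>2) \<partial>lborel) = ennreal m"
  proof -
    have "(\<integral>\<^sup>+x\<in>cube (3 * R). ennreal ((norm (\<gamma> x))\<^sup>2) \<partial>lborel) = (\<integral>\<^sup>+x\<in>cube (3 * R). ennreal ((norm (\<gamma> x))\<^sup>2) \<partial>lebesgue)"
      by (simp add: nn_integral_completion)
    also have "\<dots> = (\<integral>\<^sup>+x\<in>cube (3 * R). ennreal ((norm (g x))\<^sup>2) \<partial>lebesgue)"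
      by (rule nn_integral_cong_AE) (use g in \<open>eventually_elim, simp\<close>)
    also have "\<dots> = ennreal m" unfolding m_def
      by (rule nn_integral_cube_eq[OF loc_L2_square_integrable[OF L2(2)]]) simp
    finally show ?thesis .
  qed
  let ?V = "real R ^ CARD('n)"
  \<comment> \<open>The factor 2^d is the volume of \<open>cube (2 * R)\<close>, the range of the
    differences h = y - x, divided by the volume of \<open>cube R\<close>, over which y is
    averaged.\<close>
  define K where "K = 2 ^ CARD('n) * real CARD('n) * (real R)\<^sup>2 * m"
  have K0: "0 \<le> K" unfolding K_def using m0 by simp
  define J where "J y = (\<integral>\<^sup>+x\<in>cube R. ennreal ((u x - u y)\<^sup>2) \<partial>lborel)" for y
  have [measurable]: "J \<in> borel_measurable borel" unfolding J_def by measurable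
  have "(\<integral>\<^sup>+y\<in>cube R. J y \<partial>lborel) = (\<integral>\<^sup>+y. (\<integral>\<^sup>+x. ennreal ((u x - u y)\<^sup>2) * indicator (cube R) x * indicator (cube R) y \<partial>lborel) \<partial>lborel)"
    unfolding J_def by (subst nn_integral_multc) auto
  also have "\<dots> = (\<integral>\<^sup>+x. (\<integral>\<^sup>+y. ennreal ((u x - u y)\<^sup>2) * indicator (cube R) x * indicator (cube R) y \<partial>lborel) \<partial>lborel)"
    by (rule lborel_pair.Fubini') measurable
  \<comment> \<open>Substitute y = x + h and relax the condition that x + h lies in
    \<open>cube R\<close> to h in \<open>cube (2 * R)\<close>. The domain of h no longer depends on
    x, so for fixed h the translation estimate applies.\<close>
  also have "\<dots> \<le> (\<integral>\<^sup>+x. (\<integral>\<^sup>+h. ennreal ((u x - u (x + h))\<^sup>2) * indicator (cube R) x * indicator (cube (2 * R)) h \<partial>lborel) \<partial>lborel)"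
  proof (rule nn_integral_mono)
    fix x
    have "(\<integral>\<^sup>+y. ennreal ((u x - u y)\<^sup>2) * indicator (cube R) x * indicator (cube R) y \<partial>lborel) =
      (\<integral>\<^sup>+h. (\<lambda>y. ennreal ((u x - u y)\<^sup>2) * indicator (cube R) x * indicator (cube R) y) (h + x) \<partial>lborel)"
      by (rule nn_integral_lborel_translation[symmetric]) measurable
    also have "\<dots> \<le> (\<integral>\<^sup>+h. ennreal ((u x - u (x + h))\<^sup>2) * indicator (cube R) x * indicator (cube (2 * R)) h \<partial>lborel)"
    proof (rule nn_integral_mono)
      fix h
      have "h \<in> cube (2 * R)" if "x \<in> cube R" "h + x \<in> cube R"
        unfolding mem_cube
      proof
        fix i
        have "\<bar>x $ i\<bar> \<le> real R / 2" "\<bar>h $ i + x $ i\<bar> \<le> real R / 2" using that by (simp_all add: mem_cube)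
        then have "\<bar>h $ i\<bar> \<le> real R" by linarith
        then show "\<bar>h $ i\<bar> \<le> real (2 * R) / 2" by simp
      qed
      then show "(\<lambda>y. ennreal ((u x - u y)\<^sup>2) * indicator (cube R) x * indicator (cube R) y) (h + x) \<le>
        ennreal ((u x - u (x + h))\<^sup>2) * indicator (cube R) x * indicator (cube (2 * R)) h"
        by (auto simp: indicator_def add.commute)
    qed
    finally show "(\<integral>\<^sup>+y. ennreal ((u x - u y)\<^sup>2) * indicator (cube R) x * indicator (cube R) y \<partial>lborel) \<le>
      (\<integral>\<^sup>+h. ennreal ((u x - u (x + h))\<^sup>2) * indicator (cube R) x * indicator (cube (2 * R)) h \<partial>lborel)" .
  qed
  also have "\<dots> = (\<integral>\<^sup>+h. (\<integral>\<^sup>+x. ennreal ((u x - u (x + h))\<^sup>2) * indicator (cube R) x * indicator (cube (2 * R)) h \<partial>lborel) \<partial>lborel)"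
    by (rule lborel_pair.Fubini'[symmetric]) measurable
  also have "\<dots> = (\<integral>\<^sup>+h. (\<integral>\<^sup>+x\<in>cube R. ennreal ((u x - u (x + h))\<^sup>2) \<partial>lborel) * indicator (cube (2 * R)) h \<partial>lborel)"
    by (subst nn_integral_multc) auto
  also have "\<dots> \<le> (\<integral>\<^sup>+h. ennreal (real CARD('n) * (real R)\<^sup>2) * ennreal m * indicator (cube (2 * R)) (h :: real^'n) \<partial>lborel)"
    by (rule nn_integral_mono)
       (use translation_estimate[OF w u u0 \<gamma> g, where R=R, unfolded mE] in \<open>simp add: indicator_def\<close>)
  also have "\<dots> = ennreal (real CARD('n) * (real R)\<^sup>2) * ennreal m * ennreal (real (2 * R) ^ CARD('n))"
    by (subst nn_integral_cmult_indicator) (auto simp: emeasure_cube)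
  also have "\<dots> = ennreal (K * ?V)"
    using m0 by (simp add: ennreal_mult[symmetric] K_def power_mult_distrib mult_ac)
  finally have J: "(\<integral>\<^sup>+y\<in>cube R. J y \<partial>lborel) \<le> ennreal (K * ?V)" .
  \<comment> \<open>Otherwise J exceeds K at every point and, as \<open>cube R\<close> has positive
    measure, so does its mean over that cube.\<close>
  have "\<exists>y. J y \<le> ennreal K"
  proof (rule ccontr)
    assume "\<nexists>y. J y \<le> ennreal K"
    then have gt: "ennreal K < J y" for y by (auto simp: not_le)
    have KV: "(\<integral>\<^sup>+y. ennreal K * indicator (cube R) (y :: real^'n) \<partial>lborel) = ennreal (K * ?V)"
      using K0 by (subst nn_integral_cmult_indicator) (auto simp: emeasure_cube ennreal_mult)
    have "(\<integral>\<^sup>+y. ennreal K * indicator (cube R) (y :: real^'n) \<partial>lborel) < (\<integral>\<^sup>+y. J y * indicator (cube R) y \<partial>lborel)"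
    proof (rule nn_integral_less)
      show "(\<integral>\<^sup>+y. ennreal K * indicator (cube R) (y :: real^'n) \<partial>lborel) \<noteq> \<infinity>" unfolding KV by simp
      show "AE y in lborel. ennreal K * indicator (cube R) y \<le> J y * indicator (cube R) y"
        using gt by (auto simp: indicator_def less_imp_le)
      show "\<not> (AE y in lborel. J y * indicator (cube R) y \<le> ennreal K * indicator (cube R) y)"
      proof
        assume "AE y in lborel. J y * indicator (cube R) y \<le> ennreal K * indicator (cube R) y"
        then have "AE y in lborel. y \<notin> (cube R :: (real^'n) set)"
          by eventually_elim (use gt in \<open>auto simp: indicator_def not_le[symmetric]\<close>)
        then have "emeasure lborel (cube R :: (real^'n) set) = 0"
          by (subst (asm) AE_iff_measurable[OF _ refl]) auto
        then show False using R by (simp add: emeasure_cube)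
      qed
    qed measurable
    then show False using J KV by simp
  qed
  then obtain y where y: "J y \<le> ennreal K" ..
  have L2c: "loc_L2 (\<lambda>x. u0 x - u y)" by (rule loc_L2_diff[OF L2(1) loc_L2_const])
  have "ennreal (LINT x:cube R|lebesgue. (u0 x - u y)\<^sup>2) = (\<integral>\<^sup>+x\<in>cube R. ennreal ((u0 x - u y)\<^sup>2) \<partial>lebesgue)"
    using loc_L2_square_integrable[OF L2c, of R] by (intro nn_integral_cube_eq[symmetric]) auto
  also have "\<dots> = (\<integral>\<^sup>+x\<in>cube R. ennreal ((u x - u y)\<^sup>2) \<partial>lebesgue)"
    by (rule nn_integral_cong_AE) (use u0 in \<open>eventually_elim, simp\<close>)
  also have "\<dots> = J y" unfolding J_def by (simp add: nn_integral_completion)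
  finally have "(LINT x:cube R|lebesgue. (u0 x - u y)\<^sup>2) \<le> K"
    using y K0 ennreal_le_iff[OF K0] by metis
  then show ?thesis unfolding K_def m_def by blast
qed

subsection \<open>Periodic functions and lattice cells\<close>

definition zvec :: "nat \<Rightarrow> ('n::finite \<Rightarrow> int) \<Rightarrow> real^'n" where
  "zvec M k = (\<chi> i. real M * of_int (k i))"

definition cells :: "nat \<Rightarrow> ('n::finite \<Rightarrow> int) set" where
  "cells n = {k. \<forall>i. \<bar>k i\<bar> \<le> int n}"

text \<open>Rounding to the nearest lattice point, ties upwards: it selects half-open cells, which
  partition the space, whereas the closed cells given by \<open>cube\<close> share their
  faces.\<close>

definition cell_index :: "nat \<Rightarrow> real^'n::finite \<Rightarrow> 'n \<Rightarrow> int" where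
  "cell_index M x i = \<lfloor>x $ i / real M + 1 / 2\<rfloor>"

lemma zvec_nth [simp]: "zvec M k $ i = real M * of_int (k i)"
  by (simp add: zvec_def)

lemma zvec_zero [simp]: "zvec M (\<lambda>i. 0) = 0"
  by (simp add: vec_eq_iff)

lemma periodicD: "periodic N f \<Longrightarrow> AE x in lebesgue. f (x + zvec N k) = f x"
  by (simp add: periodic_def zvec_def)

lemma periodicI: "(\<And>k. AE x in lebesgue. f (x + zvec N k) = f x) \<Longrightarrow> periodic N f"
  by (simp add: periodic_def zvec_def)

lemma finite_cells [simp]: "finite (cells n :: ('n::finite \<Rightarrow> int) set)"
proof -
  have "z \<in> {- int n..int n} \<longleftrightarrow> \<bar>z\<bar> \<le> int n" for z by auto
  then have "cells n = PiE (UNIV :: 'n set) (\<lambda>_. {- int n..int n})"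
    by (simp only: cells_def PiE_UNIV_domain Pi_def) simp
  then show ?thesis by (simp add: finite_PiE)
qed

lemma cell_index_unique:
  fixes x :: "real^'n::finite"
  assumes "0 < M" "\<And>i. - real M / 2 \<le> x $ i - real M * of_int (k i)" "\<And>i. x $ i - real M * of_int (k i) < real M / 2"
  shows "cell_index M x = k"
proof
  fix i
  have "of_int (k i) \<le> x $ i / real M + 1 / 2" "x $ i / real M + 1 / 2 < of_int (k i) + 1"
    using assms(1) assms(2,3)[of i] by (simp_all add: field_simps)
  then show "cell_index M x i = k i" unfolding cell_index_def by (rule floor_unique)
qed

lemma cell_index_translation:
  fixes x :: "real^'n::finite"
  assumes "0 < M" shows "cell_index M (x + zvec M k) = (\<lambda>i. cell_index M x i + k i)"
proof
  fix i
  have "(x + zvec M k) $ i / real M + 1 / 2 = (x $ i / real M + 1 / 2) + of_int (k i)"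
    using assms by (simp add: field_simps)
  then show "cell_index M (x + zvec M k) i = cell_index M x i + k i"
    unfolding cell_index_def by (simp only: floor_add_int)
qed

lemma AE_coordinate_neq: "AE x in lebesgue. (x::real^'n::finite) $ i \<noteq> c"
proof -
  have "negligible {x::real^'n. x $ i = c}" using negligible_hyperplane[of "axis i 1 :: real^'n" c] by (simp add: inner_axis')
  then have "{x::real^'n. x $ i = c} \<in> null_sets lebesgue" by (simp add: negligible_iff_null_sets)
  then have "AE x in lebesgue. x \<notin> {x::real^'n. x $ i = c}" by (rule AE_not_in)
  then show ?thesis by simp
qed

text \<open>Off its upper faces, a null set, a closed cell contains only points whose
  \<open>cell_index\<close> is that cell; so two cells containing the same point coincide.\<close>

lemma AE_cells_disjoint:
  fixes k l :: "'n::finite \<Rightarrow> int"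
  assumes "0 < M"
  shows "AE x in lebesgue. x - zvec M k \<in> cube M \<and> x - zvec M l \<in> cube M \<longrightarrow> k = l"
proof -
  have one: "AE x in lebesgue. x - zvec M k \<in> cube M \<longrightarrow> cell_index M x = k" for k :: "'n \<Rightarrow> int"
  proof -
    have "AE x in lebesgue. \<forall>i\<in>UNIV. (x :: real^'n) $ i \<noteq> real M * of_int (k i) + real M / 2"
      by (intro AE_finite_allI AE_coordinate_neq) simp
    then show ?thesis
    proof eventually_elim
      case (elim x)
      show ?case
      proof
        assume c: "x - zvec M k \<in> cube M"
        show "cell_index M x = k"
        proof (rule cell_index_unique[OF assms])
          fix i
          have "\<bar>x $ i - real M * of_int (k i)\<bar> \<le> real M / 2" using c by (simp add: mem_cube)
          then show "- real M / 2 \<le> x $ i - real M * of_int (k i)" by linarith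
          have "x $ i \<noteq> real M * of_int (k i) + real M / 2" using elim by blast
          then show "x $ i - real M * of_int (k i) < real M / 2"
            using \<open>\<bar>x $ i - real M * of_int (k i)\<bar> \<le> real M / 2\<close> by linarith
        qed
      qed
    qed
  qed
  show ?thesis using one[of k] one[of l] by eventually_elim blast
qed

lemma cube_eq_UN_cells:
  assumes "0 < M"
  shows "cube (M * (2 * n + 1)) = (\<Union>k\<in>cells n. {x::real^'n::finite. x - zvec M k \<in> cube M})"
proof (intro set_eqI iffI)
  fix x :: "real^'n" assume x: "x \<in> cube (M * (2 * n + 1))"
  have "\<exists>z::int. \<bar>z\<bar> \<le> int n \<and> \<bar>x $ i - real M * of_int z\<bar> \<le> real M / 2" for i
  proof -
    have b: "\<bar>x $ i\<bar> \<le> real M * (2 * real n + 1) / 2"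
      using x[unfolded mem_cube, rule_format, of i] by (simp add: algebra_simps)
    define w where "w = x $ i / real M"
    have xw: "x $ i = real M * w" using assms by (simp add: w_def)
    have w: "\<bar>w\<bar> \<le> real n + 1 / 2"
    proof -
      have "real M * \<bar>w\<bar> \<le> real M * (real n + 1 / 2)"
        using b by (simp add: xw abs_mult algebra_simps)
      then show ?thesis using assms by simp
    qed
    \<comment> \<open>At w = n + 1/2 rounding gives n + 1, which is outside the range; n is then
      just as near.\<close>
    have "\<exists>z::int. \<bar>z\<bar> \<le> int n \<and> \<bar>w - of_int z\<bar> \<le> 1 / 2"
    proof (cases "\<lfloor>w + 1 / 2\<rfloor> \<le> int n")
      case True
      then show ?thesis using w by (intro exI[of _ "\<lfloor>w + 1 / 2\<rfloor>"]) linarith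
    next
      case False
      then show ?thesis using w by (intro exI[of _ "int n"]) linarith
    qed
    then obtain z :: int where z: "\<bar>z\<bar> \<le> int n" "\<bar>w - of_int z\<bar> \<le> 1 / 2" by blast
    have "\<bar>x $ i - real M * of_int z\<bar> = real M * \<bar>w - of_int z\<bar>"
      by (simp add: xw abs_mult right_diff_distrib[symmetric])
    also have "\<dots> \<le> real M * (1 / 2)" using z(2) by (intro mult_left_mono) auto
    finally show ?thesis using z(1) by auto
  qed
  then obtain k where "\<And>i. \<bar>k i\<bar> \<le> int n \<and> \<bar>x $ i - real M * of_int (k i)\<bar> \<le> real M / 2" by metis
  then show "x \<in> (\<Union>k\<in>cells n. {x. x - zvec M k \<in> cube M})"
    by (auto simp: cells_def mem_cube)
next
  fix x :: "real^'n" assume "x \<in> (\<Union>k\<in>cells n. {x. x - zvec M k \<in> cube M})"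
  then obtain k where k: "\<And>i. \<bar>k i\<bar> \<le> int n" "\<And>i. \<bar>x $ i - real M * of_int (k i)\<bar> \<le> real M / 2"
    by (auto simp: cells_def mem_cube)
  show "x \<in> cube (M * (2 * n + 1))" unfolding mem_cube
  proof
    fix i
    have "\<bar>of_int (k i)\<bar> \<le> real n" using k(1)[of i] by linarith
    then have "\<bar>real M * of_int (k i)\<bar> \<le> real M * real n" by (simp add: abs_mult mult_left_mono)
    then have "\<bar>x $ i\<bar> \<le> real M * real n + real M / 2" using k(2)[of i] by linarith
    then show "\<bar>x $ i\<bar> \<le> real (M * (2 * n + 1)) / 2" by (simp add: field_simps)
  qed
qed

lemma cell_closed: "closed {x::real^'n::finite. x - a \<in> cube M}"
proof -
  have "closed ((\<lambda>x. x - a) -` cube M)" by (intro closed_vimage closed_cube continuous_intros)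
  then show ?thesis by (simp add: vimage_def)
qed

lemma cell_sets [measurable]: "{x::real^'n::finite. x - a \<in> cube M} \<in> sets lebesgue"
  using borel_closed[OF cell_closed] by simp

lemma set_integral_cell:
  fixes f :: "real^'n::finite \<Rightarrow> 'b::euclidean_space"
  assumes "set_integrable lebesgue (cube M) (\<lambda>x. f (x + a))"
  shows "set_integrable lebesgue {x. x - a \<in> cube M} f"
    and "(LINT x:{x. x - a \<in> cube M}|lebesgue. f x) = (LINT x:cube M|lebesgue. f (x + a))"
proof -
  let ?F = "\<lambda>x. indicator (cube M) x *\<^sub>R f (x + a)"
  have eq: "indicator {x. x - a \<in> cube M} x *\<^sub>R f x = ?F (x + - a)" for x by (simp add: indicator_def)
  have i: "integrable lebesgue ?F" using assms by (simp add: set_integrable_def)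
  show "set_integrable lebesgue {x. x - a \<in> cube M} f"
    unfolding set_integrable_def eq by (rule integrable_translation[OF i])
  show "(LINT x:{x. x - a \<in> cube M}|lebesgue. f x) = (LINT x:cube M|lebesgue. f (x + a))"
    unfolding set_lebesgue_integral_def eq by (rule integral_translation[OF borel_measurable_integrable[OF i]])
qed

text \<open>The closed cells overlap only in null sets, so the integral splits despite the shared
  faces. The integrability part carries bounds from one period cell to arbitrarily large
  cubes.\<close>

lemma tiling:
  fixes f :: "real^'n::finite \<Rightarrow> 'b::euclidean_space"
  assumes M: "0 < M" and f: "\<And>k. k \<in> cells n \<Longrightarrow> set_integrable lebesgue (cube M) (\<lambda>x. f (x + zvec M k))"
  shows "set_integrable lebesgue (cube (M * (2 * n + 1))) f"
    and "(LINT x:cube (M * (2 * n + 1))|lebesgue. f x) =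
      (\<Sum>k\<in>cells n. LINT x:cube M|lebesgue. f (x + zvec M k))"
proof -
  show "set_integrable lebesgue (cube (M * (2 * n + 1))) f"
    unfolding cube_eq_UN_cells[OF M] by (intro set_integrable_UN set_integral_cell f) auto
  have "(LINT x:cube (M * (2 * n + 1))|lebesgue. f x) =
      (\<Sum>k\<in>cells n. LINT x:{x. x - zvec M k \<in> cube M}|lebesgue. f x)"
    unfolding cube_eq_UN_cells[OF M]
  proof (rule set_integral_finite_UN_AE)
    show "AE x in lebesgue. x \<in> {x. x - zvec M i \<in> cube M} \<and> x \<in> {x. x - zvec M j \<in> cube M} \<longrightarrow> i = j"
      for i j :: "'n \<Rightarrow> int"
      using AE_cells_disjoint[OF M, of i j] by simp
    show "set_integrable lebesgue {x. x - zvec M i \<in> cube M} f" if "i \<in> cells n" for i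
      by (rule set_integral_cell(1)[OF f[OF that]])
  qed simp_all
  also have "\<dots> = (\<Sum>k\<in>cells n. LINT x:cube M|lebesgue. f (x + zvec M k))"
    by (intro sum.cong refl set_integral_cell f)
  finally show "(LINT x:cube (M * (2 * n + 1))|lebesgue. f x) =
      (\<Sum>k\<in>cells n. LINT x:cube M|lebesgue. f (x + zvec M k))" .
qed

section \<open>Periodic Sobolev functions and folding\<close>

lemma periodic_loc_L2:
  fixes f :: "real^'n::finite \<Rightarrow> 'b::euclidean_space"
  assumes N: "0 < N" and p: "periodic N f" and m: "f \<in> borel_measurable lebesgue"
    and i: "set_integrable lebesgue (cube N) (\<lambda>x. (norm (f x))\<^sup>2)"
  shows "loc_L2 f"
  unfolding loc_L2_def
proof (intro conjI allI m)
  fix R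
  have "set_integrable lebesgue (cube (N * (2 * R + 1))) (\<lambda>x. (norm (f x))\<^sup>2)"
  proof (rule tiling(1)[OF N])
    fix k :: "'n \<Rightarrow> int"
    show "set_integrable lebesgue (cube N) (\<lambda>x. (norm (f (x + zvec N k)))\<^sup>2)"
    proof (rule set_integrable_bound[OF i])
      show "set_borel_measurable lebesgue (cube N) (\<lambda>x. (norm (f (x + zvec N k)))\<^sup>2)"
        unfolding set_borel_measurable_def using measurable_translation[OF m] by measurable
      show "AE x in lebesgue. x \<in> cube N \<longrightarrow>
          norm ((norm (f (x + zvec N k)))\<^sup>2) \<le> norm ((norm (f x))\<^sup>2)"
        using periodicD[OF p, of k] by eventually_elim simp
    qed
  qed
  moreover have "R \<le> N * (2 * R + 1)" using N by (cases N) auto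
  ultimately show "set_integrable lebesgue (cube R) (\<lambda>x. (norm (f x))\<^sup>2)"
    by (rule set_integrable_subset[OF _ cube_lebesgue cube_mono])
qed

text \<open>As u agrees almost everywhere with its translate, the translated gradient is again a
  weak gradient of u, and weak gradients are unique.\<close>

lemma periodic_weak_gradient:
  assumes p: "periodic N u" and w: "has_weak_gradient u g" shows "periodic N g"
proof (rule periodicI)
  fix k
  have "has_weak_gradient u (\<lambda>x. g (x + zvec N k))"
    unfolding has_weak_gradient_def
  proof (intro conjI allI impI)
    have w': "has_weak_gradient (\<lambda>x. u (x + zvec N k)) (\<lambda>x. g (x + zvec N k))"
      by (rule has_weak_gradient_translation[OF w])
    show "locally_integrable u" "locally_integrable (\<lambda>x. g (x + zvec N k))"
      using has_weak_gradientD(1)[OF w] has_weak_gradientD(2)[OF w'] .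
    fix \<phi> :: "real^'a \<Rightarrow> real" and i assume \<phi>: "test_function \<phi>"
    have "(LINT x|lebesgue. u x * partial_deriv i \<phi> x) = (LINT x|lebesgue. u (x + zvec N k) * partial_deriv i \<phi> x)"
    proof (rule integral_cong_AE)
      show "AE x in lebesgue. u x * partial_deriv i \<phi> x = u (x + zvec N k) * partial_deriv i \<phi> x"
        using periodicD[OF p, of k] by eventually_elim simp
      show "(\<lambda>x. u x * partial_deriv i \<phi> x) \<in> borel_measurable lebesgue"
        by (rule borel_measurable_integrable[OF integrable_mult_partial_deriv[OF has_weak_gradientD(1)[OF w] \<phi>]])
      show "(\<lambda>x. u (x + zvec N k) * partial_deriv i \<phi> x) \<in> borel_measurable lebesgue"
        by (rule borel_measurable_integrable[OF integrable_mult_partial_deriv[OF has_weak_gradientD(1)[OF w'] \<phi>]])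
    qed
    then show "(LINT x|lebesgue. u x * partial_deriv i \<phi> x) = - (LINT x|lebesgue. g (x + zvec N k) $ i * \<phi> x)"
      using has_weak_gradientD(3)[OF w' \<phi>] by simp
  qed
  then show "AE x in lebesgue. g (x + zvec N k) = g x" using w by (rule weak_gradient_AE_unique)
qed

text \<open>The definition of \<open>H1_per\<close> asks for square integrability on one cell;
  periodicity spreads it to all cubes, which is the form used from here on.\<close>

lemma H1_perD:
  fixes u :: "real^'n::finite \<Rightarrow> real"
  assumes "u \<in> H1_per N" "0 < N"
  shows "has_weak_gradient u (weak_gradient u)" "periodic N u" "periodic N (weak_gradient u)"
    "loc_L2 u" "loc_L2 (weak_gradient u)"
proof -
  show w: "has_weak_gradient u (weak_gradient u)"
    using assms has_weak_gradient_weak_gradient by (auto simp: H1_per_def)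
  show p: "periodic N u" using assms by (simp add: H1_per_def)
  show p': "periodic N (weak_gradient u)" by (rule periodic_weak_gradient[OF p w])
  note m = has_weak_gradientD(1,2)[OF w, THEN locally_integrable_measurable]
  show "loc_L2 u"
    by (rule periodic_loc_L2[OF assms(2) p m(1)]) (use assms in \<open>auto simp: H1_per_def square_integrable_on_def\<close>)
  show "loc_L2 (weak_gradient u)"
    by (rule periodic_loc_L2[OF assms(2) p' m(2)]) (use assms in \<open>auto simp: H1_per_def square_integrable_on_def\<close>)
qed

lemma loc_L2_square_integrable_on:
  assumes "loc_L2 f" shows "f square_integrable_on cube N"
  unfolding square_integrable_on_def
proof
  show "set_borel_measurable lebesgue (cube N) f" unfolding set_borel_measurable_def
    by (intro borel_measurable_scaleR borel_measurable_indicator cube_lebesgue loc_L2_measurable[OF assms])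
qed (rule loc_L2_square_integrable[OF assms])

lemma H1_perI:
  fixes u :: "real^'n::finite \<Rightarrow> real"
  assumes w: "has_weak_gradient u g" and "periodic N u" "loc_L2 u" "loc_L2 g"
  shows "u \<in> H1_per N" "AE x in lebesgue. weak_gradient u x = g x"
proof -
  show ae: "AE x in lebesgue. weak_gradient u x = g x" by (rule weak_gradient_AE_eq[OF w])
  note w' = has_weak_gradient_weak_gradient[OF w]
  have "loc_L2 (weak_gradient u)"
    by (rule loc_L2_cong_AE[OF assms(4) locally_integrable_measurable[OF has_weak_gradientD(2)[OF w']]])
       (use ae in \<open>eventually_elim, simp\<close>)
  then have "u square_integrable_on cube N" "weak_gradient u square_integrable_on cube N"
    using assms(3) by (auto intro: loc_L2_square_integrable_on)
  then show "u \<in> H1_per N" using assms(1,2) unfolding H1_per_def by blast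
qed

lemma periodic_multiple:
  fixes f :: "real^'n::finite \<Rightarrow> 'b"
  assumes "periodic M f" shows "periodic (M * m) f"
proof (rule periodicI)
  fix k :: "'n \<Rightarrow> int"
  have "zvec (M * m) k = zvec M (\<lambda>i. int m * k i)" by (simp add: vec_eq_iff)
  then show "AE x in lebesgue. f (x + zvec (M * m) k) = f x" 
    using periodicD[OF assms, of "\<lambda>i. int m * k i"] by simp
qed

lemma H1_per_multiple:
  assumes "u \<in> H1_per M" "0 < M" shows "u \<in> H1_per (M * m)"
  using H1_perI(1)[OF H1_perD(1)[OF assms] periodic_multiple[OF H1_perD(2)[OF assms]] H1_perD(4,5)[OF assms]] .

text \<open>A shift by a lattice vector permutes the cells modulo 2n+1, and f does not see multiples
  of 2n+1. This folding sends functions on the supercell to functions on the unit torus.\<close>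

lemma periodic_sum_cells:
  fixes f :: "real^'n::finite \<Rightarrow> 'b::comm_monoid_add"
  assumes p: "periodic (2 * n + 1) f"
  shows "periodic 1 (\<lambda>x. \<Sum>k\<in>cells n. f (x + zvec 1 k))"
proof (rule periodicI)
  fix l :: "'n \<Rightarrow> int"
  define N where "N = 2 * int n + 1"
  \<comment> \<open>\<open>r\<close> is the representative modulo 2n+1 in [-n, n] and
    \<open>q\<close> the number of whole periods removed; adding n before the division and
    subtracting it afterwards centres the residues.\<close>
  define q where "q z = (z + int n) div N" for z
  define r where "r z = (z + int n) mod N - int n" for z
  have N: "0 < N" by (simp add: N_def)
  have rq: "z = r z + N * q z" for z
    unfolding r_def q_def using mult_div_mod_eq[of N "z + int n"] by linarith
  have rb: "\<bar>r z\<bar> \<le> int n" for z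
    using pos_mod_bound[OF N, of "z + int n"] pos_mod_sign[OF N, of "z + int n"]
    unfolding r_def N_def by linarith
  define \<rho> where "\<rho> k i = r (k i + l i)" for k :: "'n \<Rightarrow> int" and i
  have "inj_on \<rho> (cells n)"
  proof (rule inj_onI, rule ext)
    fix k k' i assume k: "k \<in> cells n" "k' \<in> cells n" and eq: "\<rho> k = \<rho> k'"
    have "r (k i + l i) = r (k' i + l i)" using fun_cong[OF eq, of i] by (simp add: \<rho>_def)
    then have "k i - k' i = N * (q (k i + l i) - q (k' i + l i))"
      using rq[of "k i + l i"] rq[of "k' i + l i"] by (simp add: algebra_simps)
    then have d: "N dvd k i - k' i" by simp
    have "\<bar>k i\<bar> \<le> int n" "\<bar>k' i\<bar> \<le> int n" using k by (simp_all add: cells_def)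
    then have "\<bar>k i - k' i\<bar> < N" unfolding N_def by linarith
    then show "k i = k' i" using d zdvd_not_zless[of "\<bar>k i - k' i\<bar>" N] by (cases "k i = k' i") auto
  qed
  moreover have "\<rho> ` cells n \<subseteq> cells n" using rb by (auto simp: cells_def \<rho>_def)
  ultimately have bij: "bij_betw \<rho> (cells n) (cells n)"
    by (simp add: bij_betw_def endo_inj_surj)
  have "AE x in lebesgue. f (x + zvec 1 l + zvec 1 k) = f (x + zvec 1 (\<rho> k))" for k
  proof -
    have "zvec 1 l + zvec 1 k = zvec 1 (\<rho> k) + zvec (2 * n + 1) (\<lambda>i. q (k i + l i))"
    proof (subst vec_eq_iff, rule allI)
      fix i
      have "l i + k i = r (k i + l i) + N * q (k i + l i)" using rq[of "k i + l i"] by simp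
      then have "real_of_int (l i + k i) = real_of_int (r (k i + l i) + N * q (k i + l i))" by simp
      then show "(zvec 1 l + zvec 1 k) $ i = (zvec 1 (\<rho> k) + zvec (2 * n + 1) (\<lambda>i. q (k i + l i))) $ i"
        by (simp add: \<rho>_def N_def)
    qed
    then have eq: "x + zvec 1 l + zvec 1 k = x + zvec 1 (\<rho> k) + zvec (2 * n + 1) (\<lambda>i. q (k i + l i))" for x
      by (simp add: add.assoc)
    show ?thesis unfolding eq by (rule AE_translation[OF periodicD[OF p]])
  qed
  then have "AE x in lebesgue. \<forall>k\<in>cells n. f (x + zvec 1 l + zvec 1 k) = f (x + zvec 1 (\<rho> k))"
    by (intro AE_finite_allI) auto
  then show "AE x in lebesgue. (\<Sum>k\<in>cells n. f (x + zvec 1 l + zvec 1 k)) = (\<Sum>k\<in>cells n. f (x + zvec 1 k))"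
  proof eventually_elim
    case (elim x)
    then have "(\<Sum>k\<in>cells n. f (x + zvec 1 l + zvec 1 k)) = (\<Sum>k\<in>cells n. f (x + zvec 1 (\<rho> k)))"
      by (intro sum.cong) auto
    also have "\<dots> = (\<Sum>k\<in>cells n. f (x + zvec 1 k))"
      by (rule sum.reindex_bij_betw[OF bij])
    finally show ?case .
  qed
qed

text \<open>Folding commutes with weak gradients since it is a finite sum of translations.\<close>

lemma H1_per_sum_cells:
  assumes v: "v \<in> H1_per (2 * n + 1)"
  shows "(\<lambda>x. \<Sum>k\<in>cells n. v (x + zvec 1 k)) \<in> H1_per 1"
    and "AE x in lebesgue. weak_gradient (\<lambda>x. \<Sum>k\<in>cells n. v (x + zvec 1 k)) x =
      (\<Sum>k\<in>cells n. weak_gradient v (x + zvec 1 k))"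
proof -
  have "0 < 2 * n + 1" by simp
  note H = H1_perD[OF v this]
  have w: "has_weak_gradient (\<lambda>x. \<Sum>k\<in>cells n. v (x + zvec 1 k))
      (\<lambda>x. \<Sum>k\<in>cells n. weak_gradient v (x + zvec 1 k))"
    by (intro has_weak_gradient_sum has_weak_gradient_translation H) simp
  have l: "loc_L2 (\<lambda>x. \<Sum>k\<in>cells n. v (x + zvec 1 k))"
     "loc_L2 (\<lambda>x. \<Sum>k\<in>cells n. weak_gradient v (x + zvec 1 k))"
    by (intro loc_L2_sum loc_L2_translation H)+
  show "(\<lambda>x. \<Sum>k\<in>cells n. v (x + zvec 1 k)) \<in> H1_per 1"
    and "AE x in lebesgue. weak_gradient (\<lambda>x. \<Sum>k\<in>cells n. v (x + zvec 1 k)) x =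
      (\<Sum>k\<in>cells n. weak_gradient v (x + zvec 1 k))"
    using H1_perI[OF w periodic_sum_cells[OF H(2)] l] .
qed

section \<open>Gluing and periodic extension\<close>

lemma loc_L2_local:
  fixes f :: "real^'n::finite \<Rightarrow> 'b::euclidean_space"
  assumes loc: "\<And>N. \<exists>h. loc_L2 h \<and> (\<forall>x\<in>cube N. f x = h x)"
  shows "loc_L2 f"
proof -
  have "set_integrable lebesgue (cube N) f \<and> set_integrable lebesgue (cube N) (\<lambda>x. (norm (f x))\<^sup>2)" for N
  proof -
    obtain h where h: "loc_L2 h" "\<forall>x\<in>cube N. f x = h x" using loc by blast
    have "set_integrable lebesgue (cube N) h" "set_integrable lebesgue (cube N) (\<lambda>x. (norm (h x))\<^sup>2)"
      using loc_L2_locally_integrable[OF h(1)] loc_L2_square_integrable[OF h(1)] by (auto simp: locally_integrable_iff_cube)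
    then show ?thesis
      using h(2) set_integrable_cong[of lebesgue lebesgue "cube N" "cube N" f h]
        set_integrable_cong[of lebesgue lebesgue "cube N" "cube N" "\<lambda>x. (norm (f x))\<^sup>2" "\<lambda>x. (norm (h x))\<^sup>2"] by auto
  qed
  then show ?thesis
    using locally_integrable_measurable[of f] by (auto simp: loc_L2_def locally_integrable_iff_cube)
qed

text \<open>Evaluating at the representative in the half-open cell gives a total function that is
  periodic by construction. Its form as a sum of translates, suited to differentiation, is recovered
  for functions vanishing off the open cell.\<close>

definition periodic_extension :: "nat \<Rightarrow> (real^'n::finite \<Rightarrow> 'b) \<Rightarrow> real^'n \<Rightarrow> 'b" where
  "periodic_extension N f x = f (x - zvec N (cell_index N x))"

lemma periodic_periodic_extension:
  fixes f :: "real^'n::finite \<Rightarrow> 'b"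
  assumes "0 < N" shows "periodic N (periodic_extension N f)"
proof (rule periodicI)
  fix k :: "'n \<Rightarrow> int"
  have "x + zvec N k - zvec N (\<lambda>i. cell_index N x i + k i) = x - zvec N (cell_index N x)" for x
    by (simp add: vec_eq_iff algebra_simps)
  then show "AE x in lebesgue. periodic_extension N f (x + zvec N k) = periodic_extension N f x"
    by (simp only: periodic_extension_def cell_index_translation[OF assms]) simp
qed

text \<open>As f vanishes off the open cell, at most one translate is nonzero at each point. On
  \<open>cube R\<close> the cell indices are bounded by R, so one finite sum serves the whole
  cube.\<close>

lemma periodic_extension_eq_sum:
  fixes f :: "real^'n::finite \<Rightarrow> 'b::comm_monoid_add"
  assumes N: "0 < N" and f: "\<forall>x. (\<exists>i. real N / 2 \<le> \<bar>x $ i\<bar>) \<longrightarrow> f x = 0" and x: "x \<in> cube R"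
  shows "periodic_extension N f x = (\<Sum>k\<in>cells R. f (x + zvec N k))"
proof -
  let ?k = "\<lambda>i. - cell_index N x i"
  have "\<bar>cell_index N x i\<bar> \<le> int R" for i
  proof -
    have b: "\<bar>x $ i\<bar> \<le> real R / 2" using x by (simp add: mem_cube)
    have "\<bar>x $ i / real N\<bar> \<le> \<bar>x $ i\<bar> / 1"
      unfolding abs_divide by (rule divide_left_mono) (use N in auto)
    then have "\<bar>x $ i / real N\<bar> \<le> real R / 2" using b by linarith
    then show ?thesis unfolding cell_index_def by linarith
  qed
  then have k: "?k \<in> cells R" by (simp add: cells_def)
  have z: "f (x + zvec N k) = 0" if "k \<noteq> ?k" for k
  proof (rule ccontr)
    assume "f (x + zvec N k) \<noteq> 0"
    then have s: "\<bar>x $ i + real N * of_int (k i)\<bar> < real N / 2" for i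
    proof -
      have "\<not> real N / 2 \<le> \<bar>(x + zvec N k) $ i\<bar>" using f \<open>f (x + zvec N k) \<noteq> 0\<close> by blast
      then show ?thesis by (simp only: not_le vector_add_component zvec_nth)
    qed
    have "cell_index N x = (\<lambda>i. - k i)"
    proof (rule cell_index_unique[OF N])
      fix i
      show "- real N / 2 \<le> x $ i - real N * of_int (- k i)" "x $ i - real N * of_int (- k i) < real N / 2"
        using s[of i] unfolding of_int_minus by linarith+
    qed
    then show False using that by auto
  qed
  have "(\<Sum>k\<in>cells R. f (x + zvec N k)) = (\<Sum>k\<in>{?k}. f (x + zvec N k))"
    by (rule sum.mono_neutral_right) (use k z in auto)
  also have "\<dots> = periodic_extension N f x"
  proof -
    have "x + zvec N ?k = x - zvec N (cell_index N x)" by (simp add: vec_eq_iff)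
    then show ?thesis by (simp add: periodic_extension_def)
  qed
  finally show ?thesis by simp
qed

lemma periodic_extension_on_cube:
  fixes f :: "real^'n::finite \<Rightarrow> 'b::zero"
  assumes N: "0 < N" and f: "\<forall>x. (\<exists>i. real N / 2 \<le> \<bar>x $ i\<bar>) \<longrightarrow> f x = 0" and x: "x \<in> cube N"
  shows "periodic_extension N f x = f x"
proof (cases "\<exists>i. \<bar>x $ i\<bar> = real N / 2")
  case True
  then obtain i where i: "\<bar>x $ i\<bar> = real N / 2" ..
  \<comment> \<open>The representative of a face point may lie on the opposite face; f vanishes on
    both.\<close>
  let ?y = "x - zvec N (cell_index N x)"
  have c: "cell_index N x i = (if x $ i = real N / 2 then 1 else 0)"
  proof (cases "x $ i = real N / 2")
    case True
    then have "x $ i / real N = 1 / 2" using N by simp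
    then have "cell_index N x i = 1" unfolding cell_index_def by (simp only:) simp
    then show ?thesis using True by simp
  next
    case False
    then have "x $ i = - (real N / 2)" using i by linarith
    then have "x $ i / real N = - (1 / 2)" using N by simp
    then show ?thesis using False by (simp add: cell_index_def)
  qed
  have "\<bar>?y $ i\<bar> = real N / 2"
    unfolding vector_minus_component zvec_nth c using i by (auto split: if_splits)
  then have "f ?y = 0" using f by (metis order_refl)
  moreover have "f x = 0" using f i by (metis order_refl)
  ultimately show ?thesis by (simp add: periodic_extension_def)
next
  case False
  have "cell_index N x = (\<lambda>i. 0)"
  proof (rule cell_index_unique[OF N])
    fix i
    have "\<bar>x $ i\<bar> < real N / 2" using False x by (simp add: mem_cube less_le)
    then show "- real N / 2 \<le> x $ i - real N * of_int 0" "x $ i - real N * of_int 0 < real N / 2"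
      by linarith+
  qed
  then show ?thesis by (simp add: periodic_extension_def)
qed

text \<open>Admits compactly supported functions into the periodic weak formulation. Function and
  gradient vanish up to the faces, so the translated copies glue.\<close>

lemma compactly_supported_H1_per:
  fixes \<psi> :: "real^'n::finite \<Rightarrow> real"
  assumes N: "0 < N" and w: "has_weak_gradient \<psi> \<gamma>" and l: "loc_L2 \<psi>" "loc_L2 \<gamma>"
    and z: "\<forall>x. (\<exists>i. real N / 2 \<le> \<bar>x $ i\<bar>) \<longrightarrow> \<psi> x = 0" "\<forall>x. (\<exists>i. real N / 2 \<le> \<bar>x $ i\<bar>) \<longrightarrow> \<gamma> x = 0"
  shows "\<exists>v\<in>H1_per N. AE x in lebesgue. x \<in> cube N \<longrightarrow> weak_gradient v x = \<gamma> x"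
proof -
  let ?P = "periodic_extension N \<psi>" and ?G = "periodic_extension N \<gamma>"
  have "has_weak_gradient ?P ?G"
  proof (rule has_weak_gradient_local)
    fix R
    have "has_weak_gradient (\<lambda>x. \<Sum>k\<in>cells R. \<psi> (x + zvec N k)) (\<lambda>x. \<Sum>k\<in>cells R. \<gamma> (x + zvec N k))"
      by (intro has_weak_gradient_sum has_weak_gradient_translation w) simp
    then show "\<exists>v h. has_weak_gradient v h \<and> (\<forall>x\<in>cube R. ?P x = v x \<and> ?G x = h x)"
      using periodic_extension_eq_sum[where f=\<psi>, OF N z(1)] periodic_extension_eq_sum[where f=\<gamma>, OF N z(2)] by blast
  qed
  moreover have "loc_L2 ?P"
  proof (rule loc_L2_local)
    fix R
    have "loc_L2 (\<lambda>x. \<Sum>k\<in>cells R. \<psi> (x + zvec N k))"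
      by (intro loc_L2_sum loc_L2_translation l)
    then show "\<exists>h. loc_L2 h \<and> (\<forall>x\<in>cube R. ?P x = h x)"
      using periodic_extension_eq_sum[where f=\<psi>, OF N z(1)] by blast
  qed
  moreover have "loc_L2 ?G"
  proof (rule loc_L2_local)
    fix R
    have "loc_L2 (\<lambda>x. \<Sum>k\<in>cells R. \<gamma> (x + zvec N k))"
      by (intro loc_L2_sum loc_L2_translation l)
    then show "\<exists>h. loc_L2 h \<and> (\<forall>x\<in>cube R. ?G x = h x)"
      using periodic_extension_eq_sum[where f=\<gamma>, OF N z(2)] by blast
  qed
  ultimately have *: "?P \<in> H1_per N" "AE x in lebesgue. weak_gradient ?P x = ?G x"
    using H1_perI[OF _ periodic_periodic_extension[OF N, of \<psi>]] by blast+
  have "AE x in lebesgue. x \<in> cube N \<longrightarrow> weak_gradient ?P x = \<gamma> x"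
    using *(2) by eventually_elim (use periodic_extension_on_cube[where f=\<gamma>, OF N z(2)] in auto)
  with *(1) show ?thesis by blast
qed

subsection \<open>Energy estimates\<close>

definition L2_inner :: "nat \<Rightarrow> (real^'n::finite \<Rightarrow> 'b::euclidean_space) \<Rightarrow> (real^'n \<Rightarrow> 'b) \<Rightarrow> real" where
  "L2_inner N f g = (LINT x:cube N|lebesgue. f x \<bullet> g x)"

lemma loc_L2_inner_integrable:
  assumes "loc_L2 f" "loc_L2 g" shows "set_integrable lebesgue (cube N) (\<lambda>x. f x \<bullet> g x)"
  by (rule loc_L2_prod_bound[OF assms, where c=1])
     (simp_all add: Cauchy_Schwarz_ineq2 borel_measurable_inner[OF loc_L2_measurable[OF assms(1)] loc_L2_measurable[OF assms(2)]])

lemma L2_inner_commute: "L2_inner N f g = L2_inner N g f"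
  by (simp add: L2_inner_def inner_commute)

lemma L2_inner_add_left:
  "loc_L2 f \<Longrightarrow> loc_L2 f' \<Longrightarrow> loc_L2 g \<Longrightarrow> L2_inner N (\<lambda>x. f x + f' x) g = L2_inner N f g + L2_inner N f' g"
  unfolding L2_inner_def inner_add_left by (intro set_integral_add(2) loc_L2_inner_integrable)

lemma L2_inner_diff_left:
  "loc_L2 f \<Longrightarrow> loc_L2 f' \<Longrightarrow> loc_L2 g \<Longrightarrow> L2_inner N (\<lambda>x. f x - f' x) g = L2_inner N f g - L2_inner N f' g"
  unfolding L2_inner_def inner_diff_left by (intro set_integral_diff(2) loc_L2_inner_integrable)

lemma L2_inner_add_right:
  "loc_L2 f \<Longrightarrow> loc_L2 g \<Longrightarrow> loc_L2 g' \<Longrightarrow> L2_inner N f (\<lambda>x. g x + g' x) = L2_inner N f g + L2_inner N f g'"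
  unfolding L2_inner_commute[of N f] by (rule L2_inner_add_left)

lemma L2_inner_diff_right:
  "loc_L2 f \<Longrightarrow> loc_L2 g \<Longrightarrow> loc_L2 g' \<Longrightarrow> L2_inner N f (\<lambda>x. g x - g' x) = L2_inner N f g - L2_inner N f g'"
  unfolding L2_inner_commute[of N f] by (rule L2_inner_diff_left)

lemma L2_inner_cong_AE:
  assumes "loc_L2 f" "loc_L2 g" "loc_L2 f'" "loc_L2 g'"
    "AE x in lebesgue. x \<in> cube N \<longrightarrow> f x \<bullet> g x = f' x \<bullet> g' x"
  shows "L2_inner N f g = L2_inner N f' g'"
  unfolding L2_inner_def set_lebesgue_integral_def
proof (rule integral_cong_AE)
  show "(\<lambda>x. indicat_real (cube N) x *\<^sub>R (f x \<bullet> g x)) \<in> borel_measurable lebesgue"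
    using loc_L2_inner_integrable[OF assms(1,2), of N] unfolding set_integrable_def by (rule borel_measurable_integrable)
  show "(\<lambda>x. indicat_real (cube N) x *\<^sub>R (f' x \<bullet> g' x)) \<in> borel_measurable lebesgue"
    using loc_L2_inner_integrable[OF assms(3,4), of N] unfolding set_integrable_def by (rule borel_measurable_integrable)
  show "AE x in lebesgue. indicat_real (cube N) x *\<^sub>R (f x \<bullet> g x) = indicat_real (cube N) x *\<^sub>R (f' x \<bullet> g' x)"
    using assms(5) by eventually_elim (simp add: indicator_def)
qed

lemma L2_inner_self: "L2_inner N f f = (LINT x:cube N|lebesgue. (norm (f x))\<^sup>2)"
  by (simp add: L2_inner_def power2_norm_eq_inner)

lemma L2_inner_self_nonneg: "0 \<le> L2_inner N f f"
  unfolding L2_inner_def set_lebesgue_integral_def by (intro integral_nonneg_AE) auto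

lemma set_integral_mono_subset:
  fixes f :: "'a \<Rightarrow> real"
  assumes "set_integrable M B f" "A \<in> sets M" "A \<subseteq> B" "\<And>x. 0 \<le> f x"
  shows "(LINT x:A|M. f x) \<le> (LINT x:B|M. f x)"
  unfolding set_lebesgue_integral_def
proof (rule integral_mono)
  show "integrable M (\<lambda>x. indicator A x *\<^sub>R f x)" using set_integrable_subset[OF assms(1-3)] by (simp add: set_integrable_def)
  show "integrable M (\<lambda>x. indicator B x *\<^sub>R f x)" using assms(1) by (simp add: set_integrable_def)
  show "indicator A x *\<^sub>R f x \<le> indicator B x *\<^sub>R f x" for x
    using assms(3,4) by (auto simp: indicator_def)
qed

lemma L2_inner_self_mono:
  assumes "loc_L2 f" "M \<le> N" shows "L2_inner M f f \<le> L2_inner N f f"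
  unfolding L2_inner_self
  by (rule set_integral_mono_subset[OF loc_L2_square_integrable[OF assms(1)] cube_lebesgue cube_mono[OF assms(2)]]) simp

lemma quadratic_form_discriminant:
  fixes X Y Z :: real
  assumes q: "\<And>a b. 0 \<le> a\<^sup>2 * X - 2 * a * b * Z + b\<^sup>2 * Y"
  shows "Z\<^sup>2 \<le> X * Y"
proof (rule ccontr)
  assume "\<not> Z\<^sup>2 \<le> X * Y"
  then have neg: "X * Y - Z\<^sup>2 < 0" by simp
  \<comment> \<open>The choices (a, b) = (Y, Z) and (Z, X) produce Y and X times the negative
    quantity, which avoids dividing by X or Y, possibly 0.\<close>
  have "0 \<le> Y * (X * Y - Z\<^sup>2)" using q[of Y Z] by (simp add: power2_eq_square algebra_simps)
  then have "Y \<le> 0" using neg by (simp add: zero_le_mult_iff)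
  moreover have "0 \<le> X * (X * Y - Z\<^sup>2)" using q[of Z X] by (simp add: power2_eq_square algebra_simps)
  then have "X \<le> 0" using neg by (simp add: zero_le_mult_iff)
  moreover have "0 \<le> X" "0 \<le> Y" using q[of 1 0] q[of 0 1] by simp_all
  ultimately have "X = 0" "Y = 0" by simp_all
  then have "Z = 0" using q[of 1 1] q[of 1 "-1"] by simp
  then show False using neg \<open>X = 0\<close> by simp
qed

lemma set_integral_Cauchy_Schwarz:
  fixes f g :: "'a \<Rightarrow> real"
  assumes i: "set_integrable M S (\<lambda>x. (f x)\<^sup>2)" "set_integrable M S (\<lambda>x. (g x)\<^sup>2)" "set_integrable M S (\<lambda>x. f x * g x)"
  shows "(LINT x:S|M. f x * g x)\<^sup>2 \<le> (LINT x:S|M. (f x)\<^sup>2) * (LINT x:S|M. (g x)\<^sup>2)"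
proof (rule quadratic_form_discriminant)
  fix a b :: real
  have "0 \<le> (LINT x:S|M. (a * f x - b * g x)\<^sup>2)"
    unfolding set_lebesgue_integral_def by (intro integral_nonneg_AE) auto
  also have "(\<lambda>x. (a * f x - b * g x)\<^sup>2) = (\<lambda>x. (a\<^sup>2 * (f x)\<^sup>2 - (2 * a * b) * (f x * g x)) + b\<^sup>2 * (g x)\<^sup>2)"
    by (simp add: fun_eq_iff power2_eq_square algebra_simps)
  also have "(LINT x:S|M. (a\<^sup>2 * (f x)\<^sup>2 - (2 * a * b) * (f x * g x)) + b\<^sup>2 * (g x)\<^sup>2) =
      (LINT x:S|M. a\<^sup>2 * (f x)\<^sup>2 - (2 * a * b) * (f x * g x)) + (LINT x:S|M. b\<^sup>2 * (g x)\<^sup>2)"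
    by (intro set_integral_add(2) set_integral_diff(1) set_integrable_mult_right i)
  also have "(LINT x:S|M. a\<^sup>2 * (f x)\<^sup>2 - (2 * a * b) * (f x * g x)) =
      (LINT x:S|M. a\<^sup>2 * (f x)\<^sup>2) - (LINT x:S|M. (2 * a * b) * (f x * g x))"
    by (intro set_integral_diff(2) set_integrable_mult_right i)
  finally show "0 \<le> a\<^sup>2 * (LINT x:S|M. (f x)\<^sup>2) - 2 * a * b * (LINT x:S|M. f x * g x) + b\<^sup>2 * (LINT x:S|M. (g x)\<^sup>2)"
    by simp
qed

lemma loc_L2_norm: "loc_L2 f \<Longrightarrow> loc_L2 (\<lambda>x. norm (f x))"
  by (rule loc_L2_bound[where f=f and c=1])
     (simp_all add: measurable_compose[OF loc_L2_measurable borel_measurable_norm])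

text \<open>Stated for measurable subsets of a cube because it is applied on the shell between two
  cubes; the squared form avoids roots.\<close>

lemma loc_L2_Cauchy_Schwarz:
  fixes f :: "real^'n::finite \<Rightarrow> 'a::euclidean_space" and g :: "real^'n \<Rightarrow> 'b::euclidean_space"
  assumes f: "loc_L2 f" and g: "loc_L2 g" and S: "S \<in> sets lebesgue" "S \<subseteq> cube N" and K: "0 \<le> K"
    and h: "h \<in> borel_measurable lebesgue" "AE x in lebesgue. x \<in> S \<longrightarrow> \<bar>h x\<bar> \<le> K * (norm (f x) * norm (g x))"
  shows "(LINT x:S|lebesgue. h x)\<^sup>2 \<le> K\<^sup>2 * ((LINT x:S|lebesgue. (norm (f x))\<^sup>2) * (LINT x:S|lebesgue. (norm (g x))\<^sup>2))"
proof -
  note nf = loc_L2_norm[OF f] and ng = loc_L2_norm[OF g]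
  have i: "set_integrable lebesgue S (\<lambda>x. (norm (f x))\<^sup>2)" "set_integrable lebesgue S (\<lambda>x. (norm (g x))\<^sup>2)"
    "set_integrable lebesgue S (\<lambda>x. norm (f x) * norm (g x))"
    using set_integrable_subset[OF loc_L2_square_integrable[OF f] S]
      set_integrable_subset[OF loc_L2_square_integrable[OF g] S]
      set_integrable_subset[OF loc_L2_inner_integrable[OF nf ng] S] by (simp_all add: inner_real_def)
  have "\<bar>LINT x:S|lebesgue. h x\<bar> \<le> (LINT x:S|lebesgue. K * (norm (f x) * norm (g x)))"
    unfolding set_lebesgue_integral_def
  proof -
    have iK: "integrable lebesgue (\<lambda>x. indicat_real S x *\<^sub>R (K * (norm (f x) * norm (g x))))"
      using set_integrable_mult_right[OF i(3), of K] by (simp add: set_integrable_def)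
    have ae: "AE x in lebesgue. norm (indicat_real S x *\<^sub>R h x) \<le> indicat_real S x *\<^sub>R (K * (norm (f x) * norm (g x)))"
      using h(2) by eventually_elim (simp add: indicator_def)
    have ih: "integrable lebesgue (\<lambda>x. indicat_real S x *\<^sub>R h x)"
    proof (rule Bochner_Integration.integrable_bound[OF iK])
      show "(\<lambda>x. indicat_real S x *\<^sub>R h x) \<in> borel_measurable lebesgue"
        by (intro borel_measurable_scaleR borel_measurable_indicator S(1) h(1))
      show "AE x in lebesgue. norm (indicat_real S x *\<^sub>R h x) \<le> norm (indicat_real S x *\<^sub>R (K * (norm (f x) * norm (g x))))"
        using ae by eventually_elim simp
    qed
    have "norm (LINT x|lebesgue. indicat_real S x *\<^sub>R h x) \<le> (LINT x|lebesgue. norm (indicat_real S x *\<^sub>R h x))"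
      by (rule integral_norm_bound)
    also have "\<dots> \<le> (LINT x|lebesgue. indicat_real S x *\<^sub>R (K * (norm (f x) * norm (g x))))"
      by (rule integral_mono_AE[OF integrable_norm[OF ih] iK ae])
    finally show "\<bar>LINT x|lebesgue. indicat_real S x *\<^sub>R h x\<bar> \<le> (LINT x|lebesgue. indicat_real S x *\<^sub>R (K * (norm (f x) * norm (g x))))"
      by simp
  qed
  then have "\<bar>LINT x:S|lebesgue. h x\<bar> \<le> K * (LINT x:S|lebesgue. norm (f x) * norm (g x))" by simp
  then have "(LINT x:S|lebesgue. h x)\<^sup>2 \<le> (K * (LINT x:S|lebesgue. norm (f x) * norm (g x)))\<^sup>2"
    by (metis abs_ge_zero power2_abs power_mono)
  also have "\<dots> \<le> K\<^sup>2 * ((LINT x:S|lebesgue. (norm (f x))\<^sup>2) * (LINT x:S|lebesgue. (norm (g x))\<^sup>2))"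
    unfolding power_mult_distrib by (intro mult_left_mono set_integral_Cauchy_Schwarz i) simp
  finally show ?thesis .
qed

section \<open>Matrix fields and bounds holding almost everywhere\<close>

lemma measurable_matrix_vector_mult:
  fixes A :: "'a \<Rightarrow> real^'n::finite^'m::finite"
  assumes A: "A \<in> borel_measurable M" and g: "g \<in> borel_measurable M"
  shows "(\<lambda>x. A x *v g x) \<in> borel_measurable M"
proof (rule measurable_vecI)
  fix i
  have "(\<lambda>x. A x $ i) \<in> borel_measurable M"
    by (rule measurable_compose[OF A borel_measurable_continuous_onI]) (intro continuous_intros)
  from measurable_nth[OF this] have "(\<lambda>x. A x $ i $ j) \<in> borel_measurable M" for j .
  then show "(\<lambda>x. (A x *v g x) $ i) \<in> borel_measurable M"
    unfolding matrix_vector_mult_def using measurable_nth[OF g] by simp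
qed

lemma loc_L2_matrix_vector_mult:
  fixes A :: "real^'n::finite \<Rightarrow> real^'m::finite^'k::finite"
  assumes "A \<in> borel_measurable lebesgue" "AE x in lebesgue. \<forall>\<xi>. norm (A x *v \<xi>) \<le> K * norm \<xi>" "loc_L2 g"
  shows "loc_L2 (\<lambda>x. A x *v g x)"
  by (rule loc_L2_bound[OF assms(3) measurable_matrix_vector_mult[OF assms(1) loc_L2_measurable[OF assms(3)]], of K])
     (use assms(2) in \<open>eventually_elim, blast\<close>)

text \<open>The ellipticity bounds come with a null set depending on \<xi>. A countable dense set of
  \<xi> merges these null sets and closedness extends the condition to all \<xi>, so that \<xi> may
  become a field value g(x).\<close>

lemma AE_closed_condition:
  fixes P :: "'a \<Rightarrow> real^'n::finite \<Rightarrow> bool"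
  assumes P: "\<And>\<xi>. AE x in M. P x \<xi>" and cl: "\<And>x. closed {\<xi>. P x \<xi>}"
  shows "AE x in M. \<forall>\<xi>. P x \<xi>"
proof -
  obtain D :: "(real^'n) set" where D: "countable D" "\<And>X. open X \<Longrightarrow> X \<noteq> {} \<Longrightarrow> \<exists>d\<in>D. d \<in> X"
    using countable_dense_setE by blast
  have "AE x in M. \<forall>\<xi>\<in>D. P x \<xi>" using D(1) P by (simp add: AE_ball_countable)
  then show ?thesis
  proof eventually_elim
    case (elim x)
    show ?case
    proof (rule ccontr)
      assume "\<not> (\<forall>\<xi>. P x \<xi>)"
      then have "- {\<xi>. P x \<xi>} \<noteq> {}" by auto
      then obtain d where "d \<in> D" "d \<in> - {\<xi>. P x \<xi>}" using D(2) cl by (metis open_Compl)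
      with elim show False by simp
    qed
  qed
qed

lemma continuous_on_matrix_vector_mult: "continuous_on UNIV (\<lambda>\<xi>. (B::real^'n::finite^'m::finite) *v \<xi>)"
  by (rule linear_continuous_on[OF matrix_vector_mul_bounded_linear])

lemma AE_coercive_all:
  fixes A :: "'a \<Rightarrow> real^'n::finite^'n"
  assumes "\<And>\<xi>. AE x in M. \<alpha> * (norm \<xi>)\<^sup>2 \<le> (A x *v \<xi>) \<bullet> \<xi>"
  shows "AE x in M. \<forall>\<xi>. \<alpha> * (norm \<xi>)\<^sup>2 \<le> (A x *v \<xi>) \<bullet> \<xi>"
  by (rule AE_closed_condition[OF assms])
     (intro closed_Collect_le continuous_on_mult continuous_on_inner continuous_on_matrix_vector_mult
        continuous_on_const continuous_on_id continuous_on_power continuous_on_norm)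

lemma AE_bounded_all:
  fixes A :: "'a \<Rightarrow> real^'n::finite^'n"
  assumes "\<And>\<xi>. AE x in M. norm (A x *v \<xi>) \<le> \<beta> * norm \<xi>"
  shows "AE x in M. \<forall>\<xi>. norm (A x *v \<xi>) \<le> \<beta> * norm \<xi>"
  by (rule AE_closed_condition[OF assms])
     (intro closed_Collect_le continuous_on_mult continuous_on_matrix_vector_mult
        continuous_on_const continuous_on_id continuous_on_norm)

text \<open>Each step bounds the square of \<open>E 0\<close> by a multiple of one increment of E,
  and the increments add up to at most B. The last step, k = K - 1, looks two levels up, which is
  why B bounds E at \<open>Suc K\<close>.\<close>

lemma iteration_bound:
  fixes E :: "nat \<Rightarrow> real"
  assumes "\<And>k. 0 \<le> E k" "\<And>k. E k \<le> E (Suc k)" "E (Suc K) \<le> B" "0 \<le> c"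
    and step: "\<And>k. k < K \<Longrightarrow> (E k)\<^sup>2 \<le> c * (E (Suc k) - E k) * E (Suc (Suc k))"
  shows "real K * (E 0)\<^sup>2 \<le> c * B\<^sup>2"
proof -
  have mono: "E i \<le> E j" if "i \<le> j" for i j using lift_Suc_mono_le[of E i j] assms(2) that by blast
  have "real K * (E 0)\<^sup>2 = (\<Sum>k<K. (E 0)\<^sup>2)" by simp
  also have "\<dots> \<le> (\<Sum>k<K. c * B * (E (Suc k) - E k))"
  proof (rule sum_mono)
    fix k assume k: "k \<in> {..<K}"
    have "(E 0)\<^sup>2 \<le> (E k)\<^sup>2" using mono[of 0 k] assms(1) by (intro power_mono) auto
    also have "\<dots> \<le> c * (E (Suc k) - E k) * E (Suc (Suc k))" using step k by simp
    also have "\<dots> \<le> c * (E (Suc k) - E k) * B"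
    proof (rule mult_left_mono)
      show "E (Suc (Suc k)) \<le> B" using mono[of "Suc (Suc k)" "Suc K"] k assms(3) by simp
      show "0 \<le> c * (E (Suc k) - E k)" using assms(2)[of k] assms(4) by simp
    qed
    finally show "(E 0)\<^sup>2 \<le> c * B * (E (Suc k) - E k)" by (simp add: mult_ac)
  qed
  also have "\<dots> = c * B * (E K - E 0)"
    by (simp add: sum_distrib_left[symmetric] sum_lessThan_telescope)
  also have "\<dots> \<le> c * B * B"
  proof (rule mult_left_mono)
    have "E K \<le> B" using assms(2)[of K] assms(3) by linarith
    then show "E K - E 0 \<le> B" using assms(1)[of 0] by linarith
    have "0 \<le> B" using assms(1)[of "Suc K"] assms(3) by linarith
    then show "0 \<le> c * B" using assms(4) by simp
  qed
  finally show ?thesis by (simp add: power2_eq_square mult_ac)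
qed

text \<open>Parallelogram identity with the energy of f + g dropped.\<close>

lemma L2_inner_self_diff_le:
  assumes "loc_L2 f" "loc_L2 g"
  shows "L2_inner N (\<lambda>x. f x - g x) (\<lambda>x. f x - g x) \<le> 2 * L2_inner N f f + 2 * L2_inner N g g"
proof -
  have "0 \<le> L2_inner N (\<lambda>x. f x + g x) (\<lambda>x. f x + g x)" by (rule L2_inner_self_nonneg)
  then show ?thesis
    using assms by (simp add: L2_inner_add_left L2_inner_add_right L2_inner_diff_left L2_inner_diff_right
        loc_L2_add loc_L2_diff L2_inner_commute[of N g f])
qed

text \<open>Every cell is translated to the unit cube; periodicity leaves F unchanged, so the sum
  falls on h alone. Folding is thus adjoint to the inclusion of 1-periodic fields.\<close>

lemma L2_inner_tiling:
  fixes F h :: "real^'n::finite \<Rightarrow> 'b::euclidean_space"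
  assumes p: "periodic 1 F" and F: "loc_L2 F" and h: "loc_L2 h"
  shows "L2_inner (2 * n + 1) F h = L2_inner 1 F (\<lambda>x. \<Sum>k\<in>cells n. h (x + zvec 1 k))"
proof -
  have i: "set_integrable lebesgue (cube 1) (\<lambda>x. F (x + a) \<bullet> h (x + a))" for a
    by (intro loc_L2_inner_integrable loc_L2_translation F h)
  have "L2_inner (2 * n + 1) F h = (\<Sum>k\<in>cells n. LINT x:cube 1|lebesgue. F (x + zvec 1 k) \<bullet> h (x + zvec 1 k))"
    using tiling(2)[of 1 n "\<lambda>x. F x \<bullet> h x", OF _ i] by (simp add: L2_inner_def)
  also have "\<dots> = (\<Sum>k\<in>cells n. LINT x:cube 1|lebesgue. F x \<bullet> h (x + zvec 1 k))"
  proof (rule sum.cong[OF refl])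
    fix k :: "'n \<Rightarrow> int"
    have "AE x in lebesgue. x \<in> cube 1 \<longrightarrow> F (x + zvec 1 k) \<bullet> h (x + zvec 1 k) = F x \<bullet> h (x + zvec 1 k)"
      using periodicD[OF p, of k] by eventually_elim simp
    from L2_inner_cong_AE[OF loc_L2_translation[OF F] loc_L2_translation[OF h] F loc_L2_translation[OF h] this]
    show "(LINT x:cube 1|lebesgue. F (x + zvec 1 k) \<bullet> h (x + zvec 1 k)) = (LINT x:cube 1|lebesgue. F x \<bullet> h (x + zvec 1 k))"
      by (simp only: L2_inner_def)
  qed
  also have "\<dots> = (LINT x:cube 1|lebesgue. \<Sum>k\<in>cells n. F x \<bullet> h (x + zvec 1 k))"
    unfolding set_lebesgue_integral_def scaleR_sum_right
    by (rule Bochner_Integration.integral_sum[symmetric])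
       (use loc_L2_inner_integrable[OF F loc_L2_translation[OF h]] in \<open>simp add: set_integrable_def\<close>)
  finally show ?thesis by (simp add: L2_inner_def inner_sum_right)
qed

lemma L2_inner_support:
  fixes g :: "real^'n::finite \<Rightarrow> 'b::euclidean_space"
  assumes "\<forall>x. (\<exists>i. real r / 2 \<le> \<bar>x $ i\<bar>) \<longrightarrow> g x = 0" "r \<le> N"
  shows "L2_inner N f g = L2_inner r f g"
proof -
  have "indicat_real (cube N) x *\<^sub>R (f x \<bullet> g x) = indicat_real (cube r) x *\<^sub>R (f x \<bullet> g x)" for x
  proof (cases "x \<in> cube r")
    case True
    then show ?thesis using cube_mono[OF assms(2)] by (auto simp: indicator_def)
  next
    case False
    then obtain i where "\<not> \<bar>x $ i\<bar> \<le> real r / 2" unfolding mem_cube by blast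
    then have "real r / 2 \<le> \<bar>x $ i\<bar>" by linarith
    then have "g x = 0" using assms(1) by blast
    then show ?thesis by simp
  qed
  then show ?thesis unfolding L2_inner_def set_lebesgue_integral_def by (simp only:)
qed

lemma L2_inner_matrix_bound:
  fixes B :: "real^'n::finite \<Rightarrow> real^'n^'n"
  assumes B: "B \<in> borel_measurable lebesgue" "AE x in lebesgue. \<forall>\<xi>. norm (B x *v \<xi>) \<le> K * norm \<xi>"
    and K: "0 \<le> K" and f: "loc_L2 f" and \<theta>: "loc_L2 \<theta>"
  shows "(L2_inner N (\<lambda>x. B x *v f x) \<theta>)\<^sup>2 \<le> K\<^sup>2 * (L2_inner N f f * L2_inner N \<theta> \<theta>)"
  unfolding L2_inner_self unfolding L2_inner_def
proof (rule loc_L2_Cauchy_Schwarz[OF f \<theta> cube_lebesgue order_refl K])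
  show "(\<lambda>x. (B x *v f x) \<bullet> \<theta> x) \<in> borel_measurable lebesgue"
    by (intro borel_measurable_inner loc_L2_measurable[OF loc_L2_matrix_vector_mult[OF B f]] loc_L2_measurable[OF \<theta>])
  show "AE x in lebesgue. x \<in> cube N \<longrightarrow> \<bar>(B x *v f x) \<bullet> \<theta> x\<bar> \<le> K * (norm (f x) * norm (\<theta> x))"
    using B(2)
  proof eventually_elim
    case (elim x)
    have "\<bar>(B x *v f x) \<bullet> \<theta> x\<bar> \<le> norm (B x *v f x) * norm (\<theta> x)" by (rule Cauchy_Schwarz_ineq2)
    also have "\<dots> \<le> (K * norm (f x)) * norm (\<theta> x)" using elim by (intro mult_right_mono) auto
    finally show ?case by (simp add: mult.assoc)
  qed
qed

text \<open>A local equation that forgets the period, so that correctors of different supercells can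
  be subtracted. A weak gradient is determined only almost everywhere, hence \<open>\<gamma>\<close>
  is listed separately and required to vanish pointwise, as periodic extension demands.\<close>

definition divergence_free_in :: "nat \<Rightarrow> (real^'n::finite \<Rightarrow> real^'n) \<Rightarrow> bool" where
  "divergence_free_in r F \<longleftrightarrow> (\<forall>\<psi> \<gamma>. has_weak_gradient \<psi> \<gamma> \<longrightarrow> loc_L2 \<psi> \<longrightarrow> loc_L2 \<gamma> \<longrightarrow>
     (\<forall>x. (\<exists>i. real r / 2 \<le> \<bar>x $ i\<bar>) \<longrightarrow> \<psi> x = 0 \<and> \<gamma> x = 0) \<longrightarrow> L2_inner r F \<gamma> = 0)"

lemma divergence_free_inD:
  "divergence_free_in r F \<Longrightarrow> has_weak_gradient \<psi> \<gamma> \<Longrightarrow> loc_L2 \<psi> \<Longrightarrow> loc_L2 \<gamma> \<Longrightarrow>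
    \<forall>x. (\<exists>i. real r / 2 \<le> \<bar>x $ i\<bar>) \<longrightarrow> \<psi> x = 0 \<and> \<gamma> x = 0 \<Longrightarrow> L2_inner r F \<gamma> = 0"
  unfolding divergence_free_in_def by blast

lemma divergence_free_in_diff:
  assumes "divergence_free_in r F" "divergence_free_in r G" "loc_L2 F" "loc_L2 G"
  shows "divergence_free_in r (\<lambda>x. F x - G x)"
  unfolding divergence_free_in_def
  using assms divergence_free_inD[OF assms(1)] divergence_free_inD[OF assms(2)]
  by (simp add: L2_inner_diff_left)

section \<open>Energy estimates for a medium with one defect\<close>

locale periodic_medium =
  fixes A C :: "real^'n::finite \<Rightarrow> real^'n^'n" and \<alpha> \<beta> :: real
  assumes A_measurable: "A \<in> borel_measurable lebesgue" and C_measurable: "C \<in> borel_measurable lebesgue"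
    and A_periodic: "periodic 1 A" and \<alpha>_pos: "0 < \<alpha>" and \<beta>_pos: "0 < \<beta>"
    and A_coercive: "AE x in lebesgue. \<forall>\<xi>. \<alpha> * (norm \<xi>)\<^sup>2 \<le> (A x *v \<xi>) \<bullet> \<xi>"
    and AC_coercive: "AE x in lebesgue. \<forall>\<xi>. \<alpha> * (norm \<xi>)\<^sup>2 \<le> ((A x + C x) *v \<xi>) \<bullet> \<xi>"
    and A_bounded: "AE x in lebesgue. \<forall>\<xi>. norm (A x *v \<xi>) \<le> \<beta> * norm \<xi>"
    and AC_bounded: "AE x in lebesgue. \<forall>\<xi>. norm ((A x + C x) *v \<xi>) \<le> \<beta> * norm \<xi>"
begin

abbreviation A1 :: "real^'n \<Rightarrow> real^'n^'n" where "A1 \<equiv> one_defect A C"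

lemma C_bounded: "AE x in lebesgue. \<forall>\<xi>. norm (C x *v \<xi>) \<le> 2 * \<beta> * norm \<xi>"
  using A_bounded AC_bounded
proof eventually_elim
  case (elim x)
  show ?case
  proof
    fix \<xi>
    have "C x *v \<xi> = (A x + C x) *v \<xi> - A x *v \<xi>" by (simp add: matrix_vector_mult_add_rdistrib)
    then have "norm (C x *v \<xi>) \<le> norm ((A x + C x) *v \<xi>) + norm (A x *v \<xi>)"
      using norm_triangle_ineq4 by metis
    also have "\<dots> \<le> \<beta> * norm \<xi> + \<beta> * norm \<xi>" using elim by (intro add_mono) blast+
    finally show "norm (C x *v \<xi>) \<le> 2 * \<beta> * norm \<xi>" by simp
  qed
qed

lemma A1_cases: "A1 x = (if x \<in> cube 1 then A x + C x else A x)"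
  by (simp add: one_defect_def)

lemma A1_measurable: "A1 \<in> borel_measurable lebesgue"
  unfolding one_defect_def
  by (intro borel_measurable_add borel_measurable_scaleR borel_measurable_indicator cube_lebesgue A_measurable C_measurable)

lemma A1_coercive: "AE x in lebesgue. \<forall>\<xi>. \<alpha> * (norm \<xi>)\<^sup>2 \<le> (A1 x *v \<xi>) \<bullet> \<xi>"
  using A_coercive AC_coercive by eventually_elim (simp add: A1_cases)

lemma A1_bounded: "AE x in lebesgue. \<forall>\<xi>. norm (A1 x *v \<xi>) \<le> \<beta> * norm \<xi>"
  using A_bounded AC_bounded by eventually_elim (simp add: A1_cases)

lemmas loc_L2_A = loc_L2_matrix_vector_mult[OF A_measurable A_bounded]
lemmas loc_L2_C = loc_L2_matrix_vector_mult[OF C_measurable C_bounded]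
lemmas loc_L2_A1 = loc_L2_matrix_vector_mult[OF A1_measurable A1_bounded]

lemma L2_inner_one_defect:
  assumes g: "loc_L2 g" and h: "loc_L2 h" and N: "1 \<le> N"
  shows "L2_inner N (\<lambda>x. A1 x *v g x) h = L2_inner N (\<lambda>x. A x *v g x) h + L2_inner 1 (\<lambda>x. C x *v g x) h"
proof -
  have iA: "integrable lebesgue (\<lambda>x. indicat_real (cube N) x *\<^sub>R ((A x *v g x) \<bullet> h x))"
    and iC: "integrable lebesgue (\<lambda>x. indicat_real (cube 1) x *\<^sub>R ((C x *v g x) \<bullet> h x))"
    using loc_L2_inner_integrable[OF loc_L2_A[OF g] h] loc_L2_inner_integrable[OF loc_L2_C[OF g] h]
    by (simp_all add: set_integrable_def)
  have "indicat_real (cube N) x *\<^sub>R ((A1 x *v g x) \<bullet> h x) =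
     indicat_real (cube N) x *\<^sub>R ((A x *v g x) \<bullet> h x) + indicat_real (cube 1) x *\<^sub>R ((C x *v g x) \<bullet> h x)" for x
    using cube_mono[OF N, where 'n='n]
    by (auto simp: A1_cases indicator_def matrix_vector_mult_add_rdistrib inner_add_left)
  then show ?thesis
    using Bochner_Integration.integral_add[OF iA iC] by (simp add: L2_inner_def set_lebesgue_integral_def)
qed

lemma energy_lower_bound:
  fixes B :: "real^'n \<Rightarrow> real^'n^'n"
  assumes B: "B \<in> borel_measurable lebesgue" "AE x in lebesgue. \<forall>\<xi>. norm (B x *v \<xi>) \<le> \<beta> * norm \<xi>"
    "AE x in lebesgue. \<forall>\<xi>. \<alpha> * (norm \<xi>)\<^sup>2 \<le> (B x *v \<xi>) \<bullet> \<xi>"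
    and g: "loc_L2 g"
  shows "\<alpha> * L2_inner N g g \<le> L2_inner N (\<lambda>x. B x *v g x) g"
proof -
  have i: "set_integrable lebesgue (cube N) (\<lambda>x. \<alpha> * (g x \<bullet> g x))"
    by (intro set_integrable_mult_right loc_L2_inner_integrable g)
  have i': "set_integrable lebesgue (cube N) (\<lambda>x. (B x *v g x) \<bullet> g x)"
    by (intro loc_L2_inner_integrable g loc_L2_matrix_vector_mult[OF B(1,2)])
  have "(LINT x:cube N|lebesgue. \<alpha> * (g x \<bullet> g x)) \<le> (LINT x:cube N|lebesgue. (B x *v g x) \<bullet> g x)"
    unfolding set_lebesgue_integral_def
  proof (rule integral_mono_AE[OF i[unfolded set_integrable_def] i'[unfolded set_integrable_def]])
    show "AE x in lebesgue. indicat_real (cube N) x *\<^sub>R (\<alpha> * (g x \<bullet> g x)) \<le> indicat_real (cube N) x *\<^sub>R ((B x *v g x) \<bullet> g x)"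
      using B(3) by eventually_elim (simp add: indicator_def power2_norm_eq_inner)
  qed
  then show ?thesis by (simp add: L2_inner_def)
qed

lemmas C_inner_bound = L2_inner_matrix_bound[OF C_measurable C_bounded]

text \<open>The energy T satisfies \<alpha> T \<le> 2\<beta> (F T)^(1/2), where F is the energy of f
  on the unit cube and 2\<beta> the bound on \<open>C\<close>; a factor T cancels unless T = 0.
  Applied with \<open>A1\<close> on a supercell and with \<open>A\<close> on the unit cube.\<close>

lemma energy_upper_bound:
  fixes B :: "real^'n \<Rightarrow> real^'n^'n"
  assumes B: "B \<in> borel_measurable lebesgue" "AE x in lebesgue. \<forall>\<xi>. norm (B x *v \<xi>) \<le> \<beta> * norm \<xi>"
    "AE x in lebesgue. \<forall>\<xi>. \<alpha> * (norm \<xi>)\<^sup>2 \<le> (B x *v \<xi>) \<bullet> \<xi>"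
    and \<theta>: "loc_L2 \<theta>" and f: "loc_L2 f" and N: "1 \<le> N"
    and eq: "L2_inner N (\<lambda>x. B x *v \<theta> x) \<theta> = - L2_inner 1 (\<lambda>x. C x *v f x) \<theta>"
  shows "L2_inner N \<theta> \<theta> \<le> (2 * \<beta> / \<alpha>)\<^sup>2 * L2_inner 1 f f"
proof -
  let ?T = "L2_inner N \<theta> \<theta>"
  have T0: "0 \<le> ?T" by (rule L2_inner_self_nonneg)
  have "(\<alpha> * ?T)\<^sup>2 \<le> (L2_inner N (\<lambda>x. B x *v \<theta> x) \<theta>)\<^sup>2"
    using energy_lower_bound[OF B \<theta>, of N] \<alpha>_pos T0 by (intro power_mono) auto
  also have "\<dots> \<le> (2 * \<beta>)\<^sup>2 * (L2_inner 1 f f * L2_inner 1 \<theta> \<theta>)"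
    unfolding eq using C_inner_bound[OF _ f \<theta>, of 1] \<beta>_pos by simp
  also have "\<dots> \<le> (2 * \<beta>)\<^sup>2 * (L2_inner 1 f f * ?T)"
    by (intro mult_left_mono L2_inner_self_mono \<theta> N L2_inner_self_nonneg) simp
  finally have *: "(\<alpha> * ?T)\<^sup>2 \<le> (2 * \<beta>)\<^sup>2 * (L2_inner 1 f f * ?T)" .
  show ?thesis
  proof (cases "?T = 0")
    case True then show ?thesis using L2_inner_self_nonneg[of 1 f] by simp
  next
    case False
    then have "0 < ?T" using T0 by simp
    have "?T * (\<alpha>\<^sup>2 * ?T) \<le> ?T * ((2 * \<beta>)\<^sup>2 * L2_inner 1 f f)"
      using * by (simp add: power_mult_distrib power2_eq_square[of ?T] mult_ac)
    then have "\<alpha>\<^sup>2 * ?T \<le> (2 * \<beta>)\<^sup>2 * L2_inner 1 f f" using \<open>0 < ?T\<close> by (rule mult_left_le_imp_le)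
    then show ?thesis using \<alpha>_pos by (simp add: power_divide field_simps)
  qed
qed

text \<open>A hole-filling estimate: the cutoff has its gradient on the shell between
  \<open>cube R\<close> and \<open>cube (3 * R)\<close>, so one factor is the energy of the shell.
  The other is the oscillation of u on side 3R, for which the Poincare inequality reaches out to
  side 9R; its factor R^2 cancels the square of D/R.\<close>

lemma caccioppoli:
  obtains K where "0 \<le> K" "\<And>u g R. 0 < R \<Longrightarrow> has_weak_gradient u g \<Longrightarrow> loc_L2 u \<Longrightarrow> loc_L2 g \<Longrightarrow>
    divergence_free_in (3 * R) (\<lambda>x. A1 x *v g x) \<Longrightarrow>
    (L2_inner R g g)\<^sup>2 \<le> K * (L2_inner (3 * R) g g - L2_inner R g g) * L2_inner (9 * R) g g"
proof -
  obtain D where D: "0 \<le> D" "\<And>R. 0 < R \<Longrightarrow> \<exists>\<eta>::real^'n \<Rightarrow> real.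
    test_function \<eta> \<and> (\<forall>x. 0 \<le> \<eta> x \<and> \<eta> x \<le> 1) \<and> (\<forall>x\<in>cube R. \<eta> x = 1 \<and> grad \<eta> x = 0) \<and>
    (\<forall>x. (\<exists>i. 3 * real R / 2 \<le> \<bar>x $ i\<bar>) \<longrightarrow> \<eta> x = 0 \<and> grad \<eta> x = 0) \<and> (\<forall>x. norm (grad \<eta> x) \<le> D / R)"
    by (rule cutoff) (rule that; assumption)
  \<comment> \<open>The Poincare constant for the cube of side 3R, without R^2: the 9 stems from
    (3R)^2.\<close>
  define P where "P = 2 ^ CARD('n) * real CARD('n) * 9"
  have P0: "0 \<le> P" by (simp add: P_def)
  show ?thesis
  proof (rule that[of "(\<beta> * D / \<alpha>)\<^sup>2 * P"])
    show "0 \<le> (\<beta> * D / \<alpha>)\<^sup>2 * P" using P0 by simp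
    fix u :: "real^'n \<Rightarrow> real" and g :: "real^'n \<Rightarrow> real^'n" and R :: nat
    assume R: "0 < R" and w: "has_weak_gradient u g" and u: "loc_L2 u" and g: "loc_L2 g"
      and weak: "divergence_free_in (3 * R) (\<lambda>x. A1 x *v g x)"
    obtain \<eta> :: "real^'n \<Rightarrow> real" where \<eta>: "test_function \<eta>" "\<And>x. 0 \<le> \<eta> x" "\<And>x. \<eta> x \<le> 1"
      "\<And>x. x \<in> cube R \<Longrightarrow> \<eta> x = 1" "\<And>x. x \<in> cube R \<Longrightarrow> grad \<eta> x = 0"
      "\<And>x. \<exists>i. 3 * real R / 2 \<le> \<bar>x $ i\<bar> \<Longrightarrow> \<eta> x = 0 \<and> grad \<eta> x = 0" "\<And>x. norm (grad \<eta> x) \<le> D / R"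
      using D(2)[OF R] by blast
    obtain c where c: "(LINT x:cube (3 * R)|lebesgue. (u x - c)\<^sup>2) \<le>
      2 ^ CARD('n) * real CARD('n) * (real (3 * R))\<^sup>2 * (LINT x:cube (3 * (3 * R))|lebesgue. (norm (g x))\<^sup>2)"
      using poincare[OF w u g, of "3 * R"] R by auto
    define v where "v = (\<lambda>x. u x - c)"
    have v: "loc_L2 v" unfolding v_def by (intro loc_L2_diff u loc_L2_const)
    have wv: "has_weak_gradient v g"
      using has_weak_gradient_diff[OF w has_weak_gradient_const[of c]] by (simp add: v_def)
    have m\<eta>: "\<eta> \<in> borel_measurable lebesgue" by (rule borel_lebesgue[OF test_function_borel[OF \<eta>(1)]])
    have m\<eta>': "grad \<eta> \<in> borel_measurable lebesgue" by (rule borel_lebesgue[OF test_function_grad_borel[OF \<eta>(1)]])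
    have \<eta>g: "loc_L2 (\<lambda>x. \<eta> x *\<^sub>R g x)"
      by (rule loc_L2_bound[OF g borel_measurable_scaleR[OF m\<eta> loc_L2_measurable[OF g]], of 1])
         (use \<eta>(2,3) in \<open>simp add: mult_left_le_one_le\<close>)
    have \<eta>v: "loc_L2 (\<lambda>x. \<eta> x * v x)"
      by (rule loc_L2_bound[OF v borel_measurable_times[OF m\<eta> loc_L2_measurable[OF v]], of 1])
         (use \<eta>(2,3) in \<open>simp add: abs_mult mult_left_le_one_le\<close>)
    have v\<eta>: "loc_L2 (\<lambda>x. v x *\<^sub>R grad \<eta> x)"
    proof (rule loc_L2_bound[OF v borel_measurable_scaleR[OF loc_L2_measurable[OF v] m\<eta>']])
      have "norm (v x *\<^sub>R grad \<eta> x) \<le> D / R * norm (v x)" for x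
        unfolding norm_scaleR real_norm_def mult.commute[of "D / R"] by (rule mult_left_mono[OF \<eta>(7)]) simp
      then show "AE x in lebesgue. norm (v x *\<^sub>R grad \<eta> x) \<le> D / R * norm (v x)" by (rule AE_I2)
    qed
    \<comment> \<open>The test function is \<eta>(u - c), with \<eta> to the first power: the energy
      on the shell stays on the right-hand side instead of being absorbed.\<close>
    have "L2_inner (3 * R) (\<lambda>x. A1 x *v g x) (\<lambda>x. \<eta> x *\<^sub>R g x + v x *\<^sub>R grad \<eta> x) = 0"
      by (rule divergence_free_inD[OF weak has_weak_gradient_mult_test_function[OF wv \<eta>(1)] \<eta>v loc_L2_add[OF \<eta>g v\<eta>]])
         (use \<eta>(6) in simp)
    then have eq: "L2_inner (3 * R) (\<lambda>x. A1 x *v g x) (\<lambda>x. \<eta> x *\<^sub>R g x) =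
        - L2_inner (3 * R) (\<lambda>x. A1 x *v g x) (\<lambda>x. v x *\<^sub>R grad \<eta> x)"
      by (simp add: L2_inner_add_right loc_L2_A1 g \<eta>g v\<eta>)
    have "\<alpha> * L2_inner R g g \<le> L2_inner (3 * R) (\<lambda>x. A1 x *v g x) (\<lambda>x. \<eta> x *\<^sub>R g x)"
    proof -
      have i: "set_integrable lebesgue (cube R) (\<lambda>x. \<alpha> * (g x \<bullet> g x))"
        by (intro set_integrable_mult_right loc_L2_inner_integrable g)
      have i': "set_integrable lebesgue (cube (3 * R)) (\<lambda>x. (A1 x *v g x) \<bullet> (\<eta> x *\<^sub>R g x))"
        by (intro loc_L2_inner_integrable loc_L2_A1 g \<eta>g)
      have sub: "cube R \<subseteq> (cube (3 * R) :: (real^'n) set)" by (rule cube_mono) simp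
      have "(LINT x:cube R|lebesgue. \<alpha> * (g x \<bullet> g x)) \<le> (LINT x:cube (3 * R)|lebesgue. (A1 x *v g x) \<bullet> (\<eta> x *\<^sub>R g x))"
        unfolding set_lebesgue_integral_def
      proof (rule integral_mono_AE[OF i[unfolded set_integrable_def] i'[unfolded set_integrable_def]])
        show "AE x in lebesgue. indicat_real (cube R) x *\<^sub>R (\<alpha> * (g x \<bullet> g x)) \<le>
          indicat_real (cube (3 * R)) x *\<^sub>R ((A1 x *v g x) \<bullet> (\<eta> x *\<^sub>R g x))"
          using A1_coercive
        proof eventually_elim
          case (elim x)
          have co: "\<alpha> * (g x \<bullet> g x) \<le> (A1 x *v g x) \<bullet> g x" using elim by (simp add: power2_norm_eq_inner)
          have "0 \<le> \<alpha> * (g x \<bullet> g x)" using \<alpha>_pos by simp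
          then have nn: "0 \<le> \<eta> x * ((A1 x *v g x) \<bullet> g x)" using co \<eta>(2)[of x] by (intro mult_nonneg_nonneg) linarith+
          show ?case
          proof (cases "x \<in> cube R")
            case True
            then show ?thesis using co sub \<eta>(4)[OF True] by (auto simp: indicator_def)
          next
            case False
            then show ?thesis using nn by (simp add: indicator_def)
          qed
        qed
      qed
      then show ?thesis by (simp add: L2_inner_def)
    qed
    note energy = this
    have lower: "(\<alpha> * L2_inner R g g)\<^sup>2 \<le> (L2_inner (3 * R) (\<lambda>x. A1 x *v g x) (\<lambda>x. v x *\<^sub>R grad \<eta> x))\<^sup>2"
    proof -
      have "0 \<le> \<alpha> * L2_inner R g g" using \<alpha>_pos L2_inner_self_nonneg[of R g] by simp
      then have "(\<alpha> * L2_inner R g g)\<^sup>2 \<le> (L2_inner (3 * R) (\<lambda>x. A1 x *v g x) (\<lambda>x. \<eta> x *\<^sub>R g x))\<^sup>2"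
        by (intro power_mono energy)
      then show ?thesis unfolding eq by simp
    qed
    let ?S = "cube (3 * R) - cube R :: (real^'n) set"
    have S: "?S \<in> sets lebesgue" "?S \<subseteq> cube (3 * R)" by (rule sets.Diff[OF cube_lebesgue cube_lebesgue], rule Diff_subset)
    have on_S: "L2_inner (3 * R) (\<lambda>x. A1 x *v g x) (\<lambda>x. v x *\<^sub>R grad \<eta> x) =
        (LINT x:?S|lebesgue. (A1 x *v g x) \<bullet> (v x *\<^sub>R grad \<eta> x))"
      unfolding L2_inner_def set_lebesgue_integral_def
      by (rule Bochner_Integration.integral_cong[OF refl]) (use \<eta>(5) in \<open>auto simp: indicator_def\<close>)
    have "(LINT x:?S|lebesgue. (A1 x *v g x) \<bullet> (v x *\<^sub>R grad \<eta> x))\<^sup>2 \<le> (\<beta> * (D / R))\<^sup>2 * ((LINT x:?S|lebesgue. (norm (g x))\<^sup>2) * (LINT x:?S|lebesgue. (norm (v x))\<^sup>2))"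
    proof (rule loc_L2_Cauchy_Schwarz[OF g v S])
      show "0 \<le> \<beta> * (D / R)" using \<beta>_pos D(1) by simp
      show "(\<lambda>x. (A1 x *v g x) \<bullet> (v x *\<^sub>R grad \<eta> x)) \<in> borel_measurable lebesgue"
        by (rule borel_measurable_inner[OF loc_L2_measurable[OF loc_L2_A1[OF g]] loc_L2_measurable[OF v\<eta>]])
      show "AE x in lebesgue. x \<in> ?S \<longrightarrow> \<bar>(A1 x *v g x) \<bullet> (v x *\<^sub>R grad \<eta> x)\<bar> \<le> \<beta> * (D / R) * (norm (g x) * norm (v x))"
        using A1_bounded
      proof eventually_elim
        case (elim x)
        have "\<bar>(A1 x *v g x) \<bullet> (v x *\<^sub>R grad \<eta> x)\<bar> \<le> norm (A1 x *v g x) * norm (v x *\<^sub>R grad \<eta> x)"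
          by (rule Cauchy_Schwarz_ineq2)
        also have "\<dots> \<le> (\<beta> * norm (g x)) * (norm (v x) * (D / R))"
          unfolding norm_scaleR real_norm_def[symmetric]
          using elim \<eta>(7)[of x] \<beta>_pos by (intro mult_mono) auto
        finally show ?case by (simp add: mult_ac)
      qed
    qed
    moreover have "(LINT x:?S|lebesgue. (norm (g x))\<^sup>2) = L2_inner (3 * R) g g - L2_inner R g g"
    proof -
      have sub: "cube R \<subseteq> (cube (3 * R) :: (real^'n) set)" by (rule cube_mono) simp
      have "(LINT x:cube R \<union> ?S|lebesgue. (norm (g x))\<^sup>2) =
         (LINT x:cube R|lebesgue. (norm (g x))\<^sup>2) + (LINT x:?S|lebesgue. (norm (g x))\<^sup>2)"
        by (rule set_integral_Un)
           (auto intro: loc_L2_square_integrable[OF g] set_integrable_subset[OF loc_L2_square_integrable[OF g] S])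
      moreover have "cube R \<union> ?S = cube (3 * R)" using sub by auto
      ultimately show ?thesis by (simp add: L2_inner_self)
    qed
    ultimately have upper: "(L2_inner (3 * R) (\<lambda>x. A1 x *v g x) (\<lambda>x. v x *\<^sub>R grad \<eta> x))\<^sup>2 \<le>
      (\<beta> * (D / R))\<^sup>2 * ((L2_inner (3 * R) g g - L2_inner R g g) * (LINT x:?S|lebesgue. (norm (v x))\<^sup>2))"
      unfolding on_S by (simp only:)
    have diff0: "0 \<le> L2_inner (3 * R) g g - L2_inner R g g"
      using L2_inner_self_mono[OF g, of R "3 * R"] by simp
    have "(LINT x:?S|lebesgue. (norm (v x))\<^sup>2) \<le> (LINT x:cube (3 * R)|lebesgue. (norm (v x))\<^sup>2)"
      by (rule set_integral_mono_subset[OF loc_L2_square_integrable[OF v] S]) simp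
    also have "\<dots> \<le> P * (real R)\<^sup>2 * L2_inner (9 * R) g g"
      using c by (simp add: v_def P_def L2_inner_self power_mult_distrib mult_ac)
    finally have V: "(LINT x:?S|lebesgue. (norm (v x))\<^sup>2) \<le> P * (real R)\<^sup>2 * L2_inner (9 * R) g g" .
    have "(\<alpha> * L2_inner R g g)\<^sup>2 \<le> (\<beta> * (D / R))\<^sup>2 *
        ((L2_inner (3 * R) g g - L2_inner R g g) * (P * (real R)\<^sup>2 * L2_inner (9 * R) g g))"
      using lower upper mult_left_mono[OF mult_left_mono[OF V diff0], of "(\<beta> * (D / R))\<^sup>2"] by simp
    also have "\<dots> = \<alpha>\<^sup>2 * ((\<beta> * D / \<alpha>)\<^sup>2 * P * (L2_inner (3 * R) g g - L2_inner R g g) * L2_inner (9 * R) g g)"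
      using R \<alpha>_pos by (simp add: power_mult_distrib power_divide)
    finally show "(L2_inner R g g)\<^sup>2 \<le> (\<beta> * D / \<alpha>)\<^sup>2 * P * (L2_inner (3 * R) g g - L2_inner R g g) * L2_inner (9 * R) g g"
      using \<alpha>_pos by (simp add: power_mult_distrib)
  qed
qed

end

context periodic_medium
begin

section \<open>Equations and energies of the correctors\<close>

lemma corrector_eq:
  "is_corrector N B i w \<Longrightarrow> v \<in> H1_per N \<Longrightarrow>
    L2_inner N (\<lambda>x. B x *v (weak_gradient w x + axis i 1)) (weak_gradient v) = 0"
  by (simp add: is_corrector_def L2_inner_def)

lemma loc_L2_corrector_field:
  assumes "is_corrector N B i w" "0 < N"
  shows "loc_L2 (weak_gradient w)" "loc_L2 (\<lambda>x. weak_gradient w x + axis i 1)"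
  using H1_perD(5)[of w N] assms by (auto simp: is_corrector_def intro: loc_L2_add loc_L2_const)

text \<open>A test vanishing off the open cube of side r \<le> N extends periodically to an
  admissible test of the supercell problem, and both cubes give the same integral.\<close>

lemma corrector_divergence_free:
  assumes w: "is_corrector N A1 i w" and N: "r \<le> N" "0 < N"
  shows "divergence_free_in r (\<lambda>x. A1 x *v (weak_gradient w x + axis i 1))"
  unfolding divergence_free_in_def
proof (intro allI impI)
  fix \<psi> :: "real^'n \<Rightarrow> real" and \<gamma>
  assume \<psi>: "has_weak_gradient \<psi> \<gamma>" "loc_L2 \<psi>" "loc_L2 \<gamma>"
      "\<forall>x. (\<exists>i. real r / 2 \<le> \<bar>x $ i\<bar>) \<longrightarrow> \<psi> x = 0 \<and> \<gamma> x = 0"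
  let ?F = "\<lambda>x. A1 x *v (weak_gradient w x + axis i 1)"
  have F: "loc_L2 ?F" by (rule loc_L2_A1[OF loc_L2_corrector_field(2)[OF w N(2)]])
  have z: "\<psi> x = 0 \<and> \<gamma> x = 0" if out: "\<exists>i. real N / 2 \<le> \<bar>x $ i\<bar>" for x
  proof -
    obtain i where "real N / 2 \<le> \<bar>x $ i\<bar>" using out ..
    then have "real r / 2 \<le> \<bar>x $ i\<bar>" using N(1) by linarith
    then show ?thesis using \<psi>(4) by blast
  qed
  obtain v where v: "v \<in> H1_per N" "AE x in lebesgue. x \<in> cube N \<longrightarrow> weak_gradient v x = \<gamma> x"
    using compactly_supported_H1_per[OF N(2) \<psi>(1-3)] z by blast
  have "AE x in lebesgue. x \<in> cube N \<longrightarrow> ?F x \<bullet> \<gamma> x = ?F x \<bullet> weak_gradient v x"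
    using v(2) by eventually_elim simp
  from L2_inner_cong_AE[OF F \<psi>(3) F H1_perD(5)[OF v(1) N(2)] this]
  have "L2_inner N ?F \<gamma> = 0" using corrector_eq[OF w v(1)] by simp
  moreover have "\<forall>x. (\<exists>i. real r / 2 \<le> \<bar>x $ i\<bar>) \<longrightarrow> \<gamma> x = 0" using \<psi>(4) by blast
  ultimately show "L2_inner r ?F \<gamma> = 0" using L2_inner_support[OF _ N(1)] by metis
qed

lemma loc_L2_vector_matrix_mult:
  assumes p: "loc_L2 p" shows "loc_L2 (\<lambda>x. p x v* A x)"
proof (rule loc_L2_bound[OF p])
  show "(\<lambda>x. p x v* A x) \<in> borel_measurable lebesgue"
  proof (rule measurable_vecI)
    fix j
    have "(\<lambda>x. A x $ i) \<in> borel_measurable lebesgue" for i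
      by (rule measurable_compose[OF A_measurable borel_measurable_continuous_onI]) (intro continuous_intros)
    from measurable_nth[OF this] have "(\<lambda>x. A x $ i $ j) \<in> borel_measurable lebesgue" for i .
    then show "(\<lambda>x. (p x v* A x) $ j) \<in> borel_measurable lebesgue"
      unfolding vector_matrix_mult_def using measurable_nth[OF loc_L2_measurable[OF p]] by simp
  qed
  show "AE x in lebesgue. norm (p x v* A x) \<le> \<beta> * norm (p x)"
    using A_bounded
  proof eventually_elim
    case (elim x)
    \<comment> \<open>The hypothesis bounds \<open>A\<close> acting on columns; pairing y with
      itself transfers the bound to the transposed action.\<close>
    let ?y = "p x v* A x"
    have "norm ?y * norm ?y = p x \<bullet> (A x *v ?y)" by (metis dot_lmul_matrix power2_eq_square power2_norm_eq_inner)
    also have "\<dots> \<le> norm (p x) * norm (A x *v ?y)" by (rule norm_cauchy_schwarz)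
    also have "\<dots> \<le> norm (p x) * (\<beta> * norm ?y)" using elim by (intro mult_left_mono) auto
    finally have "norm ?y * norm ?y \<le> norm ?y * (\<beta> * norm (p x))" by (simp add: mult_ac)
    then show ?case
      using \<beta>_pos by (cases "?y = 0") (auto simp: mult_le_cancel_left)
  qed
qed

text \<open>Transposition moves \<open>A\<close> onto p. The transposed field is again 1-periodic,
  so the folding lands on h, underneath the matrix.\<close>

lemma L2_inner_A_tiling:
  assumes p: "periodic 1 p" "loc_L2 p" and h: "loc_L2 h"
  shows "L2_inner (2 * n + 1) (\<lambda>x. A x *v h x) p = L2_inner 1 (\<lambda>x. A x *v (\<Sum>k\<in>cells n. h (x + zvec 1 k))) p"
proof -
  have adj: "L2_inner N (\<lambda>x. A x *v f x) p = L2_inner N (\<lambda>x. p x v* A x) f" for N f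
  proof -
    have "(A x *v f x) \<bullet> p x = (p x v* A x) \<bullet> f x" for x
      unfolding dot_lmul_matrix by (rule inner_commute)
    then show ?thesis by (simp only: L2_inner_def)
  qed
  have "periodic 1 (\<lambda>x. p x v* A x)"
  proof (rule periodicI)
    fix k :: "'n \<Rightarrow> int"
    show "AE x in lebesgue. p (x + zvec 1 k) v* A (x + zvec 1 k) = p x v* A x"
      using periodicD[OF p(1), of k] periodicD[OF A_periodic, of k] by eventually_elim simp
  qed
  from L2_inner_tiling[OF this loc_L2_vector_matrix_mult[OF p(2)] h]
  show ?thesis by (simp only: adj)
qed

text \<open>Folding turns a test function of the supercell into one of the unit cell, where the
  equation of \<open>w0\<close> applies.\<close>

lemma periodic_corrector_eq:
  assumes w0: "is_corrector 1 A i w0" and v: "v \<in> H1_per (2 * n + 1)"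
  shows "L2_inner (2 * n + 1) (\<lambda>x. A x *v (weak_gradient w0 x + axis i 1)) (weak_gradient v) = 0"
proof -
  let ?F = "\<lambda>x. A x *v (weak_gradient w0 x + axis i 1)"
  have N: "0 < 2 * n + 1" by simp
  have w0H: "w0 \<in> H1_per 1" using w0 by (simp add: is_corrector_def)
  have F: "loc_L2 ?F" by (rule loc_L2_A[OF loc_L2_corrector_field(2)[OF w0]]) simp
  note v' = H1_perD(5)[OF v N]
  have "periodic 1 ?F"
  proof (rule periodicI)
    fix k :: "'n \<Rightarrow> int"
    show "AE x in lebesgue. ?F (x + zvec 1 k) = ?F x"
      using periodicD[OF H1_perD(3)[OF w0H zero_less_one], of k] periodicD[OF A_periodic, of k] by eventually_elim simp
  qed
  from L2_inner_tiling[OF this F v']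
  have "L2_inner (2 * n + 1) ?F (weak_gradient v) = L2_inner 1 ?F (\<lambda>x. \<Sum>k\<in>cells n. weak_gradient v (x + zvec 1 k))" .
  also have "\<dots> = L2_inner 1 ?F (weak_gradient (\<lambda>x. \<Sum>k\<in>cells n. v (x + zvec 1 k)))"
  proof (rule L2_inner_cong_AE[OF F _ F])
    show "loc_L2 (\<lambda>x. \<Sum>k\<in>cells n. weak_gradient v (x + zvec 1 k))" by (intro loc_L2_sum loc_L2_translation v')
    show "loc_L2 (weak_gradient (\<lambda>x. \<Sum>k\<in>cells n. v (x + zvec 1 k)))"
      by (rule H1_perD(5)[OF H1_per_sum_cells(1)[OF v]]) simp
    show "AE x in lebesgue. x \<in> cube 1 \<longrightarrow> ?F x \<bullet> (\<Sum>k\<in>cells n. weak_gradient v (x + zvec 1 k)) =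
       ?F x \<bullet> weak_gradient (\<lambda>x. \<Sum>k\<in>cells n. v (x + zvec 1 k)) x"
      using H1_per_sum_cells(2)[OF v] by eventually_elim simp
  qed
  also have "\<dots> = 0" by (rule corrector_eq[OF w0 H1_per_sum_cells(1)[OF v]])
  finally show ?thesis .
qed

lemma H1_per_diff:
  assumes "u \<in> H1_per N" "v \<in> H1_per N" "0 < N"
  shows "(\<lambda>x. u x - v x) \<in> H1_per N"
    "AE x in lebesgue. weak_gradient (\<lambda>x. u x - v x) x = weak_gradient u x - weak_gradient v x"
proof -
  note U = H1_perD[OF assms(1,3)] and V = H1_perD[OF assms(2,3)]
  have p: "periodic N (\<lambda>x. u x - v x)"
  proof (rule periodicI)
    fix k :: "'a \<Rightarrow> int"
    show "AE x in lebesgue. u (x + zvec N k) - v (x + zvec N k) = u x - v x"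
      using periodicD[OF U(2), of k] periodicD[OF V(2), of k] by eventually_elim simp
  qed
  note H = H1_perI[OF has_weak_gradient_diff[OF U(1) V(1)] p loc_L2_diff[OF U(4) V(4)] loc_L2_diff[OF U(5) V(5)]]
  show "(\<lambda>x. u x - v x) \<in> H1_per N" by (rule H(1))
  show "AE x in lebesgue. weak_gradient (\<lambda>x. u x - v x) x = weak_gradient u x - weak_gradient v x" by (rule H(2))
qed

lemma corrector_diff:
  assumes w0: "is_corrector 1 A i w0" and w: "is_corrector (2 * n + 1) A1 i w"
  shows "(\<lambda>x. w x - w0 x) \<in> H1_per (2 * n + 1)"
    "AE x in lebesgue. weak_gradient (\<lambda>x. w x - w0 x) x = weak_gradient w x - weak_gradient w0 x"
proof -
  have "w \<in> H1_per (2 * n + 1)" "w0 \<in> H1_per (2 * n + 1)"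
    using w w0 H1_per_multiple[of w0 1 "2 * n + 1"] by (simp_all add: is_corrector_def)
  from H1_per_diff[OF this] show "(\<lambda>x. w x - w0 x) \<in> H1_per (2 * n + 1)"
    "AE x in lebesgue. weak_gradient (\<lambda>x. w x - w0 x) x = weak_gradient w x - weak_gradient w0 x" by simp_all
qed

text \<open>Test both equations with w - w0 and subtract. Since \<open>A1\<close> and
  \<open>A\<close> differ only on the unit cube, the sole source is C(grad w0 + e_i) there, whose
  norm does not depend on n.\<close>

lemma corrector_energy_bound:
  assumes w0: "is_corrector 1 A i w0" and w: "is_corrector (2 * n + 1) A1 i w"
  defines "\<theta> \<equiv> \<lambda>x. weak_gradient w x - weak_gradient w0 x"
  shows "L2_inner (2 * n + 1) \<theta> \<theta> \<le> (2 * \<beta> / \<alpha>)\<^sup>2 *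
    L2_inner 1 (\<lambda>x. weak_gradient w0 x + axis i 1) (\<lambda>x. weak_gradient w0 x + axis i 1)"
proof -
  let ?N = "2 * n + 1" and ?e = "axis i 1 :: real^'n" and ?v = "\<lambda>x. w x - w0 x"
  have N: "0 < ?N" by simp
  note v = corrector_diff[OF w0 w]
  note g = loc_L2_corrector_field[OF w N] and g0 = loc_L2_corrector_field[OF w0 zero_less_one]
  have \<theta>: "loc_L2 \<theta>" unfolding \<theta>_def by (rule loc_L2_diff[OF g(1) g0(1)])
  have cong: "L2_inner ?N F (weak_gradient ?v) = L2_inner ?N F \<theta>" if F: "loc_L2 F" for F
    by (rule L2_inner_cong_AE[OF F H1_perD(5)[OF v(1) N] F \<theta>])
       (use v(2) in \<open>eventually_elim, simp add: \<theta>_def\<close>)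
  have 1: "L2_inner ?N (\<lambda>x. A1 x *v (weak_gradient w x + ?e)) \<theta> = 0"
    using corrector_eq[OF w v(1)] cong[OF loc_L2_A1[OF g(2)]] by simp
  have 2: "L2_inner ?N (\<lambda>x. A x *v (weak_gradient w0 x + ?e)) \<theta> = 0"
    using periodic_corrector_eq[OF w0 v(1)] cong[OF loc_L2_A[OF g0(2)]] by simp
  have "L2_inner ?N (\<lambda>x. A1 x *v \<theta> x) \<theta> =
    L2_inner ?N (\<lambda>x. A1 x *v (weak_gradient w x + ?e) - A1 x *v (weak_gradient w0 x + ?e)) \<theta>"
    by (simp add: \<theta>_def matrix_vector_mult_diff_distrib[symmetric])
  also have "\<dots> = - L2_inner ?N (\<lambda>x. A1 x *v (weak_gradient w0 x + ?e)) \<theta>"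
    using 1 by (subst L2_inner_diff_left) (simp_all add: loc_L2_A1 g g0 \<theta>)
  also have "\<dots> = - L2_inner 1 (\<lambda>x. C x *v (weak_gradient w0 x + ?e)) \<theta>"
    using 2 by (subst L2_inner_one_defect[OF g0(2) \<theta>]) simp_all
  finally show ?thesis
    by (intro energy_upper_bound[OF A1_measurable A1_bounded A1_coercive \<theta> g0(2)]) auto
qed

text \<open>K counts the nested shells between cubes of sides 3^k that fit into the smaller
  supercell, so K may grow like log n, while c does not depend on n, m or K.\<close>

lemma corrector_gradients_close:
  assumes w0: "is_corrector 1 A i w0"
  obtains c where "\<And>n m w w' K. n \<le> m \<Longrightarrow> is_corrector (2 * n + 1) A1 i w \<Longrightarrow>
    is_corrector (2 * m + 1) A1 i w' \<Longrightarrow> 3 ^ Suc K \<le> 2 * n + 1 \<Longrightarrow>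
    real K * (L2_inner 1 (\<lambda>x. weak_gradient w x - weak_gradient w' x)
      (\<lambda>x. weak_gradient w x - weak_gradient w' x))\<^sup>2 \<le> c"
proof -
  obtain c where c: "0 \<le> c" "\<And>u g R. 0 < R \<Longrightarrow> has_weak_gradient u g \<Longrightarrow> loc_L2 u \<Longrightarrow> loc_L2 g \<Longrightarrow>
    divergence_free_in (3 * R) (\<lambda>x. A1 x *v g x) \<Longrightarrow>
    (L2_inner R g g)\<^sup>2 \<le> c * (L2_inner (3 * R) g g - L2_inner R g g) * L2_inner (9 * R) g g"
    by (rule caccioppoli) (rule that; assumption)
  define T where "T = (2 * \<beta> / \<alpha>)\<^sup>2 * L2_inner 1 (\<lambda>x. weak_gradient w0 x + axis i 1) (\<lambda>x. weak_gradient w0 x + axis i 1)"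
  show ?thesis
  proof (rule that[of "c * (4 * T)\<^sup>2"])
    fix n m w w' K
    assume nm: "n \<le> m" and w: "is_corrector (2 * n + 1) A1 i w" and w': "is_corrector (2 * m + 1) A1 i w'"
      and K: "3 ^ Suc K \<le> 2 * n + (1::nat)"
    let ?e = "axis i 1 :: real^'n"
    let ?g = "\<lambda>x. weak_gradient w x - weak_gradient w' x"
    have N: "0 < 2 * n + 1" "0 < 2 * m + 1" by simp_all
    have wH: "w \<in> H1_per (2 * n + 1)" "w' \<in> H1_per (2 * m + 1)" using w w' by (simp_all add: is_corrector_def)
    note W = H1_perD[OF wH(1) N(1)] and W' = H1_perD[OF wH(2) N(2)]
    note W0 = loc_L2_corrector_field[OF w0 zero_less_one]
    note f = loc_L2_corrector_field(2)[OF w N(1)] loc_L2_corrector_field(2)[OF w' N(2)]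
    have g: "loc_L2 ?g" by (rule loc_L2_diff[OF W(5) W'(5)])
    \<comment> \<open>On the smaller supercell both differences to the periodic corrector have
      energy at most T, the second one by restriction from the larger supercell; this gives 2T +
      2T.\<close>
    have total: "L2_inner (2 * n + 1) ?g ?g \<le> 4 * T"
    proof -
      let ?\<theta> = "\<lambda>x. weak_gradient w x - weak_gradient w0 x" and ?\<theta>' = "\<lambda>x. weak_gradient w' x - weak_gradient w0 x"
      have \<theta>: "loc_L2 ?\<theta>" "loc_L2 ?\<theta>'" by (rule loc_L2_diff[OF W(5) W0(1)], rule loc_L2_diff[OF W'(5) W0(1)])
      have "L2_inner (2 * n + 1) ?\<theta>' ?\<theta>' \<le> L2_inner (2 * m + 1) ?\<theta>' ?\<theta>'"
        using nm by (intro L2_inner_self_mono \<theta>) simp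
      moreover have "L2_inner (2 * m + 1) ?\<theta>' ?\<theta>' \<le> T" "L2_inner (2 * n + 1) ?\<theta> ?\<theta> \<le> T"
        unfolding T_def by (rule corrector_energy_bound[OF w0 w'], rule corrector_energy_bound[OF w0 w])
      moreover have "L2_inner (2 * n + 1) (\<lambda>x. ?\<theta> x - ?\<theta>' x) (\<lambda>x. ?\<theta> x - ?\<theta>' x) \<le>
          2 * L2_inner (2 * n + 1) ?\<theta> ?\<theta> + 2 * L2_inner (2 * n + 1) ?\<theta>' ?\<theta>'"
        by (rule L2_inner_self_diff_le[OF \<theta>])
      ultimately show ?thesis by simp
    qed
    have "real K * (L2_inner (3 ^ 0) ?g ?g)\<^sup>2 \<le> c * (4 * T)\<^sup>2"
    proof (rule iteration_bound[where E="\<lambda>k. L2_inner (3 ^ k) ?g ?g"])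
      show "0 \<le> L2_inner (3 ^ k) ?g ?g" for k by (rule L2_inner_self_nonneg)
      show "L2_inner (3 ^ k) ?g ?g \<le> L2_inner (3 ^ Suc k) ?g ?g" for k by (intro L2_inner_self_mono g) simp
      show "L2_inner (3 ^ Suc K) ?g ?g \<le> 4 * T" using L2_inner_self_mono[OF g K] total by linarith
      show "0 \<le> c" by (rule c(1))
      fix k assume k: "k < K"
      have "3 * 3 ^ k \<le> (3::nat) ^ Suc K" using power_increasing[of "Suc k" "Suc K" "3::nat"] k by simp
      \<comment> \<open>Both equations hold up to side 3^(k+1); as k < K, the outer cube of side
        3^(k+2) still lies within side 3^(K+1).\<close>
      then have le: "3 * 3 ^ k \<le> 2 * n + 1" "3 * 3 ^ k \<le> 2 * m + 1" using K nm by linarith+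
      have "(L2_inner (3 ^ k) ?g ?g)\<^sup>2 \<le> c * (L2_inner (3 * 3 ^ k) ?g ?g - L2_inner (3 ^ k) ?g ?g) * L2_inner (9 * 3 ^ k) ?g ?g"
      proof (rule c(2)[OF _ has_weak_gradient_diff[OF W(1) W'(1)] loc_L2_diff[OF W(4) W'(4)] g])
        have "divergence_free_in (3 * 3 ^ k) (\<lambda>x. A1 x *v (weak_gradient w x + ?e) - A1 x *v (weak_gradient w' x + ?e))"
          by (intro divergence_free_in_diff corrector_divergence_free[OF w le(1) N(1)]
              corrector_divergence_free[OF w' le(2) N(2)] loc_L2_A1 f)
        then show "divergence_free_in (3 * 3 ^ k) (\<lambda>x. A1 x *v ?g x)"
          by (simp add: matrix_vector_mult_diff_distrib[symmetric])
      qed simp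
      then show "(L2_inner (3 ^ k) ?g ?g)\<^sup>2 \<le> c * (L2_inner (3 ^ Suc k) ?g ?g - L2_inner (3 ^ k) ?g ?g) * L2_inner (3 ^ Suc (Suc k)) ?g ?g"
        by simp
    qed
    then show "real K * (L2_inner 1 ?g ?g)\<^sup>2 \<le> c * (4 * T)\<^sup>2" by simp
  qed
qed

text \<open>The defect matrix as a linear functional of a field p: for correctors, p = e_j yields
  the entry in row j and column i, whereas gradients of 1-periodic functions yield 0. Letting p vary
  puts both facts under one identity.\<close>

definition flux :: "nat \<Rightarrow> 'n \<Rightarrow> (real^'n \<Rightarrow> real) \<Rightarrow> (real^'n \<Rightarrow> real) \<Rightarrow> (real^'n \<Rightarrow> real^'n) \<Rightarrow> real" where
  "flux n i w0 w p = L2_inner (2 * n + 1) (\<lambda>x. A1 x *v (weak_gradient w x + axis i 1)) p -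
     L2_inner (2 * n + 1) (\<lambda>x. A x *v (weak_gradient w0 x + axis i 1)) p"

text \<open>Summing over the periodic cells replaces the adjoint corrector: it turns the contribution of
  \<open>A\<close>, which is spread over the whole supercell, into one of a \<open>1\<close>-periodic gradient.\<close>

lemma flux_eq:
  assumes w0: "is_corrector 1 A i w0" and w: "is_corrector (2 * n + 1) A1 i w"
    and p: "periodic 1 p" "loc_L2 p"
  shows "flux n i w0 w p = L2_inner 1 (\<lambda>x. C x *v (weak_gradient w x + axis i 1)) p +
    L2_inner 1 (\<lambda>x. A x *v (\<Sum>k\<in>cells n. weak_gradient w (x + zvec 1 k) - weak_gradient w0 (x + zvec 1 k))) p"
proof -
  let ?N = "2 * n + 1" and ?e = "axis i 1 :: real^'n"
  have N: "0 < ?N" by simp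
  note g = loc_L2_corrector_field[OF w N] and g0 = loc_L2_corrector_field[OF w0 zero_less_one]
  have "L2_inner ?N (\<lambda>x. A x *v (weak_gradient w x + ?e)) p - L2_inner ?N (\<lambda>x. A x *v (weak_gradient w0 x + ?e)) p =
    L2_inner ?N (\<lambda>x. A x *v (weak_gradient w x + ?e) - A x *v (weak_gradient w0 x + ?e)) p"
    by (rule L2_inner_diff_left[OF loc_L2_A[OF g(2)] loc_L2_A[OF g0(2)] p(2), symmetric])
  also have "\<dots> = L2_inner ?N (\<lambda>x. A x *v (weak_gradient w x - weak_gradient w0 x)) p"
    by (simp add: matrix_vector_mult_diff_distrib[symmetric])
  also have "\<dots> = L2_inner 1 (\<lambda>x. A x *v (\<Sum>k\<in>cells n. weak_gradient w (x + zvec 1 k) - weak_gradient w0 (x + zvec 1 k))) p"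
    by (rule L2_inner_A_tiling[OF p loc_L2_diff[OF g(1) g0(1)]])
  finally show ?thesis
    unfolding flux_def using L2_inner_one_defect[OF g(2) p(2), of ?N] by simp
qed

text \<open>Two uses of \<open>flux_eq\<close>. Against 1-periodic gradients the fluxes vanish,
  which is an equation on the unit torus for the folded difference \<Theta> with source C\<delta>,
  so the energy of \<delta> controls that of \<Theta>. Against e_j the fluxes are matrix entries,
  and \<delta> and \<Theta> bound their difference. The constant combines the bounds 2\<beta> for
  \<open>C\<close> and \<beta> for \<open>A\<close> with (x + y)^2 \<le> 2x^2 + 2y^2.\<close>

lemma flux_difference_bound:
  assumes w0: "is_corrector 1 A i w0" and w: "is_corrector (2 * n + 1) A1 i w"
    and w': "is_corrector (2 * m + 1) A1 i w'"
  defines "\<delta> \<equiv> \<lambda>x. weak_gradient w x - weak_gradient w' x"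
  shows "(flux n i w0 w (\<lambda>x. axis j 1) - flux m i w0 w' (\<lambda>x. axis j 1))\<^sup>2 \<le>
    (8 * \<beta>\<^sup>2 + 2 * \<beta>\<^sup>2 * (2 * \<beta> / \<alpha>)\<^sup>2) * L2_inner 1 \<delta> \<delta>"
proof -
  let ?e = "axis i 1 :: real^'n"
  let ?Z = "\<lambda>x. \<Sum>k\<in>cells n. weak_gradient w (x + zvec 1 k) - weak_gradient w0 (x + zvec 1 k)"
  let ?Z' = "\<lambda>x. \<Sum>k\<in>cells m. weak_gradient w' (x + zvec 1 k) - weak_gradient w0 (x + zvec 1 k)"
  let ?\<Theta> = "\<lambda>x. ?Z x - ?Z' x"
  have N: "0 < 2 * n + 1" "0 < 2 * m + 1" by simp_all
  note g = loc_L2_corrector_field[OF w N(1)] and g' = loc_L2_corrector_field[OF w' N(2)]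
    and g0 = loc_L2_corrector_field[OF w0 zero_less_one]
  have Z: "loc_L2 ?Z" "loc_L2 ?Z'"
    by (intro loc_L2_sum loc_L2_diff loc_L2_translation g g' g0)+
  have \<Theta>: "loc_L2 ?\<Theta>" by (rule loc_L2_diff[OF Z])
  have \<delta>: "loc_L2 \<delta>" unfolding \<delta>_def by (rule loc_L2_diff[OF g(1) g'(1)])
  have diff: "flux n i w0 w p - flux m i w0 w' p = L2_inner 1 (\<lambda>x. C x *v \<delta> x) p + L2_inner 1 (\<lambda>x. A x *v ?\<Theta> x) p"
    if p: "periodic 1 p" "loc_L2 p" for p
  proof -
    have "L2_inner 1 (\<lambda>x. C x *v \<delta> x) p =
       L2_inner 1 (\<lambda>x. C x *v (weak_gradient w x + ?e) - C x *v (weak_gradient w' x + ?e)) p"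
      by (simp add: \<delta>_def matrix_vector_mult_diff_distrib[symmetric])
    also have "\<dots> = L2_inner 1 (\<lambda>x. C x *v (weak_gradient w x + ?e)) p - L2_inner 1 (\<lambda>x. C x *v (weak_gradient w' x + ?e)) p"
      by (rule L2_inner_diff_left[OF loc_L2_C[OF g(2)] loc_L2_C[OF g'(2)] p(2)])
    finally have c: "L2_inner 1 (\<lambda>x. C x *v \<delta> x) p =
      L2_inner 1 (\<lambda>x. C x *v (weak_gradient w x + ?e)) p - L2_inner 1 (\<lambda>x. C x *v (weak_gradient w' x + ?e)) p" .
    have "L2_inner 1 (\<lambda>x. A x *v ?\<Theta> x) p = L2_inner 1 (\<lambda>x. A x *v ?Z x - A x *v ?Z' x) p"
      by (simp only: matrix_vector_mult_diff_distrib)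
    also have "\<dots> = L2_inner 1 (\<lambda>x. A x *v ?Z x) p - L2_inner 1 (\<lambda>x. A x *v ?Z' x) p"
      by (rule L2_inner_diff_left[OF loc_L2_A[OF Z(1)] loc_L2_A[OF Z(2)] p(2)])
    finally have a: "L2_inner 1 (\<lambda>x. A x *v ?\<Theta> x) p = L2_inner 1 (\<lambda>x. A x *v ?Z x) p - L2_inner 1 (\<lambda>x. A x *v ?Z' x) p" .
    show ?thesis unfolding a flux_eq[OF w0 w p] flux_eq[OF w0 w' p] c by linarith
  qed
  \<comment> \<open>A 1-periodic function is also (2n+1)-periodic, hence admissible in the supercell
    equation, and both terms of the flux vanish.\<close>
  have flux0: "flux n i w0 w (weak_gradient v) = 0" if "v \<in> H1_per 1" "is_corrector (2 * n + 1) A1 i w" for v n w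
  proof -
    have v: "v \<in> H1_per (2 * n + 1)" using H1_per_multiple[OF that(1), of "2 * n + 1"] by simp
    show ?thesis unfolding flux_def
      using corrector_eq[OF that(2) v] periodic_corrector_eq[OF w0 v] by simp
  qed
  note v = corrector_diff[OF w0 w] and v' = corrector_diff[OF w0 w']
  note s = H1_per_sum_cells[OF v(1)] and s' = H1_per_sum_cells[OF v'(1)]
  \<comment> \<open>A 1-periodic potential of \<Theta>: each corrector difference is folded over its
    own supercell, which makes functions of different periods comparable.\<close>
  define V where "V = (\<lambda>x. (\<Sum>k\<in>cells n. w (x + zvec 1 k) - w0 (x + zvec 1 k)) -
     (\<Sum>k\<in>cells m. w' (x + zvec 1 k) - w0 (x + zvec 1 k)))"
  have V: "V \<in> H1_per 1" unfolding V_def by (rule H1_per_diff(1)[OF s(1) s'(1) zero_less_one])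
  have AE_cells: "AE x in lebesgue. \<forall>k\<in>cells n. weak_gradient u (x + zvec 1 k) = h (x + zvec 1 k)"
    if "AE x in lebesgue. weak_gradient u x = h x" for n u and h :: "real^'n \<Rightarrow> real^'n"
    using AE_translation[OF that] by (intro AE_finite_allI) auto
  have Vgrad: "AE x in lebesgue. weak_gradient V x = ?\<Theta> x"
    using H1_per_diff(2)[OF s(1) s'(1) zero_less_one] s(2) s'(2) AE_cells[OF v(2), of n] AE_cells[OF v'(2), of m]
  proof eventually_elim
    case (elim x)
    have "(\<Sum>k\<in>cells n. weak_gradient (\<lambda>x. w x - w0 x) (x + zvec 1 k)) = ?Z x"
      by (rule sum.cong[OF refl]) (rule bspec[OF elim(4)])
    moreover have "(\<Sum>k\<in>cells m. weak_gradient (\<lambda>x. w' x - w0 x) (x + zvec 1 k)) = ?Z' x"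
      by (rule sum.cong[OF refl]) (rule bspec[OF elim(5)])
    ultimately show ?case unfolding V_def elim(1) elim(2) elim(3) by (simp only:)
  qed
  have eqV: "L2_inner 1 (\<lambda>x. A x *v ?\<Theta> x) (weak_gradient V) = - L2_inner 1 (\<lambda>x. C x *v \<delta> x) (weak_gradient V)"
    using diff[OF H1_perD(3,5)[OF V zero_less_one]] unfolding flux0[OF V w] flux0[OF V w'] by linarith
  have \<Theta>V: "L2_inner 1 F (weak_gradient V) = L2_inner 1 F ?\<Theta>" if F: "loc_L2 F" for F
    by (rule L2_inner_cong_AE[OF F H1_perD(5)[OF V zero_less_one] F \<Theta>])
       (use Vgrad in \<open>eventually_elim, simp only: simp_thms\<close>)
  \<comment> \<open>Almost everywhere \<Theta> is the gradient of \<open>V\<close>, so it may serve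
    as the test in its own equation.\<close>
  have "L2_inner 1 (\<lambda>x. A x *v ?\<Theta> x) ?\<Theta> = - L2_inner 1 (\<lambda>x. C x *v \<delta> x) ?\<Theta>"
    using eqV unfolding \<Theta>V[OF loc_L2_A[OF \<Theta>]] \<Theta>V[OF loc_L2_C[OF \<delta>]] .
  then have \<Theta>\<delta>: "L2_inner 1 ?\<Theta> ?\<Theta> \<le> (2 * \<beta> / \<alpha>)\<^sup>2 * L2_inner 1 \<delta> \<delta>"
    by (rule energy_upper_bound[OF A_measurable A_bounded A_coercive \<Theta> \<delta> order_refl])
  \<comment> \<open>A nonzero constant field is 1-periodic but not the gradient of a periodic
    function, so the flux against it need not vanish.\<close>
  let ?p = "\<lambda>x::real^'n. axis j 1 :: real^'n"
  have p: "periodic 1 ?p" "loc_L2 ?p" by (simp_all add: periodic_def loc_L2_const)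
  have p1: "L2_inner 1 ?p ?p = 1"
    unfolding L2_inner_def using measure_cube[where 'n='n, of 1]
    by (simp add: set_lebesgue_integral_def inner_axis_axis)
  let ?X = "L2_inner 1 (\<lambda>x. C x *v \<delta> x) ?p" and ?Y = "L2_inner 1 (\<lambda>x. A x *v ?\<Theta> x) ?p"
  have "?X\<^sup>2 \<le> (2 * \<beta>)\<^sup>2 * L2_inner 1 \<delta> \<delta>"
    using C_inner_bound[OF _ \<delta> p(2), of 1] \<beta>_pos unfolding p1 by simp
  moreover have "?Y\<^sup>2 \<le> \<beta>\<^sup>2 * L2_inner 1 ?\<Theta> ?\<Theta>"
    using L2_inner_matrix_bound[OF A_measurable A_bounded less_imp_le[OF \<beta>_pos] \<Theta> p(2), of 1]
    unfolding p1 mult_1_right .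
  moreover have "\<beta>\<^sup>2 * L2_inner 1 ?\<Theta> ?\<Theta> \<le> \<beta>\<^sup>2 * ((2 * \<beta> / \<alpha>)\<^sup>2 * L2_inner 1 \<delta> \<delta>)"
    using \<Theta>\<delta> by (rule mult_left_mono) simp
  moreover have "(?X + ?Y)\<^sup>2 \<le> 2 * ?X\<^sup>2 + 2 * ?Y\<^sup>2"
    using sum_squares_bound[of ?X ?Y] unfolding power2_sum by linarith
  ultimately have "(?X + ?Y)\<^sup>2 \<le> 2 * ((2 * \<beta>)\<^sup>2 * L2_inner 1 \<delta> \<delta>) + 2 * (\<beta>\<^sup>2 * ((2 * \<beta> / \<alpha>)\<^sup>2 * L2_inner 1 \<delta> \<delta>))"
    by linarith
  also have "\<dots> = (8 * \<beta>\<^sup>2 + 2 * \<beta>\<^sup>2 * (2 * \<beta> / \<alpha>)\<^sup>2) * L2_inner 1 \<delta> \<delta>"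
    by (simp add: power_mult_distrib algebra_simps)
  finally show ?thesis unfolding diff[OF p] .
qed

lemma flux_convergent:
  assumes w0: "is_corrector 1 A i w0" and w: "\<And>n. is_corrector (2 * n + 1) A1 i (w n)"
  shows "convergent (\<lambda>n. flux n i w0 (w n) (\<lambda>x. axis j 1))"
proof -
  let ?D = "\<lambda>n. flux n i w0 (w n) (\<lambda>x. axis j 1)"
  let ?\<delta> = "\<lambda>n m x. weak_gradient (w n) x - weak_gradient (w m) x"
  define L where "L = 8 * \<beta>\<^sup>2 + 2 * \<beta>\<^sup>2 * (2 * \<beta> / \<alpha>)\<^sup>2"
  have L: "0 < L" using \<beta>_pos by (auto simp: L_def intro!: add_pos_nonneg)
  obtain c where c: "\<And>n m w w' K. n \<le> m \<Longrightarrow> is_corrector (2 * n + 1) A1 i w \<Longrightarrow>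
    is_corrector (2 * m + 1) A1 i w' \<Longrightarrow> 3 ^ Suc K \<le> 2 * n + 1 \<Longrightarrow>
    real K * (L2_inner 1 (\<lambda>x. weak_gradient w x - weak_gradient w' x)
      (\<lambda>x. weak_gradient w x - weak_gradient w' x))\<^sup>2 \<le> c"
    by (rule corrector_gradients_close[OF w0]) (rule that; assumption)
  have "Cauchy ?D"
  proof (rule metric_CauchyI)
    fix e :: real assume e: "0 < e"
    \<comment> \<open>Energy distance below \<epsilon> on the unit cube gives flux distance below e;
      K is then taken so large that the bound c on K times the squared energy forces this.\<close>
    define \<epsilon> where "\<epsilon> = e\<^sup>2 / L"
    have \<epsilon>: "0 < \<epsilon>" using e L by (simp add: \<epsilon>_def)
    obtain K :: nat where K: "c < real K * \<epsilon>\<^sup>2" using reals_Archimedean3[of "\<epsilon>\<^sup>2"] \<epsilon> by auto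
    have main: "dist (?D n) (?D m) < e" if nm: "3 ^ Suc K \<le> n" "n \<le> m" for n m
    proof -
      let ?d = "L2_inner 1 (?\<delta> n m) (?\<delta> n m)"
      have "real K * ?d\<^sup>2 \<le> c" by (rule c[OF nm(2) w w]) (use nm(1) in linarith)
      then have "real K * ?d\<^sup>2 < real K * \<epsilon>\<^sup>2" using K by linarith
      then have "?d\<^sup>2 < \<epsilon>\<^sup>2" by (rule mult_left_less_imp_less) simp
      then have "?d < \<epsilon>" by (rule power_less_imp_less_base) (use \<epsilon> in simp)
      have "(?D n - ?D m)\<^sup>2 \<le> L * ?d" unfolding L_def by (rule flux_difference_bound[OF w0 w w])
      also have "\<dots> < L * \<epsilon>" using \<open>?d < \<epsilon>\<close> L by simp
      also have "\<dots> = e\<^sup>2" using L by (simp add: \<epsilon>_def)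
      finally have "\<bar>?D n - ?D m\<bar>\<^sup>2 < e\<^sup>2" by simp
      then have "\<bar>?D n - ?D m\<bar> < e" by (rule power_less_imp_less_base) (use e in simp)
      then show ?thesis by (simp add: dist_real_def)
    qed
    show "\<exists>M. \<forall>m\<ge>M. \<forall>n\<ge>M. dist (?D m) (?D n) < e"
    proof (intro exI allI impI)
      fix m n :: nat assume "3 ^ Suc K \<le> m" "3 ^ Suc K \<le> n"
      then show "dist (?D m) (?D n) < e" using main[of m n] main[of n m] by (cases "m \<le> n") (auto simp: dist_commute)
    qed
  qed
  then show ?thesis by (rule Cauchy_convergent)
qed

end

theorem proposition2:
  fixes Aper Cper :: "real^'n::finite \<Rightarrow> real^'n^'n"
    and \<alpha> \<beta> :: real
    and w0 :: "'n \<Rightarrow> real^'n \<Rightarrow> real"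
    and w1 :: "nat \<Rightarrow> 'n \<Rightarrow> real^'n \<Rightarrow> real"
    and A1 :: "nat \<Rightarrow> real^'n^'n"
  assumes "Aper \<in> borel_measurable lebesgue" and "Cper \<in> borel_measurable lebesgue"
    and "periodic 1 Aper" and "periodic 1 Cper"
    and "0 < \<alpha>" and "\<alpha> \<le> \<beta>"
    and "\<And>\<xi>. AE x in lebesgue. \<alpha> * (norm \<xi>)\<^sup>2 \<le> (Aper x *v \<xi>) \<bullet> \<xi>"
    and "\<And>\<xi>. AE x in lebesgue. \<alpha> * (norm \<xi>)\<^sup>2 \<le> ((Aper x + Cper x) *v \<xi>) \<bullet> \<xi>"
    and "\<And>\<xi>. AE x in lebesgue. norm (Aper x *v \<xi>) \<le> \<beta> * norm \<xi>"
    and "\<And>\<xi>. AE x in lebesgue. norm ((Aper x + Cper x) *v \<xi>) \<le> \<beta> * norm \<xi>"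
    and "\<And>i. is_corrector 1 Aper i (w0 i)"
    and "\<And>N i. odd N \<Longrightarrow> is_corrector N (one_defect Aper Cper) i (w1 N i)"
    and "\<And>N i. odd N \<Longrightarrow>
      A1 N *v axis i 1 =
        (LINT x:cube N|lebesgue.
           one_defect Aper Cper x *v (weak_gradient (w1 N i) x + axis i 1)) -
        (LINT x:cube N|lebesgue. Aper x *v (weak_gradient (w0 i) x + axis i 1))"
  shows "\<exists>L. (\<lambda>n. A1 (2 * n + 1)) \<longlonglongrightarrow> L"
proof -
  \<comment> \<open>The bounds are assumed for each \<xi> separately, while the locale asks for one
    null set valid for all \<xi>.\<close>
  interpret medium: periodic_medium Aper Cper \<alpha> \<beta>
  proof
    show "0 < \<beta>" using assms(5,6) by linarith
  qed (fact assms(1,2,3,5) AE_coercive_all[OF assms(7)] AE_coercive_all[OF assms(8)]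
         AE_bounded_all[OF assms(9)] AE_bounded_all[OF assms(10)])+
  have w: "is_corrector (2 * n + 1) (one_defect Aper Cper) i (w1 (2 * n + 1) i)" for n i
    by (rule assms(12)) simp
  \<comment> \<open>Column i of the matrix is its value at e_i; pairing with e_j turns the two
    vector integrals into the scalar products in \<open>flux\<close>.\<close>
  have entry: "A1 (2 * n + 1) $ j $ i = medium.flux n i (w0 i) (w1 (2 * n + 1) i) (\<lambda>x. axis j 1)" for n i j
  proof -
    let ?N = "2 * n + 1"
    have inner: "(LINT x:cube ?N|lebesgue. F x) \<bullet> axis j 1 = L2_inner ?N F (\<lambda>x. axis j 1)"
      if F: "loc_L2 F" for F :: "real^'n \<Rightarrow> real^'n"
    proof -
      have "integrable lebesgue (\<lambda>x. indicat_real (cube ?N) x *\<^sub>R F x)"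
        using loc_L2_locally_integrable[OF F] by (simp add: locally_integrable_iff_cube set_integrable_def)
      from integral_inner_left[OF this, of "axis j 1"] show ?thesis
        by (simp add: L2_inner_def set_lebesgue_integral_def)
    qed
    have "A1 ?N $ j $ i = (A1 ?N *v axis i 1) \<bullet> axis j 1"
      unfolding matrix_vector_mult_basis by (simp add: column_def inner_axis)
    also have "\<dots> = medium.flux n i (w0 i) (w1 ?N i) (\<lambda>x. axis j 1)"
    proof -
      have F: "loc_L2 (\<lambda>x. one_defect Aper Cper x *v (weak_gradient (w1 ?N i) x + axis i 1))"
        by (rule medium.loc_L2_A1[OF medium.loc_L2_corrector_field(2)[OF w]]) simp
      have F0: "loc_L2 (\<lambda>x. Aper x *v (weak_gradient (w0 i) x + axis i 1))"
        by (rule medium.loc_L2_A[OF medium.loc_L2_corrector_field(2)[OF assms(11)]]) simp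
      have "odd ?N" by simp
      show ?thesis unfolding assms(13)[OF \<open>odd ?N\<close>] medium.flux_def inner_diff_left inner[OF F] inner[OF F0] ..
    qed
    finally show ?thesis .
  qed
  have "convergent (\<lambda>n. A1 (2 * n + 1) $ j $ i)" for i j
    unfolding entry by (rule medium.flux_convergent[OF assms(11) w])
  then have "(\<lambda>n. A1 (2 * n + 1) $ j $ i) \<longlonglongrightarrow> lim (\<lambda>n. A1 (2 * n + 1) $ j $ i)" for i j
    unfolding convergent_LIMSEQ_iff .
  then have "(\<lambda>n. A1 (2 * n + 1)) \<longlonglongrightarrow> (\<chi> j i. lim (\<lambda>n. A1 (2 * n + 1) $ j $ i))"
    by (intro vec_tendstoI) (simp only: vec_lambda_beta)
  then show ?thesis by (rule exI)
qed

end
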